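(* Let $(B^n,g_B)$ be a complete Riemannian manifold with two smooth functions $f>0$ and $\varphi$ satisfying $$Ric+\nabla^{2}\varphi=\lambda g_B+\frac{m}{f}\nabla^{2}f$$ and $$2\lambda\varphi-|\nabla\varphi|^{2}+\Delta\varphi+\frac{m}{f}\nabla\varphi(f)=c$$ on $B$, for some constants $c,\lambda\in\mathbb{R}$ and some integer $m>1$, where $Ric$ is the Ricci tensor of $g_B$. Let $\mu\in\mathbb{R}$ be the constant satisfying $$\lambda f^{2}+f\Delta f+(m-1)|\nabla f|^{2}-f\nabla\varphi(f)=\mu$$ on $B$, and let $(F^m,g_F)$ be a complete Riemannian manifold of dimension $m$ with Ricci tensor ${}^F\!Ric=\mu g_F$. Then $(B^n\times_f F^m,g,\nabla\tilde\varphi,\lambda)$ is a gradient Ricci soliton, where $g$ is the warped product metric and $\tilde\varphi=\varphi\circ\pi$ is the lift of $\varphi$ to $B\times F$.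
   Context: Manifolds are smooth and connected. On $B$, the gradient $\nabla$, Hessian $\nabla^2$, Laplacian $\Delta=\mathrm{tr}(\nabla^2)$ and norms are with respect to $g_B$, and $\nabla\varphi(f)=g_B(\nabla\varphi,\nabla f)$. Given Riemannian manifolds $(B^n,g_B)$, $(F^m,g_F)$ of dimensions $n,m$ and a positive smooth function $f$ on $B$, the warped product $B\times_f F$ is the manifold $B\times F$ with the metric $g=\pi^*g_B+(f\circ\pi)^2\sigma^*g_F$, where $\pi:B\times F\to B$ and $\sigma:B\times F\to F$ are the projections. A gradient Ricci soliton $(M,g,\nabla\psi,\lambda)$ is a complete Riemannian manifold $(M,g)$ with a smooth function $\psi$ on $M$ and a constant $\lambda\in\mathbb{R}$ such that $Ric+\nabla^2\psi=\lambda g$, where $\nabla^2\psi$ is the Hessian of $\psi$ with respect to $g$. *)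

theory Defs
  imports "HOL-Analysis.Analysis"
begin

text \<open>
  A manifold is a type of class t2_space and second_countable_topology (the underlying point set
  and its topology) together with a smooth atlas modelled on a Euclidean space 'a, whose dimension
  DIM('a) is the dimension of the manifold.  The atlas need not be maximal; it generates the
  smooth structure.  The components below refer to the standard basis of 'a.
\<close>

section \<open>Smooth maps between Euclidean spaces\<close>

abbreviation pd :: "'a::euclidean_space \<Rightarrow> ('a \<Rightarrow> 'b::real_normed_vector) \<Rightarrow> 'a \<Rightarrow> 'b" where
  "pd v h z \<equiv> frechet_derivative h (at z) v"

primrec Ck_on :: "nat \<Rightarrow> 'a::euclidean_space set \<Rightarrow> ('a \<Rightarrow> 'b::real_normed_vector) \<Rightarrow> bool" where
  "Ck_on 0 S h \<longleftrightarrow> continuous_on S h"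
| "Ck_on (Suc k) S h \<longleftrightarrow> (\<forall>z\<in>S. h differentiable (at z)) \<and> (\<forall>i\<in>Basis. Ck_on k S (pd i h))"

text \<open>Only meaningful (and only used) for open sets.\<close>

definition smooth_on :: "'a::euclidean_space set \<Rightarrow> ('a \<Rightarrow> 'b::real_normed_vector) \<Rightarrow> bool" where
  "smooth_on S h \<longleftrightarrow> (\<forall>k. Ck_on k S h)"

section \<open>Smooth manifolds\<close>

text \<open>
  A chart is a pair of its domain and its coordinate map; values of the coordinate map outside
  the domain are irrelevant.
\<close>

type_synonym ('p, 'a) chart = "'p set \<times> ('p \<Rightarrow> 'a)"

abbreviation chart_inv :: "('p, 'a) chart \<Rightarrow> 'a \<Rightarrow> 'p" where
  "chart_inv c \<equiv> inv_into (fst c) (snd c)"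

definition smooth_atlas ::
    "('p::{t2_space,second_countable_topology}, 'a::euclidean_space) chart set \<Rightarrow> bool" where
  "smooth_atlas A \<longleftrightarrow>
     (\<forall>c\<in>A. open (fst c) \<and> open (snd c ` fst c) \<and>
        homeomorphism (fst c) (snd c ` fst c) (snd c) (chart_inv c)) \<and>
     (\<Union>c\<in>A. fst c) = UNIV \<and>
     (\<forall>c\<in>A. \<forall>d\<in>A. smooth_on (snd c ` (fst c \<inter> fst d)) (snd d \<circ> chart_inv c))"

definition smooth_manifold ::
    "('p::{t2_space,second_countable_topology}, 'a::euclidean_space) chart set \<Rightarrow> bool" where
  "smooth_manifold A \<longleftrightarrow> smooth_atlas A \<and> connected (UNIV :: 'p set)"

definition smooth_fun :: "('p, 'a::euclidean_space) chart set \<Rightarrow> ('p \<Rightarrow> real) \<Rightarrow> bool" where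
  "smooth_fun A h \<longleftrightarrow> (\<forall>c\<in>A. smooth_on (snd c ` fst c) (h \<circ> chart_inv c))"

definition smooth_at ::
    "('p::topological_space, 'a::euclidean_space) chart set \<Rightarrow> ('p \<Rightarrow> real) \<Rightarrow> 'p \<Rightarrow> bool" where
  "smooth_at A h p \<longleftrightarrow> (\<exists>W. open W \<and> p \<in> W \<and>
     (\<forall>c\<in>A. smooth_on (snd c ` (fst c \<inter> W)) (h \<circ> chart_inv c)))"

section \<open>Tangent vectors\<close>

text \<open>
  A tangent vector at p is a directional derivative operator acting on the functions that are
  smooth near p; to make this a determinate functional it is set to 0 on all other functions.
  coord_vec A c p u is the vector with components u in the chart c, so that
  coord_vec A c p i, for i in Basis, is the coordinate vector usually written d/dx^i.
\<close>

type_synonym 'p tvec = "('p \<Rightarrow> real) \<Rightarrow> real"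

definition coord_vec ::
    "('p::topological_space, 'a::euclidean_space) chart set \<Rightarrow> ('p, 'a) chart \<Rightarrow> 'p \<Rightarrow> 'a \<Rightarrow> 'p tvec" where
  "coord_vec A c p u =
     (\<lambda>h. if smooth_at A h p then pd u (h \<circ> chart_inv c) (snd c p) else 0)"

definition tangent_space ::
    "('p::topological_space, 'a::euclidean_space) chart set \<Rightarrow> 'p \<Rightarrow> 'p tvec set" where
  "tangent_space A p = {coord_vec A c p u | c u. c \<in> A \<and> p \<in> fst c}"

text \<open>The differential at p of a map F into the manifold with atlas A.\<close>

definition push_forward ::
    "('q::topological_space, 'a::euclidean_space) chart set \<Rightarrow> ('p \<Rightarrow> 'q) \<Rightarrow> 'p \<Rightarrow> 'p tvec \<Rightarrow> 'q tvec" where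
  "push_forward A F p X = (\<lambda>h. if smooth_at A h (F p) then X (h \<circ> F) else 0)"

section \<open>Riemannian metrics\<close>

type_synonym 'p metric = "'p \<Rightarrow> 'p tvec \<Rightarrow> 'p tvec \<Rightarrow> real"

definition metric_comp ::
    "('p::topological_space, 'a::euclidean_space) chart set \<Rightarrow> 'p metric \<Rightarrow> ('p, 'a) chart
      \<Rightarrow> 'a \<Rightarrow> 'a \<Rightarrow> 'p \<Rightarrow> real" where
  "metric_comp A g c i j p = g p (coord_vec A c p i) (coord_vec A c p j)"

definition riemannian_metric ::
    "('p::topological_space, 'a::euclidean_space) chart set \<Rightarrow> 'p metric \<Rightarrow> bool" where
  "riemannian_metric A g \<longleftrightarrow>
     (\<forall>p. \<forall>X\<in>tangent_space A p. \<forall>Y\<in>tangent_space A p. \<forall>Z\<in>tangent_space A p. \<forall>a b.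
        g p (\<lambda>h. a * X h + b * Y h) Z = a * g p X Z + b * g p Y Z) \<and>
     (\<forall>p. \<forall>X\<in>tangent_space A p. \<forall>Y\<in>tangent_space A p. g p X Y = g p Y X) \<and>
     (\<forall>p. \<forall>X\<in>tangent_space A p. X \<noteq> (\<lambda>_. 0) \<longrightarrow> g p X X > 0) \<and>
     (\<forall>c\<in>A. \<forall>i\<in>Basis. \<forall>j\<in>Basis.
        smooth_on (snd c ` fst c) (metric_comp A g c i j \<circ> chart_inv c))"

definition riemannian_manifold ::
    "('p::{t2_space,second_countable_topology}, 'a::euclidean_space) chart set \<Rightarrow> 'p metric \<Rightarrow> bool" where
  "riemannian_manifold A g \<longleftrightarrow> smooth_manifold A \<and> riemannian_metric A g"

section \<open>Completeness\<close>

text \<open>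
  C1 on the closed interval, with one-sided derivatives at the end points.
\<close>

definition C1_curve ::
    "('p::topological_space, 'a::euclidean_space) chart set \<Rightarrow> (real \<Rightarrow> 'p) \<Rightarrow> real \<Rightarrow> real \<Rightarrow> bool" where
  "C1_curve A \<gamma> a b \<longleftrightarrow> continuous_on {a..b} \<gamma> \<and>
     (\<forall>c\<in>A. \<exists>D. continuous_on {t\<in>{a..b}. \<gamma> t \<in> fst c} D \<and>
        (\<forall>t\<in>{a..b}. \<gamma> t \<in> fst c \<longrightarrow>
           ((snd c \<circ> \<gamma>) has_vector_derivative D t) (at t within {a..b})))"

text \<open>The finite set S consists of the break points.\<close>

definition piecewise_C1_curve ::
    "('p::topological_space, 'a::euclidean_space) chart set \<Rightarrow> (real \<Rightarrow> 'p) \<Rightarrow> real \<Rightarrow> real \<Rightarrow> bool" where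
  "piecewise_C1_curve A \<gamma> a b \<longleftrightarrow> continuous_on {a..b} \<gamma> \<and>
     (\<exists>S. finite S \<and>
        (\<forall>s t. a \<le> s \<and> s < t \<and> t \<le> b \<and> {s<..<t} \<inter> S = {} \<longrightarrow> C1_curve A \<gamma> s t))"

definition velocity ::
    "('p::topological_space, 'a::euclidean_space) chart set \<Rightarrow> (real \<Rightarrow> 'p) \<Rightarrow> real \<Rightarrow> 'p tvec" where
  "velocity A \<gamma> t = (\<lambda>h. if smooth_at A h (\<gamma> t) then vector_derivative (h \<circ> \<gamma>) (at t) else 0)"

text \<open>
  For piecewise C1 curves the integrand is bounded, and continuous off a finite set (at whose
  points, as at a and b, velocity may be meaningless), hence integrable.
\<close>

definition curve_length ::
    "('p::topological_space, 'a::euclidean_space) chart set \<Rightarrow> 'p metric \<Rightarrow> (real \<Rightarrow> 'p)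
      \<Rightarrow> real \<Rightarrow> real \<Rightarrow> real" where
  "curve_length A g \<gamma> a b =
     integral {a..b} (\<lambda>t. sqrt (g (\<gamma> t) (velocity A \<gamma> t) (velocity A \<gamma> t)))"

definition riem_dist ::
    "('p::topological_space, 'a::euclidean_space) chart set \<Rightarrow> 'p metric \<Rightarrow> 'p \<Rightarrow> 'p \<Rightarrow> real" where
  "riem_dist A g p q =
     Inf {curve_length A g \<gamma> a b | \<gamma> a b.
            a < b \<and> piecewise_C1_curve A \<gamma> a b \<and> \<gamma> a = p \<and> \<gamma> b = q}"

text \<open>Completeness of the Riemannian distance (by Hopf-Rinow the same as geodesic completeness).\<close>

definition complete_riemannian_manifold ::
    "('p::{t2_space,second_countable_topology}, 'a::euclidean_space) chart set \<Rightarrow> 'p metric \<Rightarrow> bool" where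
  "complete_riemannian_manifold A g \<longleftrightarrow> riemannian_manifold A g \<and>
     (\<forall>s :: nat \<Rightarrow> 'p.
        (\<forall>e>0. \<exists>N. \<forall>m\<ge>N. \<forall>n\<ge>N. riem_dist A g (s m) (s n) < e) \<longrightarrow>
        (\<exists>p. (\<lambda>n. riem_dist A g (s n) p) \<longlonglongrightarrow> 0))"

section \<open>Tensor calculus in coordinates\<close>

text \<open>
  Here G i j z are the components of a metric at the point of 'a with coordinates z, for basis
  vectors i and j.  The inverse matrix is obtained by inverting the linear map with matrix G.
\<close>

type_synonym 'a coord_metric = "'a \<Rightarrow> 'a \<Rightarrow> 'a \<Rightarrow> real"

definition ginv :: "'a::euclidean_space coord_metric \<Rightarrow> 'a coord_metric" where
  "ginv G i j z =
     inv (\<lambda>v::'a. \<Sum>k\<in>Basis. (\<Sum>l\<in>Basis. G k l z * (v \<bullet> l)) *\<^sub>R k) j \<bullet> i"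

definition christoffel ::
    "'a::euclidean_space coord_metric \<Rightarrow> 'a \<Rightarrow> 'a \<Rightarrow> 'a \<Rightarrow> 'a \<Rightarrow> real" where
  "christoffel G k i j z =
     (\<Sum>l\<in>Basis. ginv G k l z * (pd i (G j l) z + pd j (G i l) z - pd l (G i j) z)) / 2"

text \<open>The coefficient of d/dx^l in R(d/dx^i, d/dx^j) d/dx^k, where
  R(X,Y) = [nabla_X, nabla_Y] - nabla_[X,Y].\<close>

definition coord_riemann ::
    "'a::euclidean_space coord_metric \<Rightarrow> 'a \<Rightarrow> 'a \<Rightarrow> 'a \<Rightarrow> 'a \<Rightarrow> 'a \<Rightarrow> real" where
  "coord_riemann G l i j k z =
     pd i (christoffel G l j k) z - pd j (christoffel G l i k) z +
     (\<Sum>m\<in>Basis. christoffel G l i m z * christoffel G m j k z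
                - christoffel G l j m z * christoffel G m i k z)"

text \<open>Ric(Y,Z) is the trace of the map taking X to R(X,Y)Z.\<close>

definition coord_ricci :: "'a::euclidean_space coord_metric \<Rightarrow> 'a \<Rightarrow> 'a \<Rightarrow> 'a \<Rightarrow> real" where
  "coord_ricci G j k z = (\<Sum>i\<in>Basis. coord_riemann G i i j k z)"

definition coord_hess ::
    "'a::euclidean_space coord_metric \<Rightarrow> ('a \<Rightarrow> real) \<Rightarrow> 'a \<Rightarrow> 'a \<Rightarrow> 'a \<Rightarrow> real" where
  "coord_hess G h i j z = pd i (pd j h) z - (\<Sum>k\<in>Basis. christoffel G k i j z * pd k h z)"

definition coord_laplacian ::
    "'a::euclidean_space coord_metric \<Rightarrow> ('a \<Rightarrow> real) \<Rightarrow> 'a \<Rightarrow> real" where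
  "coord_laplacian G h z = (\<Sum>i\<in>Basis. \<Sum>j\<in>Basis. ginv G i j z * coord_hess G h i j z)"

definition coord_grad :: "'a::euclidean_space coord_metric \<Rightarrow> ('a \<Rightarrow> real) \<Rightarrow> 'a \<Rightarrow> 'a" where
  "coord_grad G h z = (\<Sum>i\<in>Basis. (\<Sum>j\<in>Basis. ginv G i j z * pd j h z) *\<^sub>R i)"

section \<open>The same quantities on a Riemannian manifold\<close>

abbreviation local_metric ::
    "('p::topological_space, 'a::euclidean_space) chart set \<Rightarrow> 'p metric \<Rightarrow> ('p, 'a) chart
      \<Rightarrow> 'a coord_metric" where
  "local_metric A g c \<equiv> (\<lambda>i j. metric_comp A g c i j \<circ> chart_inv c)"

definition ricci ::
    "('p::topological_space, 'a::euclidean_space) chart set \<Rightarrow> 'p metric \<Rightarrow> ('p, 'a) chart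
      \<Rightarrow> 'a \<Rightarrow> 'a \<Rightarrow> 'p \<Rightarrow> real" where
  "ricci A g c i j p = coord_ricci (local_metric A g c) i j (snd c p)"

definition hess ::
    "('p::topological_space, 'a::euclidean_space) chart set \<Rightarrow> 'p metric \<Rightarrow> ('p, 'a) chart
      \<Rightarrow> ('p \<Rightarrow> real) \<Rightarrow> 'a \<Rightarrow> 'a \<Rightarrow> 'p \<Rightarrow> real" where
  "hess A g c h i j p = coord_hess (local_metric A g c) (h \<circ> chart_inv c) i j (snd c p)"

definition laplacian ::
    "('p::topological_space, 'a::euclidean_space) chart set \<Rightarrow> 'p metric \<Rightarrow> ('p, 'a) chart
      \<Rightarrow> ('p \<Rightarrow> real) \<Rightarrow> 'p \<Rightarrow> real" where
  "laplacian A g c h p = coord_laplacian (local_metric A g c) (h \<circ> chart_inv c) (snd c p)"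

definition grad ::
    "('p::topological_space, 'a::euclidean_space) chart set \<Rightarrow> 'p metric \<Rightarrow> ('p, 'a) chart
      \<Rightarrow> ('p \<Rightarrow> real) \<Rightarrow> 'p \<Rightarrow> 'p tvec" where
  "grad A g c h p =
     coord_vec A c p (coord_grad (local_metric A g c) (h \<circ> chart_inv c) (snd c p))"

section \<open>Warped products and gradient Ricci solitons\<close>

definition prod_atlas ::
    "('p, 'a::euclidean_space) chart set \<Rightarrow> ('q, 'b::euclidean_space) chart set
      \<Rightarrow> ('p \<times> 'q, 'a \<times> 'b) chart set" where
  "prod_atlas A C = {(fst c \<times> fst d, map_prod (snd c) (snd d)) | c d. c \<in> A \<and> d \<in> C}"

definition warped_metric ::
    "('p::topological_space, 'a::euclidean_space) chart set \<Rightarrow> 'p metric \<Rightarrow> ('p \<Rightarrow> real)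
      \<Rightarrow> ('q::topological_space, 'b::euclidean_space) chart set \<Rightarrow> 'q metric
      \<Rightarrow> ('p \<times> 'q) metric" where
  "warped_metric A gB f C gF = (\<lambda>x X Y.
     gB (fst x) (push_forward A fst x X) (push_forward A fst x Y) +
     (f (fst x))\<^sup>2 * gF (snd x) (push_forward C snd x X) (push_forward C snd x Y))"

text \<open>
  As everywhere, an identity between tensor fields is stated for the components in every chart
  of the atlas.
\<close>

definition gradient_ricci_soliton ::
    "('p::{t2_space,second_countable_topology}, 'a::euclidean_space) chart set \<Rightarrow> 'p metric
      \<Rightarrow> ('p \<Rightarrow> real) \<Rightarrow> real \<Rightarrow> bool" where
  "gradient_ricci_soliton A g \<psi> lam \<longleftrightarrow>
     complete_riemannian_manifold A g \<and> smooth_fun A \<psi> \<and>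
     (\<forall>c\<in>A. \<forall>p\<in>fst c. \<forall>i\<in>Basis. \<forall>j\<in>Basis.
        ricci A g c i j p + hess A g c \<psi> i j p = lam * metric_comp A g c i j p)"

end

theory Submission
  imports Defs
begin

text \<open>
  In a product chart the Christoffel symbols of g are those of the two factors together with
  (f_i / f) delta^a_b and - f f^i h_ab, where h is the metric of F.  Hence the Ricci tensor of g is
  Ric - (m/f) Hess f on the base, Ric_F - (f Laplace f + (m - 1) |grad f|^2) h on the fibre, and 0
  on mixed vectors, while the Hessian of the lift of phi is Hess phi on the base and
  f <grad phi, grad f> h on the fibre; the two equations for f and phi and Ric_F = mu h make the sum
  lambda g.

  For completeness, projecting to B does not increase lengths, so a Cauchy sequence of g projects to
  a Cauchy sequence of B, with a limit p.  Curves of small length near p stay in a compact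
  coordinate ball, where f is bounded below by some delta > 0; there, projecting to F increases
  lengths by a factor of at most 1/delta, so the F-components are Cauchy as well.
\<close>

text \<open>The curvature identity is required only in the charts of \<open>prod_atlas\<close>, each
  of which is a product of two charts, so a block-diagonal computation in one such chart suffices
  and no transformation law of tensors enters. Its awkward point is that the inverse metric is
  defined by inverting a map, with no formula to differentiate: \<open>pd_ginv\<close> gets its
  derivative from nabla g = 0, and this is also what turns the divergence of grad f, in which form
  second derivatives of \<open>f\<close> enter the fibre part of the Ricci tensor, into the
  Laplacian.

  The obstacle for completeness is that \<open>f\<close> may have infimum 0, so that no global
  multiple of the distance of the product bounds the fibre distance. The bound is available only for
  curves whose base projection stays near the limit point, and this confinement is proved directly
  from lengths, because the distance is known only as an infimum over curves. The infimum says
  something only if there are curves to take it over, which is where connectedness enters.\<close>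

section \<open>Calculus of smooth functions on open sets\<close>

lemma pd_eqI: "(h has_derivative D) (at z) \<Longrightarrow> pd v h z = D v"
  by (metis frechet_derivative_at)

lemma pd_has_derivative: "h differentiable (at z) \<Longrightarrow> (h has_derivative (\<lambda>v. pd v h z)) (at z)"
  using frechet_derivative_works by blast

lemma pd_cong:
  assumes "open S" "z \<in> S" "\<And>y. y \<in> S \<Longrightarrow> h y = k y"
  shows "pd v h z = pd v k z"
proof -
  have "(h has_derivative D) (at z) \<longleftrightarrow> (k has_derivative D) (at z)" for D
    using assms has_derivative_transform_within_open[OF _ assms(1,2), of h _ UNIV k]
      has_derivative_transform_within_open[OF _ assms(1,2), of k _ UNIV h] by auto
  then show ?thesis by (simp add: frechet_derivative_def)
qed

lemma differentiable_cong_open: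
  assumes "open S" "z \<in> S" "\<And>y. y \<in> S \<Longrightarrow> h y = k y"
  shows "h differentiable (at z) \<longleftrightarrow> k differentiable (at z)"
  using assms has_derivative_transform_within_open[OF _ assms(1,2), of h _ UNIV k]
      has_derivative_transform_within_open[OF _ assms(1,2), of k _ UNIV h]
  unfolding differentiable_def by auto

lemma pd_linear: "h differentiable (at z) \<Longrightarrow> linear (\<lambda>v. pd v h z)"
  using pd_has_derivative has_derivative_linear by blast

lemma pd_const [simp]: "pd v (\<lambda>_. k) z = 0"
  by (rule pd_eqI) (auto intro!: derivative_eq_intros)

lemma pd_add:
  "\<lbrakk>h differentiable (at z); k differentiable (at z)\<rbrakk> \<Longrightarrow> pd v (\<lambda>y. h y + k y) z = pd v h z + pd v k z"
  by (rule pd_eqI) (auto intro!: derivative_eq_intros pd_has_derivative)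

lemma pd_minus:
  "h differentiable (at z) \<Longrightarrow> pd v (\<lambda>y. - h y) z = - pd v h z"
  by (rule pd_eqI) (auto intro!: derivative_eq_intros pd_has_derivative)

lemma pd_sum:
  "(\<And>i. i \<in> I \<Longrightarrow> h i differentiable (at z)) \<Longrightarrow> pd v (\<lambda>y. \<Sum>i\<in>I. h i y) z = (\<Sum>i\<in>I. pd v (h i) z)"
  by (rule pd_eqI) (auto intro!: derivative_eq_intros pd_has_derivative)

lemma pd_mult:
  fixes h k :: "'a::euclidean_space \<Rightarrow> real"
  shows "\<lbrakk>h differentiable (at z); k differentiable (at z)\<rbrakk> \<Longrightarrow>
    pd v (\<lambda>y. h y * k y) z = pd v h z * k z + h z * pd v k z"
  by (rule pd_eqI) (auto intro!: derivative_eq_intros pd_has_derivative simp: algebra_simps)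

lemma pd_divide:
  fixes h k :: "'a::euclidean_space \<Rightarrow> real"
  assumes "h differentiable (at z)" "k differentiable (at z)" "k z \<noteq> 0"
  shows "pd v (\<lambda>y. h y / k y) z = pd v h z / k z - h z * pd v k z / (k z)\<^sup>2"
proof (rule pd_eqI)
  show "((\<lambda>y. h y / k y) has_derivative (\<lambda>v. pd v h z / k z - h z * pd v k z / (k z)\<^sup>2)) (at z)"
    using has_derivative_divide[OF pd_has_derivative[OF assms(1)] pd_has_derivative[OF assms(2)] assms(3)]
    by (rule has_derivative_eq_rhs) (auto simp: fun_eq_iff field_simps power2_eq_square assms(3))
qed

lemma pd_bounded_linear:
  "\<lbrakk>bounded_linear L; h differentiable (at z)\<rbrakk> \<Longrightarrow> pd v (\<lambda>y. L (h y)) z = L (pd v h z)"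
  by (rule pd_eqI) (rule bounded_linear.has_derivative[OF _ pd_has_derivative])

lemma has_derivative_fst_comp:
  "(h has_derivative D) (at (fst x)) \<Longrightarrow> ((\<lambda>y. h (fst y)) has_derivative (\<lambda>v. D (fst v))) (at x)"
  by (rule has_derivative_compose[of fst fst, OF _ , simplified]) (auto intro!: derivative_eq_intros)

lemma has_derivative_snd_comp:
  "(h has_derivative D) (at (snd x)) \<Longrightarrow> ((\<lambda>y. h (snd y)) has_derivative (\<lambda>v. D (snd v))) (at x)"
  by (rule has_derivative_compose[of snd snd, OF _ , simplified]) (auto intro!: derivative_eq_intros)

lemma differentiable_fst_comp:
  "h differentiable (at (fst x)) \<Longrightarrow> (\<lambda>y. h (fst y)) differentiable (at x)"
  using has_derivative_fst_comp unfolding differentiable_def by blast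

lemma differentiable_snd_comp:
  "h differentiable (at (snd x)) \<Longrightarrow> (\<lambda>y. h (snd y)) differentiable (at x)"
  using has_derivative_snd_comp unfolding differentiable_def by blast

lemma pd_fst_comp: "h differentiable (at (fst x)) \<Longrightarrow> pd v (\<lambda>y. h (fst y)) x = pd (fst v) h (fst x)"
  by (rule pd_eqI) (rule has_derivative_fst_comp, rule pd_has_derivative)

lemma pd_snd_comp: "h differentiable (at (snd x)) \<Longrightarrow> pd v (\<lambda>y. h (snd y)) x = pd (snd v) h (snd x)"
  by (rule pd_eqI) (rule has_derivative_snd_comp, rule pd_has_derivative)

text \<open>A basis vector \<open>(i, 0)\<close> of a product differentiates functions of the second
  factor along 0. Without differentiability \<open>pd 0 h z\<close> would be the value of an
  arbitrary choice.\<close>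

lemma pd_0: "h differentiable (at z) \<Longrightarrow> pd 0 h z = 0"
  using pd_linear linear_0 by blast

text \<open>\<open>Ck_on\<close> speaks of basis directions only; continuity of a derivative along
  an arbitrary \<open>v\<close> is reached through this sum.\<close>

lemma pd_Basis_sum:
  assumes "h differentiable (at z)"
  shows "pd v h z = (\<Sum>i\<in>Basis. (v \<bullet> i) *\<^sub>R pd i h z)"
proof -
  have "pd v h z = pd (\<Sum>i\<in>Basis. (v \<bullet> i) *\<^sub>R i) h z" by (simp add: euclidean_representation)
  also have "\<dots> = (\<Sum>i\<in>Basis. (v \<bullet> i) *\<^sub>R pd i h z)"
    using pd_linear[OF assms] by (simp add: linear_sum linear_cmul)
  finally show ?thesis .
qed

section \<open>Closure properties of C^k and smooth functions\<close>

text \<open>The rules for sums, products and compositions compute a derivative only at points of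
  \<open>S\<close>, so the inductions below exchange the true derivative for its formula on
  \<open>S\<close>. Openness makes the values on \<open>S\<close> determine the derivatives
  there.\<close>

lemma Ck_on_cong:
  assumes "open S" "\<And>z. z \<in> S \<Longrightarrow> h z = k z"
  shows "Ck_on n S h \<longleftrightarrow> Ck_on n S k"
  using assms(2)
proof (induction n arbitrary: h k)
  case 0
  then show ?case using continuous_on_cong by auto
next
  case (Suc n)
  have "pd i h z = pd i k z" "h differentiable (at z) \<longleftrightarrow> k differentiable (at z)" if "z \<in> S" for i z
    using pd_cong[OF assms(1) that] differentiable_cong_open[OF assms(1) that] Suc.prems by blast+
  then have "Ck_on n S (pd i h) \<longleftrightarrow> Ck_on n S (pd i k)" for i by (intro Suc.IH) 
  then show ?case using \<open>\<And>i z. z \<in> S \<Longrightarrow> h differentiable (at z) \<longleftrightarrow> k differentiable (at z)\<close> by auto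
qed

text \<open>\<open>Ck_on (Suc n)\<close> does not contain \<open>Ck_on n\<close> by definition. The
  product rule needs it, since one factor stays undifferentiated.\<close>

lemma Ck_on_SucD: "Ck_on (Suc n) S h \<Longrightarrow> Ck_on n S h"
proof (induction n arbitrary: h)
  case 0
  then show ?case
    by (simp add: continuous_at_imp_continuous_on differentiable_imp_continuous_within)
qed auto

lemma Ck_on_const: "Ck_on n S (\<lambda>_. k)"
proof (induction n arbitrary: k)
  case (Suc n)
  have "pd i (\<lambda>_::'a. k) = (\<lambda>_. 0)" for i by (auto simp: fun_eq_iff)
  then show ?case using Suc[of 0] by auto
qed simp

lemma Ck_on_add:
  assumes "open S"
  shows "\<lbrakk>Ck_on n S h; Ck_on n S k\<rbrakk> \<Longrightarrow> Ck_on n S (\<lambda>z. h z + k z)"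
proof (induction n arbitrary: h k)
  case (Suc n)
  have "Ck_on n S (pd i (\<lambda>z. h z + k z))" if "i \<in> Basis" for i
    using Suc that by (subst Ck_on_cong[OF assms, of _ "\<lambda>z. pd i h z + pd i k z"]) (auto intro!: pd_add)
  then show ?case using Suc.prems by auto
qed (auto intro: continuous_intros)

lemma Ck_on_mult:
  fixes h k :: "'a::euclidean_space \<Rightarrow> real"
  assumes "open S"
  shows "\<lbrakk>Ck_on n S h; Ck_on n S k\<rbrakk> \<Longrightarrow> Ck_on n S (\<lambda>z. h z * k z)"
proof (induction n arbitrary: h k)
  case (Suc n)
  have "Ck_on n S (pd i (\<lambda>z. h z * k z))" if "i \<in> Basis" for i
    using Suc that Suc.prems[THEN Ck_on_SucD]
    by (subst Ck_on_cong[OF assms, of _ "\<lambda>z. pd i h z * k z + h z * pd i k z"])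
      (auto intro!: pd_mult Ck_on_add[OF assms])
  then show ?case using Suc.prems by auto
qed (auto intro: continuous_intros)

lemma Ck_on_bounded_linear:
  assumes "open S" "bounded_linear L"
  shows "Ck_on n S h \<Longrightarrow> Ck_on n S (\<lambda>z. L (h z))"
proof (induction n arbitrary: h)
  case (Suc n)
  have "Ck_on n S (pd i (\<lambda>z. L (h z)))" if "i \<in> Basis" for i
    using Suc that assms(2)
    by (subst Ck_on_cong[OF assms(1), of _ "\<lambda>z. L (pd i h z)"]) (auto intro!: pd_bounded_linear)
  moreover have "(\<lambda>z. L (h z)) differentiable (at z)" if "z \<in> S" for z
    using Suc.prems that bounded_linear.has_derivative[OF assms(2)] unfolding differentiable_def
    by (metis Ck_on.simps(2) differentiable_def)
  ultimately show ?case by auto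
qed (use assms(2) bounded_linear.continuous_on in auto)

lemma Ck_on_fst_comp:
  assumes "open S" "open T"
  shows "Ck_on n S h \<Longrightarrow> Ck_on n (S \<times> T) (\<lambda>y. h (fst y))"
proof (induction n arbitrary: h)
  case (Suc n)
  have "Ck_on n (S \<times> T) (pd i (\<lambda>y. h (fst y)))" if "i \<in> Basis" for i :: "'a \<times> 'b"
  proof -
    have eq: "pd i (\<lambda>y. h (fst y)) z = pd (fst i) h (fst z)" if "z \<in> S \<times> T" for z
      using that Suc.prems by (intro pd_fst_comp) auto
    \<comment> \<open>\<open>fst i\<close> is a basis vector or 0. The hypothesis on
      \<open>h\<close> covers the first case; in the second the derivative is the zero
      function.\<close>
    have "Ck_on n S (pd (fst i) h)"
    proof (cases "fst i = 0")
      case True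
      have "pd (fst i) h z = 0" if "z \<in> S" for z
        using that Suc.prems by (auto simp: True pd_0)
      then show ?thesis by (subst Ck_on_cong[OF assms(1), of _ "\<lambda>_. 0"]) (auto simp: Ck_on_const)
    next
      case False
      then show ?thesis using Suc.prems \<open>i \<in> Basis\<close> by (auto simp: Basis_prod_def)
    qed
    then show ?thesis
      using Ck_on_cong[OF open_Times[OF assms] eq, of "\<lambda>z. z"] Suc.IH by simp
  qed
  then show ?case using Suc.prems by (auto intro!: differentiable_fst_comp)
next
  case 0
  then have "continuous_on S h" by simp
  then show ?case by (auto intro!: continuous_on_compose2[of S h _ fst] continuous_on_fst continuous_on_id)
qed

lemma Ck_on_snd_comp:
  assumes "open S" "open T"
  shows "Ck_on n T h \<Longrightarrow> Ck_on n (S \<times> T) (\<lambda>y. h (snd y))"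
proof (induction n arbitrary: h)
  case (Suc n)
  have "Ck_on n (S \<times> T) (pd i (\<lambda>y. h (snd y)))" if "i \<in> Basis" for i :: "'a \<times> 'b"
  proof -
    have eq: "pd i (\<lambda>y. h (snd y)) z = pd (snd i) h (snd z)" if "z \<in> S \<times> T" for z
      using that Suc.prems by (intro pd_snd_comp) auto
    have "Ck_on n T (pd (snd i) h)"
    proof (cases "snd i = 0")
      case True
      have "pd (snd i) h z = 0" if "z \<in> T" for z
        using that Suc.prems by (auto simp: True pd_0)
      then show ?thesis by (subst Ck_on_cong[OF assms(2), of _ "\<lambda>_. 0"]) (auto simp: Ck_on_const)
    next
      case False
      then show ?thesis using Suc.prems \<open>i \<in> Basis\<close> by (auto simp: Basis_prod_def)
    qed
    then show ?thesis
      using Ck_on_cong[OF open_Times[OF assms] eq, of "\<lambda>z. z"] Suc.IH by simp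
  qed
  then show ?case using Suc.prems by (auto intro!: differentiable_snd_comp)
next
  case 0
  then have "continuous_on T h" by simp
  then show ?case by (auto intro!: continuous_on_compose2[of T h _ snd] continuous_on_snd continuous_on_id)
qed

lemma smooth_on_cong:
  "\<lbrakk>open S; \<And>z. z \<in> S \<Longrightarrow> h z = k z\<rbrakk> \<Longrightarrow> smooth_on S h \<longleftrightarrow> smooth_on S k"
  using Ck_on_cong unfolding smooth_on_def by blast

lemma smooth_on_const: "smooth_on S (\<lambda>_. k)"
  by (simp add: smooth_on_def Ck_on_const)

lemma smooth_on_add:
  "\<lbrakk>open S; smooth_on S h; smooth_on S k\<rbrakk> \<Longrightarrow> smooth_on S (\<lambda>z. h z + k z)"
  by (simp add: smooth_on_def Ck_on_add)

lemma smooth_on_mult: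
  fixes h k :: "'a::euclidean_space \<Rightarrow> real"
  shows "\<lbrakk>open S; smooth_on S h; smooth_on S k\<rbrakk> \<Longrightarrow> smooth_on S (\<lambda>z. h z * k z)"
  by (simp add: smooth_on_def Ck_on_mult)

lemma smooth_on_bounded_linear:
  "\<lbrakk>open S; bounded_linear L; smooth_on S h\<rbrakk> \<Longrightarrow> smooth_on S (\<lambda>z. L (h z))"
  by (simp add: smooth_on_def Ck_on_bounded_linear)

lemma smooth_on_fst_comp:
  "\<lbrakk>open S; open T; smooth_on S h\<rbrakk> \<Longrightarrow> smooth_on (S \<times> T) (\<lambda>y. h (fst y))"
  by (simp add: smooth_on_def Ck_on_fst_comp)

lemma smooth_on_snd_comp:
  "\<lbrakk>open S; open T; smooth_on T h\<rbrakk> \<Longrightarrow> smooth_on (S \<times> T) (\<lambda>y. h (snd y))"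
  by (simp add: smooth_on_def Ck_on_snd_comp)

lemma smooth_on_continuous: "smooth_on S h \<Longrightarrow> continuous_on S h"
  unfolding smooth_on_def by (metis Ck_on.simps(1))

lemma smooth_on_pd: "\<lbrakk>smooth_on S h; i \<in> Basis\<rbrakk> \<Longrightarrow> smooth_on S (pd i h)"
  unfolding smooth_on_def by (metis Ck_on.simps(2))

lemma smooth_on_differentiable: "\<lbrakk>smooth_on S h; z \<in> S\<rbrakk> \<Longrightarrow> h differentiable (at z)"
  unfolding smooth_on_def by (metis Ck_on.simps(2))

section \<open>Metrics in coordinates\<close>

lemma sum_delta_Basis [simp]:
  fixes h :: "'a::euclidean_space \<Rightarrow> real"
  assumes "j \<in> Basis"
  shows "(\<Sum>l\<in>Basis. h l * (if l = j then 1 else 0)) = h j"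
    and "(\<Sum>l\<in>Basis. h l * (if j = l then 1 else 0)) = h j"
    and "(\<Sum>l\<in>Basis. (if l = j then 1 else 0) * h l) = h j"
    and "(\<Sum>l\<in>Basis. (if j = l then 1 else 0) * h l) = h j"
  using assms by (simp_all add: if_distrib if_distribR sum.delta sum.delta' cong: if_cong)

text \<open>The map inside \<open>ginv\<close>: lowering an index with \<open>G\<close>. Identities
  for the inverse matrix are read off from its bijectivity.\<close>

definition metric_map :: "'a::euclidean_space coord_metric \<Rightarrow> 'a \<Rightarrow> 'a \<Rightarrow> 'a" where
  "metric_map G z v = (\<Sum>k\<in>Basis. (\<Sum>l\<in>Basis. G k l z * (v \<bullet> l)) *\<^sub>R k)"

lemma ginv_metric_map: "ginv G i j z = inv (metric_map G z) j \<bullet> i"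
  unfolding ginv_def metric_map_def ..

lemma metric_map_inner:
  "k \<in> Basis \<Longrightarrow> metric_map G z v \<bullet> k = (\<Sum>l\<in>Basis. G k l z * (v \<bullet> l))"
  unfolding metric_map_def by (simp add: inner_sum_left inner_Basis)

lemma linear_metric_map: "linear (metric_map G z)"
  unfolding metric_map_def
  by (intro linearI)
    (simp_all add: inner_add_left algebra_simps sum.distrib scaleR_sum_right sum_distrib_left)

lemma coord_grad_inner:
  "i \<in> Basis \<Longrightarrow> coord_grad G h z \<bullet> i = (\<Sum>j\<in>Basis. ginv G i j z * pd j h z)"
  unfolding coord_grad_def by (simp add: inner_sum_left inner_Basis)

text \<open>What one chart sees of a Riemannian manifold. Positivity is put as a property of the
  quadratic form, from which invertibility of the matrix follows at once.\<close>

locale coord_metric_on =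
  fixes U :: "'a::euclidean_space set" and G :: "'a coord_metric"
  assumes open_domain: "open U"
    and symm: "\<lbrakk>z \<in> U; i \<in> Basis; j \<in> Basis\<rbrakk> \<Longrightarrow> G i j z = G j i z"
    and pos: "\<lbrakk>z \<in> U; v \<noteq> 0\<rbrakk> \<Longrightarrow> 0 < (\<Sum>i\<in>Basis. \<Sum>j\<in>Basis. G i j z * (v \<bullet> i) * (v \<bullet> j))"
    and smooth: "\<lbrakk>i \<in> Basis; j \<in> Basis\<rbrakk> \<Longrightarrow> smooth_on U (G i j)"
begin

text \<open>Pairing \<open>metric_map G z v\<close> with \<open>v\<close> gives the quadratic form,
  so the kernel is 0; in finite dimension injectivity gives surjectivity.\<close>

lemma bij_metric_map:
  assumes "z \<in> U"
  shows "bij (metric_map G z)"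
proof -
  have "v = 0" if "metric_map G z v = 0" for v
  proof (rule ccontr)
    assume "v \<noteq> 0"
    have "0 = v \<bullet> metric_map G z v" using that by simp
    also have "\<dots> = (\<Sum>k\<in>Basis. (v \<bullet> k) * (metric_map G z v \<bullet> k))"
      by (rule euclidean_inner)
    also have "\<dots> = (\<Sum>i\<in>Basis. \<Sum>j\<in>Basis. G i j z * (v \<bullet> i) * (v \<bullet> j))"
      by (simp add: metric_map_inner sum_distrib_left mult_ac)
    finally show False using pos[OF assms \<open>v \<noteq> 0\<close>] by simp
  qed
  then have "inj (metric_map G z)"
    using linear_injective_0[OF linear_metric_map] by blast
  then show ?thesis
    using linear_injective_imp_surjective[OF linear_metric_map] by (auto simp: bij_def)
qed

lemma metric_ginv:
  assumes "z \<in> U" "k \<in> Basis" "j \<in> Basis"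
  shows "(\<Sum>l\<in>Basis. G k l z * ginv G l j z) = (if k = j then 1 else 0)"
proof -
  have "metric_map G z (inv (metric_map G z) j) = j"
    using bij_metric_map[OF assms(1)] by (simp add: bij_def surj_f_inv_f)
  then have "metric_map G z (inv (metric_map G z) j) \<bullet> k = (if k = j then 1 else 0)"
    using assms by (auto simp: inner_Basis)
  then show ?thesis by (simp add: metric_map_inner[OF assms(2)] ginv_metric_map)
qed

text \<open>Lets the inverse of a concrete matrix, later a block-diagonal one, be identified by
  checking a candidate column.\<close>

lemma ginv_unique:
  assumes "z \<in> U" "j \<in> Basis" "l \<in> Basis"
    and H: "\<And>k. k \<in> Basis \<Longrightarrow> (\<Sum>l\<in>Basis. G k l z * H l) = (if k = j then 1 else 0)"
  shows "ginv G l j z = H l"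
proof -
  define w where "w = (\<Sum>l\<in>Basis. H l *\<^sub>R l)"
  have w: "w \<bullet> l = H l" if "l \<in> Basis" for l
    using that by (simp add: w_def inner_sum_left inner_Basis)
  have "metric_map G z w \<bullet> k = j \<bullet> k" if "k \<in> Basis" for k
    using H[OF that] that assms(2) by (simp add: metric_map_inner w inner_Basis eq_commute)
  then have "metric_map G z w = j" using euclidean_eqI by blast
  then have "inv (metric_map G z) j = w"
    using bij_metric_map[OF assms(1)] by (metis bij_inv_eq_iff)
  then show ?thesis by (simp add: ginv_metric_map w assms(3))
qed

text \<open>Both entries equal the double sum of \<open>ginv G k i * G k l * ginv G l j\<close>:
  cancel \<open>G\<close> against the right factor or, by its symmetry, against the left
  one.\<close>

lemma ginv_symm:
  assumes "z \<in> U" "i \<in> Basis" "j \<in> Basis"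
  shows "ginv G i j z = ginv G j i z"
proof -
  have "ginv G j i z = (\<Sum>k\<in>Basis. ginv G k i z * (\<Sum>l\<in>Basis. G k l z * ginv G l j z))"
    using assms by (simp add: metric_ginv)
  also have "\<dots> = (\<Sum>k\<in>Basis. \<Sum>l\<in>Basis. G l k z * ginv G k i z * ginv G l j z)"
    using assms by (auto simp: sum_distrib_left symm mult_ac intro!: sum.cong)
  also have "\<dots> = (\<Sum>l\<in>Basis. (\<Sum>k\<in>Basis. G l k z * ginv G k i z) * ginv G l j z)"
    by (subst sum.swap) (simp add: sum_distrib_right)
  also have "\<dots> = ginv G i j z"
    using assms by (simp add: metric_ginv)
  finally show ?thesis by simp
qed

lemma ginv_metric:
  assumes "z \<in> U" "k \<in> Basis" "j \<in> Basis"
  shows "(\<Sum>l\<in>Basis. ginv G j l z * G l k z) = (if j = k then 1 else 0)"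
proof -
  have "(\<Sum>l\<in>Basis. ginv G j l z * G l k z) = (\<Sum>l\<in>Basis. G k l z * ginv G l j z)"
    using assms by (intro sum.cong) (auto simp: ginv_symm[of z j] symm[of z _ k])
  then show ?thesis using metric_ginv[OF assms] by auto
qed

lemma differentiable_metric:
  "\<lbrakk>z \<in> U; i \<in> Basis; j \<in> Basis\<rbrakk> \<Longrightarrow> G i j differentiable (at z)"
  using smooth smooth_on_differentiable by blast

lemma differentiable_pd_metric:
  "\<lbrakk>z \<in> U; i \<in> Basis; j \<in> Basis; k \<in> Basis\<rbrakk> \<Longrightarrow> pd k (G i j) differentiable (at z)"
  using smooth smooth_on_differentiable smooth_on_pd by blast

text \<open>The map (z, v) to (z, G(z) v) has the inverse (z, u) to (z, G(z)^{-1} u), to which the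
  inverse function theorem applies.\<close>

lemma differentiable_ginv:
  assumes "z0 \<in> U" "i \<in> Basis" "j \<in> Basis"
  shows "ginv G i j differentiable (at z0)"
proof -
  define \<Phi> where "\<Phi> = (\<lambda>x. (fst x, metric_map G (fst x) (snd x)))"
  define \<Psi> where "\<Psi> = (\<lambda>x. (fst x, inv (metric_map G (fst x)) (snd x)))"
  \<comment> \<open>\<open>D z v u\<close> is the derivative of \<open>metric_map G z v\<close> with
    respect to \<open>z\<close> along \<open>u\<close>.\<close>
  define D where "D = (\<lambda>z v u. \<Sum>k\<in>Basis. (\<Sum>l\<in>Basis. pd u (G k l) z * (v \<bullet> l)) *\<^sub>R k)"
  have der: "(\<Phi> has_derivative
      (\<lambda>d. (fst d, D (fst x) (snd x) (fst d) + metric_map G (fst x) (snd d)))) (at x)"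
    if "x \<in> U \<times> UNIV" for x
  proof -
    have "((\<lambda>x. G k l (fst x)) has_derivative (\<lambda>d. pd (fst d) (G k l) (fst x))) (at x)"
      if "k \<in> Basis" "l \<in> Basis" for k l
      using that \<open>x \<in> U \<times> UNIV\<close>
      by (intro has_derivative_fst_comp pd_has_derivative differentiable_metric) auto
    then have "((\<lambda>x. metric_map G (fst x) (snd x)) has_derivative
       (\<lambda>d. D (fst x) (snd x) (fst d) + metric_map G (fst x) (snd d))) (at x)"
      unfolding metric_map_def D_def
      by (auto intro!: derivative_eq_intros
          simp: fun_eq_iff sum.distrib scaleR_add_left algebra_simps)
    then show ?thesis unfolding \<Phi>_def
      by (intro has_derivative_Pair) (auto intro!: derivative_eq_intros)
  qed
  \<comment> \<open>Chosen so that \<open>\<Phi> x0 = (z0, j)\<close>, the point at which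
    \<open>\<Psi>\<close> is to be differentiated.\<close>
  define x0 where "x0 = (z0, inv (metric_map G z0) j)"
  have x0: "x0 \<in> U \<times> UNIV" "fst x0 = z0" using assms by (auto simp: x0_def)
  have bij: "bij (metric_map G z0)" by (rule bij_metric_map[OF assms(1)])
  \<comment> \<open>The derivative solves \<open>u = fst e\<close> and
    \<open>D u + G d = snd e\<close> for \<open>(u, d)\<close>. The theorem used asks for continuity
    of \<open>\<Phi>\<close> only, not of the inverse.\<close>
  have "(\<Psi> has_derivative (\<lambda>e. (fst e, inv (metric_map G z0) (snd e - D z0 (snd x0) (fst e))))) (at (\<Phi> x0))"
  proof (rule has_derivative_inverse_strong[OF _ x0(1) _ _ der[OF x0(1)]])
    show "open (U \<times> (UNIV :: 'a set))" using open_domain by (simp add: open_Times)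
    show "continuous_on (U \<times> UNIV) \<Phi>"
      by (intro continuous_at_imp_continuous_on ballI has_derivative_continuous[OF der])
    show "\<Psi> (\<Phi> x) = x" if "x \<in> U \<times> UNIV" for x
      using that bij_metric_map[of "fst x"] by (auto simp: \<Psi>_def \<Phi>_def bij_def)
    show "(\<lambda>d. (fst d, D (fst x0) (snd x0) (fst d) + metric_map G (fst x0) (snd d))) \<circ>
      (\<lambda>e. (fst e, inv (metric_map G z0) (snd e - D z0 (snd x0) (fst e)))) = id"
      using bij by (auto simp: fun_eq_iff x0 bij_def surj_f_inv_f)
  qed
  moreover have "\<Phi> x0 = (z0, j)"
    using bij by (simp add: \<Phi>_def x0_def bij_def surj_f_inv_f)
  ultimately have "\<Psi> differentiable (at (z0, j))" unfolding differentiable_def by auto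
  moreover have "(\<lambda>z. (z, j)) differentiable (at z0)" by simp
  ultimately have "(\<lambda>z. \<Psi> (z, j)) differentiable (at z0)"
    using differentiable_chain_at[of "\<lambda>z. (z, j)" z0 \<Psi>] by (simp add: o_def)
  then have "(\<lambda>z. snd (\<Psi> (z, j)) \<bullet> i) differentiable (at z0)"
    unfolding differentiable_def
    using has_derivative_inner_left[OF has_derivative_snd] by blast
  then show ?thesis by (simp add: \<Psi>_def ginv_metric_map[abs_def])
qed

section \<open>Christoffel symbols, metric compatibility and the Laplacian as a divergence\<close>

lemma pd_metric_symm:
  "\<lbrakk>z \<in> U; i \<in> Basis; j \<in> Basis\<rbrakk> \<Longrightarrow> pd v (G i j) z = pd v (G j i) z"
  by (rule pd_cong[OF open_domain]) (auto simp: symm)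

lemma christoffel_symm:
  "\<lbrakk>z \<in> U; i \<in> Basis; j \<in> Basis\<rbrakk> \<Longrightarrow> christoffel G k i j z = christoffel G k j i z"
  unfolding christoffel_def
  by (auto simp: pd_metric_symm[of z i j] algebra_simps intro!: sum.cong)

lemma differentiable_christoffel:
  assumes "z \<in> U" "k \<in> Basis" "i \<in> Basis" "j \<in> Basis"
  shows "christoffel G k i j differentiable (at z)"
proof -
  have "(\<lambda>z. (\<Sum>l\<in>Basis. ginv G k l z * (pd i (G j l) z + pd j (G i l) z - pd l (G i j) z)) / 2)
      differentiable (at z)"
    using assms
    by (auto intro!: differentiable_divide differentiable_sum differentiable_mult differentiable_add
        differentiable_diff differentiable_ginv differentiable_pd_metric)
  then show ?thesis by (simp add: christoffel_def[abs_def])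
qed

text \<open>Lowering the upper index cancels \<open>ginv\<close> and leaves the Christoffel symbols
  of the first kind.\<close>

lemma metric_christoffel:
  assumes "z \<in> U" "a \<in> Basis" "i \<in> Basis" "j \<in> Basis"
  shows "(\<Sum>k\<in>Basis. G a k z * christoffel G k i j z) =
    (pd i (G j a) z + pd j (G i a) z - pd a (G i j) z) / 2"
proof -
  define T where "T l = pd i (G j l) z + pd j (G i l) z - pd l (G i j) z" for l
  have "(\<Sum>k\<in>Basis. G a k z * christoffel G k i j z) =
      (\<Sum>k\<in>Basis. \<Sum>l\<in>Basis. G a k z * ginv G k l z * T l) / 2"
    unfolding christoffel_def T_def[symmetric]
    by (simp add: sum_distrib_left sum_divide_distrib mult.assoc)
  also have "\<dots> = (\<Sum>l\<in>Basis. (\<Sum>k\<in>Basis. G a k z * ginv G k l z) * T l) / 2"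
    by (subst sum.swap) (simp add: sum_distrib_right)
  also have "\<dots> = T a / 2"
    using assms by (simp add: metric_ginv)
  finally show ?thesis by (simp add: T_def)
qed

text \<open>Metric compatibility, nabla g = 0: of the six first-kind terms on the right four
  cancel.\<close>

lemma pd_metric:
  assumes "z \<in> U" "a \<in> Basis" "b \<in> Basis" "l \<in> Basis"
  shows "pd l (G a b) z =
    (\<Sum>m\<in>Basis. G a m z * christoffel G m l b z) + (\<Sum>m\<in>Basis. G b m z * christoffel G m l a z)"
  using assms by (simp add: metric_christoffel pd_metric_symm[of z l] pd_metric_symm[of z b a] field_simps)

text \<open>The inverse metric is parallel as well. Differentiating \<open>G * ginv G = 1\<close>
  expresses the derivative of \<open>ginv G\<close> through that of \<open>G\<close>, which
  \<open>pd_metric\<close> replaces by Christoffel symbols.\<close>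

lemma pd_ginv:
  assumes z: "z \<in> U" and i: "i \<in> Basis" and j: "j \<in> Basis" and l: "l \<in> Basis"
  shows "pd l (ginv G i j) z =
    - (\<Sum>k\<in>Basis. christoffel G i l k z * ginv G k j z) - (\<Sum>k\<in>Basis. christoffel G j l k z * ginv G i k z)"
proof -
  have d: "G a b differentiable (at z)" "ginv G a b differentiable (at z)"
    if "a \<in> Basis" "b \<in> Basis" for a b
    using that z differentiable_metric differentiable_ginv by auto
  have zero: "(\<Sum>b\<in>Basis. pd l (G a b) z * ginv G b j z) = - (\<Sum>b\<in>Basis. G a b z * pd l (ginv G b j) z)"
    if a: "a \<in> Basis" for a
  proof -
    have "0 = pd l (\<lambda>y. \<Sum>b\<in>Basis. G a b y * ginv G b j y) z"
      by (subst pd_cong[OF open_domain z, of _ "\<lambda>_. if a = j then 1 else 0"]) (auto simp: metric_ginv a j)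
    also have "\<dots> = (\<Sum>b\<in>Basis. pd l (\<lambda>y. G a b y * ginv G b j y) z)"
      using d a j by (intro pd_sum) auto
    also have "\<dots> = (\<Sum>b\<in>Basis. pd l (G a b) z * ginv G b j z + G a b z * pd l (ginv G b j) z)"
      using d a j by (intro sum.cong pd_mult) auto
    finally show ?thesis by (simp add: sum.distrib)
  qed
  \<comment> \<open>Inserting \<open>ginv G * G = 1\<close> allows \<open>zero\<close> to move the
    derivative from \<open>ginv G\<close> to \<open>G\<close>.\<close>
  have "pd l (ginv G i j) z = (\<Sum>b\<in>Basis. (\<Sum>a\<in>Basis. ginv G i a z * G a b z) * pd l (ginv G b j) z)"
    using z i by (simp add: ginv_metric)
  also have "\<dots> = (\<Sum>a\<in>Basis. \<Sum>b\<in>Basis. ginv G i a z * G a b z * pd l (ginv G b j) z)"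
    by (subst sum.swap) (simp add: sum_distrib_right)
  also have "\<dots> = - (\<Sum>a\<in>Basis. ginv G i a z * (\<Sum>b\<in>Basis. pd l (G a b) z * ginv G b j z))"
    by (simp add: zero sum_distrib_left sum_negf mult.assoc)
  also have "(\<Sum>a\<in>Basis. ginv G i a z * (\<Sum>b\<in>Basis. pd l (G a b) z * ginv G b j z)) =
      (\<Sum>a\<in>Basis. \<Sum>b\<in>Basis. \<Sum>m\<in>Basis. ginv G i a z * G a m z * (christoffel G m l b z * ginv G b j z)) +
      (\<Sum>a\<in>Basis. \<Sum>b\<in>Basis. \<Sum>m\<in>Basis. ginv G i a z * christoffel G m l a z * (G m b z * ginv G b j z))"
    using z l by (simp add: pd_metric sum_distrib_left sum_distrib_right sum.distrib algebra_simps symm)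
  also have "(\<Sum>a\<in>Basis. \<Sum>b\<in>Basis. \<Sum>m\<in>Basis. ginv G i a z * G a m z * (christoffel G m l b z * ginv G b j z)) =
      (\<Sum>b\<in>Basis. \<Sum>m\<in>Basis. (\<Sum>a\<in>Basis. ginv G i a z * G a m z) * (christoffel G m l b z * ginv G b j z))"
    unfolding sum_distrib_right by (rule trans[OF sum.swap], rule sum.cong[OF refl], rule sum.swap)
  also have "\<dots> = (\<Sum>b\<in>Basis. christoffel G i l b z * ginv G b j z)"
    using z i by (simp add: ginv_metric)
  also have "(\<Sum>a\<in>Basis. \<Sum>b\<in>Basis. \<Sum>m\<in>Basis. ginv G i a z * christoffel G m l a z * (G m b z * ginv G b j z)) =
      (\<Sum>a\<in>Basis. \<Sum>m\<in>Basis. ginv G i a z * christoffel G m l a z * (\<Sum>b\<in>Basis. G m b z * ginv G b j z))"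
    unfolding sum_distrib_left by (rule sum.cong[OF refl], rule sum.swap)
  also have "\<dots> = (\<Sum>a\<in>Basis. ginv G i a z * christoffel G j l a z)"
    using z j by (simp add: metric_ginv)
  finally show ?thesis by (simp add: mult.commute)
qed

lemma differentiable_coord_grad:
  assumes "smooth_on U h" "z \<in> U" "i \<in> Basis"
  shows "(\<lambda>y. coord_grad G h y \<bullet> i) differentiable (at z)"
  using assms
  by (auto simp: coord_grad_inner intro!: differentiable_sum differentiable_mult differentiable_ginv
      smooth_on_differentiable[OF smooth_on_pd])

lemma metric_coord_grad:
  assumes "z \<in> U" "i \<in> Basis"
  shows "(\<Sum>j\<in>Basis. G i j z * (coord_grad G h z \<bullet> j)) = pd i h z"
proof -
  have "(\<Sum>j\<in>Basis. G i j z * (coord_grad G h z \<bullet> j)) =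
      (\<Sum>k\<in>Basis. (\<Sum>j\<in>Basis. G i j z * ginv G j k z) * pd k h z)"
    unfolding sum_distrib_right
    by (subst sum.swap) (simp add: coord_grad_inner sum_distrib_left mult.assoc)
  then show ?thesis using assms by (simp add: metric_ginv)
qed

text \<open>The Ricci tensor of the warped product differentiates Christoffel symbols that contain
  grad f, whereas \<open>coord_laplacian\<close> is the trace of the Hessian. Of the two sums in
  \<open>pd_ginv\<close>, the one over \<open>christoffel G j l k\<close> becomes the correction
  term of the Hessian, and the one over \<open>christoffel G i l k\<close> is cancelled by the
  second sum of the statement.\<close>

lemma laplacian_eq_divergence:
  assumes h: "smooth_on U h" and z: "z \<in> U"
  shows "coord_laplacian G h z =
    (\<Sum>i\<in>Basis. pd i (\<lambda>y. coord_grad G h y \<bullet> i) z) +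
    (\<Sum>i\<in>Basis. \<Sum>k\<in>Basis. christoffel G i i k z * (coord_grad G h z \<bullet> k))"
proof -
  have d: "ginv G a b differentiable (at z)" "pd b h differentiable (at z)"
    if "a \<in> Basis" "b \<in> Basis" for a b
    using that z h differentiable_ginv smooth_on_differentiable[OF smooth_on_pd] by auto
  have "pd i (\<lambda>y. coord_grad G h y \<bullet> i) z =
      (\<Sum>j\<in>Basis. ginv G i j z * pd i (pd j h) z)
      - (\<Sum>j\<in>Basis. \<Sum>k\<in>Basis. christoffel G i i k z * ginv G k j z * pd j h z)
      - (\<Sum>j\<in>Basis. \<Sum>k\<in>Basis. ginv G i k z * (christoffel G j i k z * pd j h z))"
    if i: "i \<in> Basis" for i
  proof -
    have "pd i (\<lambda>y. coord_grad G h y \<bullet> i) z = (\<Sum>j\<in>Basis. pd i (\<lambda>y. ginv G i j y * pd j h y) z)"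
      using i d by (simp add: coord_grad_inner pd_sum)
    also have "\<dots> = (\<Sum>j\<in>Basis. pd i (ginv G i j) z * pd j h z + ginv G i j z * pd i (pd j h) z)"
      using i d by (intro sum.cong pd_mult) auto
    also have "\<dots> = (\<Sum>j\<in>Basis. ginv G i j z * pd i (pd j h) z
        - (\<Sum>k\<in>Basis. christoffel G i i k z * ginv G k j z * pd j h z)
        - (\<Sum>k\<in>Basis. ginv G i k z * (christoffel G j i k z * pd j h z)))"
      using i z by (intro sum.cong) (auto simp: pd_ginv sum_distrib_left sum_distrib_right algebra_simps)
    finally show ?thesis by (simp add: sum_subtractf)
  qed
  then have "(\<Sum>i\<in>Basis. pd i (\<lambda>y. coord_grad G h y \<bullet> i) z) =
      (\<Sum>i\<in>Basis. \<Sum>j\<in>Basis. ginv G i j z * pd i (pd j h) z)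
      - (\<Sum>i\<in>Basis. \<Sum>j\<in>Basis. \<Sum>k\<in>Basis. christoffel G i i k z * ginv G k j z * pd j h z)
      - (\<Sum>i\<in>Basis. \<Sum>j\<in>Basis. \<Sum>k\<in>Basis. ginv G i k z * (christoffel G j i k z * pd j h z))"
    by (simp add: sum_subtractf)
  also have "(\<Sum>i\<in>Basis. \<Sum>j\<in>Basis. \<Sum>k\<in>Basis. christoffel G i i k z * ginv G k j z * pd j h z) =
      (\<Sum>i\<in>Basis. \<Sum>k\<in>Basis. christoffel G i i k z * (coord_grad G h z \<bullet> k))"
    by (rule sum.cong[OF refl], subst sum.swap) (simp add: coord_grad_inner sum_distrib_left mult.assoc)
  also have "(\<Sum>i\<in>Basis. \<Sum>j\<in>Basis. \<Sum>k\<in>Basis. ginv G i k z * (christoffel G j i k z * pd j h z)) =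
      (\<Sum>i\<in>Basis. \<Sum>k\<in>Basis. ginv G i k z * (\<Sum>j\<in>Basis. christoffel G j i k z * pd j h z))"
    unfolding sum_distrib_left by (rule sum.cong[OF refl], rule sum.swap)
  finally show ?thesis
    unfolding coord_laplacian_def coord_hess_def
    by (simp add: right_diff_distrib sum_subtractf)
qed

end

section \<open>The Ricci tensor of a warped product in coordinates\<close>

lemma sum_Basis_Times:
  fixes h :: "'a::euclidean_space \<times> 'b::euclidean_space \<Rightarrow> 'c::comm_monoid_add"
  shows "(\<Sum>i\<in>Basis. h i) = (\<Sum>i\<in>Basis. h (i, 0)) + (\<Sum>j\<in>Basis. h (0, j))"
proof -
  have "inj_on (\<lambda>u. (u::'a, 0::'b)) Basis" "inj_on (\<lambda>u. (0::'a, u::'b)) Basis"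
    by (auto intro!: inj_onI Pair_inject)
  then show ?thesis
    unfolding Basis_prod_def
    by (subst sum.union_disjoint) (auto simp: Basis_prod_def sum.reindex)
qed

lemma Basis_Times_cases [consumes 1, case_names fst snd]:
  assumes "I \<in> Basis"
  obtains i where "I = (i, 0)" "i \<in> Basis" | j where "I = (0, j)" "j \<in> Basis"
  using assms by (auto simp: Basis_prod_def)

lemma Pair_in_Basis [simp]:
  "i \<in> Basis \<Longrightarrow> (i, 0) \<in> Basis" "j \<in> Basis \<Longrightarrow> (0, j) \<in> Basis"
  by (auto simp: Basis_prod_def)

text \<open>The components of \<open>G\<close> are prescribed only on \<open>U \<times> V\<close>
  and for basis vectors, so their derivatives have to be taken through
  \<open>pd_cong\<close>.\<close>

locale warped_coords = B: coord_metric_on U GB + F: coord_metric_on V GF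
  for U :: "'a::euclidean_space set" and GB and V :: "'b::euclidean_space set" and GF +
  fixes f :: "'a \<Rightarrow> real" and G :: "('a \<times> 'b) coord_metric"
  assumes f_smooth: "smooth_on U f"
    and f_pos: "z \<in> U \<Longrightarrow> f z > 0"
    and G_BB: "\<lbrakk>z \<in> U; w \<in> V; i \<in> Basis; j \<in> Basis\<rbrakk> \<Longrightarrow> G (i, 0) (j, 0) (z, w) = GB i j z"
    and G_BF: "\<lbrakk>z \<in> U; w \<in> V; i \<in> Basis; b \<in> Basis\<rbrakk> \<Longrightarrow> G (i, 0) (0, b) (z, w) = 0"
    and G_FB: "\<lbrakk>z \<in> U; w \<in> V; a \<in> Basis; j \<in> Basis\<rbrakk> \<Longrightarrow> G (0, a) (j, 0) (z, w) = 0"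
    and G_FF: "\<lbrakk>z \<in> U; w \<in> V; a \<in> Basis; b \<in> Basis\<rbrakk> \<Longrightarrow>
      G (0, a) (0, b) (z, w) = (f z)\<^sup>2 * GF a b w"
begin

lemma open_Times_domain: "open (U \<times> V)"
  by (rule open_Times[OF B.open_domain F.open_domain])

text \<open>The mixed blocks vanish, so the quadratic form splits as
  \<open>QB + (f z)\<^sup>2 * QF\<close>; one of the two parts is positive for a nonzero
  vector.\<close>

lemma total_metric: "coord_metric_on (U \<times> V) G"
proof
  show "open (U \<times> V)" by (rule open_Times_domain)
  show "G I J x = G J I x" if "x \<in> U \<times> V" "I \<in> Basis" "J \<in> Basis" for x I J
    using that by (auto simp: Basis_prod_def G_BB G_BF G_FB G_FF B.symm F.symm)
  show "0 < (\<Sum>I\<in>Basis. \<Sum>J\<in>Basis. G I J x * (v \<bullet> I) * (v \<bullet> J))" if xv: "x \<in> U \<times> V" "v \<noteq> 0" for x v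
  proof -
    obtain z w where x: "x = (z, w)" "z \<in> U" "w \<in> V" using xv(1) by auto
    define QB QF where "QB = (\<Sum>i\<in>Basis. \<Sum>j\<in>Basis. GB i j z * (fst v \<bullet> i) * (fst v \<bullet> j))"
      and "QF = (\<Sum>i\<in>Basis. \<Sum>j\<in>Basis. GF i j w * (snd v \<bullet> i) * (snd v \<bullet> j))"
    have QB: "QB = 0" if "fst v = 0" using that by (simp add: QB_def)
    have QB': "QB > 0" if "fst v \<noteq> 0" using B.pos[OF x(2) that] by (simp add: QB_def)
    have QF: "QF = 0" if "snd v = 0" using that by (simp add: QF_def)
    have QF': "QF > 0" if "snd v \<noteq> 0" using F.pos[OF x(3) that] by (simp add: QF_def)
    have "(\<Sum>I\<in>Basis. \<Sum>J\<in>Basis. G I J x * (v \<bullet> I) * (v \<bullet> J)) = QB + (f z)\<^sup>2 * QF"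
      unfolding QB_def QF_def using x
      by (simp add: sum_Basis_Times G_BB G_BF G_FB G_FF inner_prod_def sum_distrib_left mult_ac)
    moreover have "fst v \<noteq> 0 \<or> snd v \<noteq> 0" using \<open>v \<noteq> 0\<close> by (auto simp: prod_eq_iff)
    moreover have "(f z)\<^sup>2 > 0" using f_pos[OF x(2)] by simp
    ultimately show ?thesis
      using QB QB' QF QF' by (cases "fst v = 0"; cases "snd v = 0") (auto simp: add_pos_pos)
  qed
  show "smooth_on (U \<times> V) (G I J)" if "I \<in> Basis" "J \<in> Basis" for I J
  proof -
    note o = B.open_domain F.open_domain
    have BB: "smooth_on (U \<times> V) (\<lambda>x. GB i j (fst x))" if "i \<in> Basis" "j \<in> Basis" for i j
      by (intro smooth_on_fst_comp o B.smooth that)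
    have FF: "smooth_on (U \<times> V) (\<lambda>x. f (fst x) * f (fst x) * GF i j (snd x))" if "i \<in> Basis" "j \<in> Basis" for i j
      by (intro smooth_on_mult smooth_on_fst_comp smooth_on_snd_comp o f_smooth F.smooth that open_Times)
    note cong = smooth_on_cong[OF open_Times_domain, THEN iffD2]
    have "smooth_on (U \<times> V) (G (i, 0) (j, 0))" if "i \<in> Basis" "j \<in> Basis" for i j
      by (rule cong[OF _ BB[OF that]]) (auto simp: G_BB that)
    moreover have "smooth_on (U \<times> V) (G (i, 0) (0, b))" if "i \<in> Basis" "b \<in> Basis" for i b
      by (rule cong[OF _ smooth_on_const]) (auto simp: G_BF that)
    moreover have "smooth_on (U \<times> V) (G (0, a) (j, 0))" if "a \<in> Basis" "j \<in> Basis" for a j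
      by (rule cong[OF _ smooth_on_const]) (auto simp: G_FB that)
    moreover have "smooth_on (U \<times> V) (G (0, a) (0, b))" if "a \<in> Basis" "b \<in> Basis" for a b
      by (rule cong[OF _ FF[OF that]]) (auto simp: G_FF that power2_eq_square)
    ultimately show ?thesis using that by (auto simp: Basis_prod_def)
  qed
qed

sublocale T: coord_metric_on "U \<times> V" G
  by (rule total_metric)

lemma f_differentiable: "z \<in> U \<Longrightarrow> f differentiable (at z)"
  using f_smooth smooth_on_differentiable by blast

lemma pd_f_differentiable: "\<lbrakk>z \<in> U; i \<in> Basis\<rbrakk> \<Longrightarrow> pd i f differentiable (at z)"
  using f_smooth smooth_on_differentiable smooth_on_pd by blast

lemma pd_G:
  assumes "z \<in> U" "w \<in> V"
  shows "i \<in> Basis \<Longrightarrow> j \<in> Basis \<Longrightarrow> pd v (G (i, 0) (j, 0)) (z, w) = pd (fst v) (GB i j) z"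
    and "i \<in> Basis \<Longrightarrow> b \<in> Basis \<Longrightarrow> pd v (G (i, 0) (0, b)) (z, w) = 0"
    and "a \<in> Basis \<Longrightarrow> j \<in> Basis \<Longrightarrow> pd v (G (0, a) (j, 0)) (z, w) = 0"
    and "a \<in> Basis \<Longrightarrow> b \<in> Basis \<Longrightarrow> pd v (G (0, a) (0, b)) (z, w) =
      2 * f z * pd (fst v) f z * GF a b w + (f z)\<^sup>2 * pd (snd v) (GF a b) w"
proof -
  have x: "(z, w) \<in> U \<times> V" using assms by simp
  note cong = pd_cong[OF open_Times_domain x]
  show "pd v (G (i, 0) (j, 0)) (z, w) = pd (fst v) (GB i j) z" if "i \<in> Basis" "j \<in> Basis"
    using that assms B.differentiable_metric pd_fst_comp[of "GB i j" "(z, w)" v]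
    by (subst cong[of _ "\<lambda>x. GB i j (fst x)"]) (auto simp: G_BB)
  show "pd v (G (i, 0) (0, b)) (z, w) = 0" if "i \<in> Basis" "b \<in> Basis"
    using that by (subst cong[of _ "\<lambda>x. 0"]) (auto simp: G_BF)
  show "pd v (G (0, a) (j, 0)) (z, w) = 0" if "a \<in> Basis" "j \<in> Basis"
    using that by (subst cong[of _ "\<lambda>x. 0"]) (auto simp: G_FB)
  show "pd v (G (0, a) (0, b)) (z, w) =
      2 * f z * pd (fst v) f z * GF a b w + (f z)\<^sup>2 * pd (snd v) (GF a b) w"
    if "a \<in> Basis" "b \<in> Basis"
  proof -
    have d: "(\<lambda>x. f (fst x)) differentiable (at (z, w))" "(\<lambda>x. GF a b (snd x)) differentiable (at (z, w))"
      using assms that by (auto intro!: differentiable_fst_comp differentiable_snd_comp f_differentiable F.differentiable_metric)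
    have e: "pd v (\<lambda>x. f (fst x)) (z, w) = pd (fst v) f z" "pd v (\<lambda>x. GF a b (snd x)) (z, w) = pd (snd v) (GF a b) w"
      using assms that pd_fst_comp[of f "(z, w)" v] pd_snd_comp[of "GF a b" "(z, w)" v]
      by (auto simp: f_differentiable F.differentiable_metric)
    have "pd v (G (0, a) (0, b)) (z, w) = pd v (\<lambda>x. f (fst x) * f (fst x) * GF a b (snd x)) (z, w)"
      using that by (intro cong) (auto simp: G_FF power2_eq_square)
    also have "\<dots> = 2 * f z * pd (fst v) f z * GF a b w + (f z)\<^sup>2 * pd (snd v) (GF a b) w"
      using d by (simp add: pd_mult differentiable_mult e power2_eq_square algebra_simps)
    finally show ?thesis .
  qed
qed

lemma pd_zero_vector [simp]:
  "z \<in> U \<Longrightarrow> i \<in> Basis \<Longrightarrow> j \<in> Basis \<Longrightarrow> pd 0 (GB i j) z = 0"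
  "w \<in> V \<Longrightarrow> a \<in> Basis \<Longrightarrow> b \<in> Basis \<Longrightarrow> pd 0 (GF a b) w = 0"
  "z \<in> U \<Longrightarrow> pd 0 f z = 0"
  by (auto intro!: pd_0 B.differentiable_metric F.differentiable_metric f_differentiable)

text \<open>The columns are guessed and confirmed by \<open>ginv_unique\<close>: they are those of
  the two inverse blocks padded with zeros, the fibre block divided by \<open>f^2\<close>.\<close>

lemma ginv_G:
  assumes "z \<in> U" "w \<in> V"
  shows "i \<in> Basis \<Longrightarrow> j \<in> Basis \<Longrightarrow> ginv G (i, 0) (j, 0) (z, w) = ginv GB i j z"
    and "i \<in> Basis \<Longrightarrow> b \<in> Basis \<Longrightarrow> ginv G (i, 0) (0, b) (z, w) = 0"
    and "a \<in> Basis \<Longrightarrow> j \<in> Basis \<Longrightarrow> ginv G (0, a) (j, 0) (z, w) = 0"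
    and "a \<in> Basis \<Longrightarrow> b \<in> Basis \<Longrightarrow> ginv G (0, a) (0, b) (z, w) = ginv GF a b w / (f z)\<^sup>2"
proof -
  have x: "(z, w) \<in> U \<times> V" using assms by simp
  have ne: "f z \<noteq> 0" using f_pos[OF assms(1)] by simp
  have B: "ginv G L (j, 0) (z, w) = (if snd L = 0 then ginv GB (fst L) j z else 0)"
    if "j \<in> Basis" "L \<in> Basis" for j L
  proof (rule T.ginv_unique[OF x _ that(2)])
    show "(j, 0 :: 'b) \<in> Basis" using that by simp
    show "(\<Sum>L\<in>Basis. G K L (z, w) * (if snd L = 0 then ginv GB (fst L) j z else 0)) =
      (if K = (j, 0) then 1 else 0)" if "K \<in> Basis" for K
      using that
      by (cases K rule: Basis_Times_cases)
        (simp_all add: sum_Basis_Times G_BB G_BF G_FB G_FF B.metric_ginv assms \<open>j \<in> Basis\<close> nonzero_Basis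
          cong: sum.cong_simp)
  qed
  have F: "ginv G L (0, b) (z, w) = (if fst L = 0 then ginv GF (snd L) b w / (f z)\<^sup>2 else 0)"
    if "b \<in> Basis" "L \<in> Basis" for b L
  proof (rule T.ginv_unique[OF x _ that(2)])
    show "(0 :: 'a, b) \<in> Basis" using that by simp
    show "(\<Sum>L\<in>Basis. G K L (z, w) * (if fst L = 0 then ginv GF (snd L) b w / (f z)\<^sup>2 else 0)) =
      (if K = (0, b) then 1 else 0)" if "K \<in> Basis" for K
      using that
      by (cases K rule: Basis_Times_cases)
        (simp_all add: sum_Basis_Times G_BB G_BF G_FB G_FF F.metric_ginv assms ne \<open>b \<in> Basis\<close> nonzero_Basis
          cong: sum.cong_simp)
  qed
  show "i \<in> Basis \<Longrightarrow> j \<in> Basis \<Longrightarrow> ginv G (i, 0) (j, 0) (z, w) = ginv GB i j z"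
    and "i \<in> Basis \<Longrightarrow> b \<in> Basis \<Longrightarrow> ginv G (i, 0) (0, b) (z, w) = 0"
    and "a \<in> Basis \<Longrightarrow> j \<in> Basis \<Longrightarrow> ginv G (0, a) (j, 0) (z, w) = 0"
    and "a \<in> Basis \<Longrightarrow> b \<in> Basis \<Longrightarrow> ginv G (0, a) (0, b) (z, w) = ginv GF a b w / (f z)\<^sup>2"
    using B F by auto
qed

section \<open>Christoffel symbols of the warped product and their derivatives\<close>

lemma christoffel_G:
  assumes "z \<in> U" "w \<in> V"
  shows "\<lbrakk>k \<in> Basis; i \<in> Basis; j \<in> Basis\<rbrakk> \<Longrightarrow>
      christoffel G (k, 0) (i, 0) (j, 0) (z, w) = christoffel GB k i j z"
    and "\<lbrakk>k \<in> Basis; i \<in> Basis; b \<in> Basis\<rbrakk> \<Longrightarrow> christoffel G (k, 0) (i, 0) (0, b) (z, w) = 0"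
    and "\<lbrakk>k \<in> Basis; a \<in> Basis; j \<in> Basis\<rbrakk> \<Longrightarrow> christoffel G (k, 0) (0, a) (j, 0) (z, w) = 0"
    and "\<lbrakk>k \<in> Basis; a \<in> Basis; b \<in> Basis\<rbrakk> \<Longrightarrow>
      christoffel G (k, 0) (0, a) (0, b) (z, w) = - (f z * (coord_grad GB f z \<bullet> k) * GF a b w)"
    and "\<lbrakk>c \<in> Basis; i \<in> Basis; j \<in> Basis\<rbrakk> \<Longrightarrow> christoffel G (0, c) (i, 0) (j, 0) (z, w) = 0"
    and "\<lbrakk>c \<in> Basis; i \<in> Basis; b \<in> Basis\<rbrakk> \<Longrightarrow>
      christoffel G (0, c) (i, 0) (0, b) (z, w) = (if c = b then pd i f z / f z else 0)"
    and "\<lbrakk>c \<in> Basis; a \<in> Basis; j \<in> Basis\<rbrakk> \<Longrightarrow>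
      christoffel G (0, c) (0, a) (j, 0) (z, w) = (if c = a then pd j f z / f z else 0)"
    and "\<lbrakk>c \<in> Basis; a \<in> Basis; b \<in> Basis\<rbrakk> \<Longrightarrow>
      christoffel G (0, c) (0, a) (0, b) (z, w) = christoffel GF c a b w"
proof -
  have ne: "f z \<noteq> 0" using f_pos[OF assms(1)] by simp
  note s = christoffel_def sum_Basis_Times ginv_G[OF assms] pd_G[OF assms] assms
  \<comment> \<open>Along a base vector the derivative of \<open>f^2\<close> is
    \<open>2 * f * t\<close>, with \<open>t\<close> the derivative of \<open>f\<close>. Contraction
    with the inverse fibre metric leaves \<open>t / f\<close> on the diagonal.\<close>
  have r: "(\<Sum>l\<in>Basis. ginv GF c l w / (f z)\<^sup>2 * (2 * f z * t * GF b l w)) / 2 = (if c = b then t / f z else 0)"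
    if "b \<in> Basis" "c \<in> Basis" for b c t
  proof -
    have "(\<Sum>l\<in>Basis. ginv GF c l w / (f z)\<^sup>2 * (2 * f z * t * GF b l w)) / 2 =
        (\<Sum>l\<in>Basis. ginv GF c l w * GF l b w) * (t / f z)"
      unfolding sum_distrib_right sum_divide_distrib
      using ne that assms by (intro sum.cong) (auto simp: field_simps power2_eq_square F.symm)
    then show ?thesis using that assms by (simp add: F.ginv_metric)
  qed
  show "christoffel G (k, 0) (i, 0) (j, 0) (z, w) = christoffel GB k i j z" if "k \<in> Basis" "i \<in> Basis" "j \<in> Basis" for i j k
    using that by (simp add: s)
  show "christoffel G (k, 0) (i, 0) (0, b) (z, w) = 0" if "k \<in> Basis" "i \<in> Basis" "b \<in> Basis" for i k b
    using that by (simp add: s)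
  show "christoffel G (k, 0) (0, a) (j, 0) (z, w) = 0" if "k \<in> Basis" "a \<in> Basis" "j \<in> Basis" for a k j
    using that by (simp add: s)
  show "christoffel G (k, 0) (0, a) (0, b) (z, w) = - (f z * (coord_grad GB f z \<bullet> k) * GF a b w)"
    if "k \<in> Basis" "a \<in> Basis" "b \<in> Basis" for a k b
    using that by (simp add: s coord_grad_inner sum_distrib_left sum_distrib_right sum_divide_distrib sum_negf[symmetric] mult_ac)
  show "christoffel G (0, c) (i, 0) (j, 0) (z, w) = 0" if "c \<in> Basis" "i \<in> Basis" "j \<in> Basis" for i j c
    using that by (simp add: s)
  show "christoffel G (0, c) (i, 0) (0, b) (z, w) = (if c = b then pd i f z / f z else 0)"
    if "c \<in> Basis" "i \<in> Basis" "b \<in> Basis" for c i b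
    using that r[of b c "pd i f z"] by (simp add: s)
  show "christoffel G (0, c) (0, a) (j, 0) (z, w) = (if c = a then pd j f z / f z else 0)"
    if "c \<in> Basis" "a \<in> Basis" "j \<in> Basis" for c a j
    using that r[of a c "pd j f z"] by (simp add: s)
  show "christoffel G (0, c) (0, a) (0, b) (z, w) = christoffel GF c a b w"
    if "c \<in> Basis" "a \<in> Basis" "b \<in> Basis" for a b c
    using that ne
    by (simp add: s right_diff_distrib[symmetric] distrib_left[symmetric])
qed

text \<open>The fourth case is restricted to base directions: in the Ricci trace this symbol is
  differentiated only along its own upper index, which is a base vector.\<close>

lemma pd_christoffel_G:
  assumes "z \<in> U" "w \<in> V"
  shows "\<lbrakk>k \<in> Basis; i \<in> Basis; j \<in> Basis\<rbrakk> \<Longrightarrow>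
      pd v (christoffel G (k, 0) (i, 0) (j, 0)) (z, w) = pd (fst v) (christoffel GB k i j) z"
    and "\<lbrakk>k \<in> Basis; i \<in> Basis; b \<in> Basis\<rbrakk> \<Longrightarrow> pd v (christoffel G (k, 0) (i, 0) (0, b)) (z, w) = 0"
    and "\<lbrakk>k \<in> Basis; a \<in> Basis; j \<in> Basis\<rbrakk> \<Longrightarrow> pd v (christoffel G (k, 0) (0, a) (j, 0)) (z, w) = 0"
    and "\<lbrakk>k \<in> Basis; a \<in> Basis; b \<in> Basis\<rbrakk> \<Longrightarrow>
      pd (i, 0) (christoffel G (k, 0) (0, a) (0, b)) (z, w) =
        - ((pd i f z * (coord_grad GB f z \<bullet> k) + f z * pd i (\<lambda>y. coord_grad GB f y \<bullet> k) z) * GF a b w)"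
    and "\<lbrakk>c \<in> Basis; i \<in> Basis; j \<in> Basis\<rbrakk> \<Longrightarrow> pd v (christoffel G (0, c) (i, 0) (j, 0)) (z, w) = 0"
    and "\<lbrakk>c \<in> Basis; i \<in> Basis; b \<in> Basis\<rbrakk> \<Longrightarrow>
      pd v (christoffel G (0, c) (i, 0) (0, b)) (z, w) =
        (if c = b then pd (fst v) (pd i f) z / f z - pd i f z * pd (fst v) f z / (f z)\<^sup>2 else 0)"
    and "\<lbrakk>c \<in> Basis; a \<in> Basis; j \<in> Basis\<rbrakk> \<Longrightarrow>
      pd v (christoffel G (0, c) (0, a) (j, 0)) (z, w) =
        (if c = a then pd (fst v) (pd j f) z / f z - pd j f z * pd (fst v) f z / (f z)\<^sup>2 else 0)"
    and "\<lbrakk>c \<in> Basis; a \<in> Basis; b \<in> Basis\<rbrakk> \<Longrightarrow>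
      pd v (christoffel G (0, c) (0, a) (0, b)) (z, w) = pd (snd v) (christoffel GF c a b) w"
proof -
  have x: "(z, w) \<in> U \<times> V" using assms by simp
  have ne: "f z \<noteq> 0" using f_pos[OF assms(1)] by simp
  note cong = pd_cong[OF open_Times_domain x]
  note ch = christoffel_G
  show "pd v (christoffel G (k, 0) (i, 0) (j, 0)) (z, w) = pd (fst v) (christoffel GB k i j) z"
    if "k \<in> Basis" "i \<in> Basis" "j \<in> Basis" for k i j
    using that assms pd_fst_comp[of "christoffel GB k i j" "(z, w)" v] B.differentiable_christoffel
    by (subst cong[of _ "\<lambda>x. christoffel GB k i j (fst x)"]) (auto simp: ch)
  show "pd v (christoffel G (0, c) (0, a) (0, b)) (z, w) = pd (snd v) (christoffel GF c a b) w"
    if "c \<in> Basis" "a \<in> Basis" "b \<in> Basis" for c a b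
    using that assms pd_snd_comp[of "christoffel GF c a b" "(z, w)" v] F.differentiable_christoffel
    by (subst cong[of _ "\<lambda>x. christoffel GF c a b (snd x)"]) (auto simp: ch)
  show "pd v (christoffel G (k, 0) (i, 0) (0, b)) (z, w) = 0" if "k \<in> Basis" "i \<in> Basis" "b \<in> Basis" for k i b
    using that by (subst cong[of _ "\<lambda>x. 0"]) (auto simp: ch)
  show "pd v (christoffel G (k, 0) (0, a) (j, 0)) (z, w) = 0" if "k \<in> Basis" "a \<in> Basis" "j \<in> Basis" for k a j
    using that by (subst cong[of _ "\<lambda>x. 0"]) (auto simp: ch)
  show "pd v (christoffel G (0, c) (i, 0) (j, 0)) (z, w) = 0" if "c \<in> Basis" "i \<in> Basis" "j \<in> Basis" for c i j
    using that by (subst cong[of _ "\<lambda>x. 0"]) (auto simp: ch)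
  have quot: "pd v (\<lambda>x. pd i f (fst x) / f (fst x)) (z, w) =
      pd (fst v) (pd i f) z / f z - pd i f z * pd (fst v) f z / (f z)\<^sup>2" if "i \<in> Basis" for i
  proof -
    have "(\<lambda>z. pd i f z / f z) differentiable (at z)"
      using assms that ne by (intro differentiable_divide pd_f_differentiable f_differentiable)
    then have "pd v (\<lambda>x. pd i f (fst x) / f (fst x)) (z, w) = pd (fst v) (\<lambda>z. pd i f z / f z) z"
      using pd_fst_comp[of "\<lambda>z. pd i f z / f z" "(z, w)" v] by simp
    also have "\<dots> = pd (fst v) (pd i f) z / f z - pd i f z * pd (fst v) f z / (f z)\<^sup>2"
      using assms that ne by (intro pd_divide pd_f_differentiable f_differentiable)
    finally show ?thesis .
  qed
  show "pd v (christoffel G (0, c) (i, 0) (0, b)) (z, w) =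
        (if c = b then pd (fst v) (pd i f) z / f z - pd i f z * pd (fst v) f z / (f z)\<^sup>2 else 0)"
    if "c \<in> Basis" "i \<in> Basis" "b \<in> Basis" for c i b
    using that quot[OF that(2)]
    by (subst cong[of _ "\<lambda>x. if c = b then pd i f (fst x) / f (fst x) else 0"]) (auto simp: ch)
  show "pd v (christoffel G (0, c) (0, a) (j, 0)) (z, w) =
        (if c = a then pd (fst v) (pd j f) z / f z - pd j f z * pd (fst v) f z / (f z)\<^sup>2 else 0)"
    if "c \<in> Basis" "a \<in> Basis" "j \<in> Basis" for c a j
    using that quot[OF that(3)]
    by (subst cong[of _ "\<lambda>x. if c = a then pd j f (fst x) / f (fst x) else 0"]) (auto simp: ch)
  show "pd (i, 0) (christoffel G (k, 0) (0, a) (0, b)) (z, w) =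
        - ((pd i f z * (coord_grad GB f z \<bullet> k) + f z * pd i (\<lambda>y. coord_grad GB f y \<bullet> k) z) * GF a b w)"
    if "k \<in> Basis" "a \<in> Basis" "b \<in> Basis" for k a b i
  proof -
    define h where "h y = f y * (coord_grad GB f y \<bullet> k)" for y
    have d: "f differentiable (at z)" "(\<lambda>y. coord_grad GB f y \<bullet> k) differentiable (at z)"
      using assms that by (auto intro!: f_differentiable B.differentiable_coord_grad f_smooth)
    have h: "h differentiable (at z)" unfolding h_def by (intro differentiable_mult d)
    have d': "(\<lambda>x. h (fst x)) differentiable (at (z, w))" "(\<lambda>x. GF a b (snd x)) differentiable (at (z, w))"
      using assms that h by (auto intro!: differentiable_fst_comp differentiable_snd_comp F.differentiable_metric)
    have e: "pd (i, 0) (\<lambda>x. h (fst x)) (z, w) = pd i h z" "pd (i, 0) (\<lambda>x. GF a b (snd x)) (z, w) = 0"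
      using assms that h pd_fst_comp[of h "(z, w)" "(i, 0)"] pd_snd_comp[of "GF a b" "(z, w)" "(i, 0)"]
      by (auto simp: F.differentiable_metric)
    have "pd (i, 0) (christoffel G (k, 0) (0, a) (0, b)) (z, w) = pd (i, 0) (\<lambda>x. - (h (fst x) * GF a b (snd x))) (z, w)"
      using that by (intro cong) (auto simp: ch h_def)
    also have "\<dots> = - (pd i h z * GF a b w)"
      using d' by (simp add: pd_minus pd_mult differentiable_mult e)
    also have "pd i h z = pd i f z * (coord_grad GB f z \<bullet> k) + f z * pd i (\<lambda>y. coord_grad GB f y \<bullet> k) z"
      unfolding h_def by (rule pd_mult[OF d])
    finally show ?thesis .
  qed
qed

section \<open>Ricci tensor and Hessians of lifts, block by block\<close>

text \<open>The trace over base directions reproduces the Ricci tensor of the base; each of the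
  \<open>DIM('b)\<close> fibre directions adds the same term, minus Hess f over f.\<close>

lemma coord_ricci_G_base:
  assumes "z \<in> U" "w \<in> V" "j \<in> Basis" "k \<in> Basis"
  shows "coord_ricci G (j, 0) (k, 0) (z, w) =
    coord_ricci GB j k z - real DIM('b) / f z * coord_hess GB f j k z"
proof -
  note s = christoffel_G[OF assms(1,2)] pd_christoffel_G[OF assms(1,2)] assms
  have ne: "f z \<noteq> 0" using f_pos[OF assms(1)] by simp
  have base: "coord_riemann G (i, 0) (i, 0) (j, 0) (k, 0) (z, w) = coord_riemann GB i i j k z"
    if "i \<in> Basis" for i
    using that by (simp add: coord_riemann_def sum_Basis_Times s)
  \<comment> \<open>The products \<open>pd j f * pd k f / f^2\<close> arise with opposite signs from
    the quotient rule and from the quadratic terms, and cancel.\<close>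
  have fibre: "coord_riemann G (0, a) (0, a) (j, 0) (k, 0) (z, w) = - (coord_hess GB f j k z / f z)"
    if a: "a \<in> Basis" for a
  proof -
    have "coord_riemann G (0, a) (0, a) (j, 0) (k, 0) (z, w) =
        - (pd j (pd k f) z / f z - pd k f z * pd j f z / (f z)\<^sup>2)
        + (\<Sum>l\<in>Basis. pd l f z / f z * christoffel GB l j k z)
        - (\<Sum>b\<in>Basis. (if a = b then pd j f z / f z else 0) * (if b = a then pd k f z / f z else 0))"
      using a by (simp add: coord_riemann_def sum_Basis_Times s sum_subtractf sum_negf)
    also have "(\<Sum>b\<in>Basis. (if a = b then pd j f z / f z else 0) * (if b = a then pd k f z / f z else 0)) =
        pd j f z / f z * (pd k f z / f z)"
      using a by (simp add: if_distrib if_distribR sum.delta cong: if_cong)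
    also have "(\<Sum>l\<in>Basis. pd l f z / f z * christoffel GB l j k z) =
        (\<Sum>l\<in>Basis. christoffel GB l j k z * pd l f z) / f z"
      by (simp add: sum_divide_distrib mult.commute)
    finally show ?thesis
      by (simp add: coord_hess_def diff_divide_distrib power2_eq_square mult.commute)
  qed
  show ?thesis
    by (simp add: coord_ricci_def sum_Basis_Times base fibre)
qed

text \<open>Each summand of the trace vanishes. In a fibre direction what is left is a difference of
  two equal terms, \<open>pd j f / f\<close> times a Christoffel symbol of the fibre; equality uses
  the symmetry of that symbol. Both index orders are treated, as symmetry of
  \<open>coord_ricci\<close> is not at hand.\<close>

lemma coord_ricci_G_mixed:
  assumes "z \<in> U" "w \<in> V" "j \<in> Basis" "c \<in> Basis"
  shows "coord_ricci G (j, 0) (0, c) (z, w) = 0" "coord_ricci G (0, c) (j, 0) (z, w) = 0"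
proof -
  note s = christoffel_G[OF assms(1,2)] pd_christoffel_G[OF assms(1,2)] assms
  have "pd 0 (christoffel GF a a c) w = 0" if "a \<in> Basis" for a
    using that assms by (intro pd_0 F.differentiable_christoffel)
  moreover have "pd 0 (christoffel GB a a j) z = 0" if "a \<in> Basis" for a
    using that assms by (intro pd_0 B.differentiable_christoffel)
  moreover have "pd 0 f z = 0" "pd 0 (pd j f) z = 0"
    using assms by (auto intro!: pd_0 f_differentiable pd_f_differentiable)
  ultimately have zero: "coord_riemann G (i, 0) (i, 0) (j, 0) (0, c) (z, w) = 0"
      "coord_riemann G (i, 0) (i, 0) (0, c) (j, 0) (z, w) = 0"
      "coord_riemann G (0, a) (0, a) (j, 0) (0, c) (z, w) = 0"
      "coord_riemann G (0, a) (0, a) (0, c) (j, 0) (z, w) = 0"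
    if "i \<in> Basis" "a \<in> Basis" for i a
    using that
    by (simp_all add: coord_riemann_def sum_Basis_Times s F.christoffel_symm[of w a c]
        if_distrib if_distribR sum.delta sum.delta' sum_subtractf sum_negf cong: if_cong)
  \<comment> \<open>\<open>zero\<close> speaks of a base vector and a fibre vector at once, so one
    of each is exhibited.\<close>
  have "(Basis :: 'a set) \<noteq> {}" "(Basis :: 'b set) \<noteq> {}" by simp_all
  then obtain i :: 'a and a :: 'b where "i \<in> Basis" "a \<in> Basis" by blast
  then show "coord_ricci G (j, 0) (0, c) (z, w) = 0" "coord_ricci G (0, c) (j, 0) (z, w) = 0"
    by (simp_all add: coord_ricci_def sum_Basis_Times zero)
qed

text \<open>In each base direction the terms in \<open>|grad f|^2\<close> cancel, and the remaining
  divergence sums to the Laplacian. Each fibre direction \<open>a\<close> contributes minus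
  \<open>|grad f|^2\<close> times the fibre metric, and the direction \<open>a = b\<close> alone
  gives it back once; hence the factor \<open>DIM('b) - 1\<close>.\<close>

lemma coord_ricci_G_fibre:
  assumes "z \<in> U" "w \<in> V" "b \<in> Basis" "c \<in> Basis"
  shows "coord_ricci G (0, b) (0, c) (z, w) = coord_ricci GF b c w
    - (f z * coord_laplacian GB f z
        + (real DIM('b) - 1) * (\<Sum>i\<in>Basis. pd i f z * (coord_grad GB f z \<bullet> i))) * GF b c w"
proof -
  note s = christoffel_G[OF assms(1,2)] pd_christoffel_G[OF assms(1,2)] assms
  have ne: "f z \<noteq> 0" using f_pos[OF assms(1)] by simp
  define N where "N = (\<Sum>i\<in>Basis. pd i f z * (coord_grad GB f z \<bullet> i))"
  define h where "h = GF b c w"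
  have pd0: "pd 0 (christoffel GB i i k) z = 0" if "i \<in> Basis" "k \<in> Basis" for i k
    using that assms by (intro pd_0 B.differentiable_christoffel)
  have "coord_riemann G (i, 0) (i, 0) (0, b) (0, c) (z, w) =
      - (f z * pd i (\<lambda>y. coord_grad GB f y \<bullet> i) z * h)
      - f z * (\<Sum>k\<in>Basis. christoffel GB i i k z * (coord_grad GB f z \<bullet> k)) * h"
    if i: "i \<in> Basis" for i
  proof -
    have "coord_riemann G (i, 0) (i, 0) (0, b) (0, c) (z, w) =
        - ((pd i f z * (coord_grad GB f z \<bullet> i) + f z * pd i (\<lambda>y. coord_grad GB f y \<bullet> i) z) * h)
        - (\<Sum>k\<in>Basis. christoffel GB i i k z * (f z * (coord_grad GB f z \<bullet> k) * h))
        + (\<Sum>a\<in>Basis. f z * (coord_grad GB f z \<bullet> i) * GF b a w * (if a = c then pd i f z / f z else 0))"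
      using i by (simp add: coord_riemann_def sum_Basis_Times s h_def sum_negf sum_subtractf)
    also have "(\<Sum>a\<in>Basis. f z * (coord_grad GB f z \<bullet> i) * GF b a w * (if a = c then pd i f z / f z else 0)) =
        pd i f z * (coord_grad GB f z \<bullet> i) * h"
      using assms ne by (simp add: if_distrib if_distribR sum.delta h_def cong: if_cong)
    finally show ?thesis by (simp add: algebra_simps sum_distrib_left)
  qed
  then have "(\<Sum>i\<in>Basis. coord_riemann G (i, 0) (i, 0) (0, b) (0, c) (z, w)) =
      (\<Sum>i\<in>Basis. - (f z * pd i (\<lambda>y. coord_grad GB f y \<bullet> i) z * h)
      - f z * (\<Sum>k\<in>Basis. christoffel GB i i k z * (coord_grad GB f z \<bullet> k)) * h)"
    by (intro sum.cong) auto
  then have base: "(\<Sum>i\<in>Basis. coord_riemann G (i, 0) (i, 0) (0, b) (0, c) (z, w)) =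
      - (f z * coord_laplacian GB f z * h)"
    by (simp add: B.laplacian_eq_divergence[OF f_smooth assms(1)] sum.distrib sum_subtractf sum_negf
        algebra_simps sum_distrib_left)
  have "coord_riemann G (0, a) (0, a) (0, b) (0, c) (z, w) =
      coord_riemann GF a a b c w - N * h + (if a = b then N * GF a c w else 0)"
    if a: "a \<in> Basis" for a
  proof -
    have "coord_riemann G (0, a) (0, a) (0, b) (0, c) (z, w) = coord_riemann GF a a b c w
        - (\<Sum>l\<in>Basis. pd l f z / f z * (f z * (coord_grad GB f z \<bullet> l) * h))
        + (\<Sum>l\<in>Basis. (if a = b then pd l f z / f z else 0) * (f z * (coord_grad GB f z \<bullet> l) * GF a c w))"
      using a by (simp add: coord_riemann_def sum_Basis_Times s h_def sum_negf sum_subtractf)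
    also have "(\<Sum>l\<in>Basis. pd l f z / f z * (f z * (coord_grad GB f z \<bullet> l) * h)) = N * h"
      using ne by (simp add: N_def sum_distrib_right mult.assoc)
    also have "(\<Sum>l\<in>Basis. (if a = b then pd l f z / f z else 0) * (f z * (coord_grad GB f z \<bullet> l) * GF a c w)) =
        (if a = b then N * GF a c w else 0)"
      using ne by (simp add: N_def sum_distrib_right mult.assoc)
    finally show ?thesis .
  qed
  then have "(\<Sum>a\<in>Basis. coord_riemann G (0, a) (0, a) (0, b) (0, c) (z, w)) =
      (\<Sum>a\<in>Basis. coord_riemann GF a a b c w - N * h + (if a = b then N * GF a c w else 0))"
    by (rule sum.cong[OF refl])
  then have "(\<Sum>a\<in>Basis. coord_riemann G (0, a) (0, a) (0, b) (0, c) (z, w)) =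
      coord_ricci GF b c w - (real DIM('b) - 1) * N * h"
    using assms by (simp add: coord_ricci_def sum.distrib sum_subtractf h_def algebra_simps)
  with base show ?thesis
    by (simp add: coord_ricci_def[of G] sum_Basis_Times N_def h_def algebra_simps)
qed

text \<open>On two fibre vectors the second derivative of a lift vanishes, so only the Christoffel
  symbols with upper index in the base remain.\<close>

lemma coord_hess_G:
  assumes h: "smooth_on U h" and zw: "z \<in> U" "w \<in> V"
  shows "\<lbrakk>i \<in> Basis; j \<in> Basis\<rbrakk> \<Longrightarrow> coord_hess G (\<lambda>x. h (fst x)) (i, 0) (j, 0) (z, w) = coord_hess GB h i j z"
    and "\<lbrakk>i \<in> Basis; b \<in> Basis\<rbrakk> \<Longrightarrow> coord_hess G (\<lambda>x. h (fst x)) (i, 0) (0, b) (z, w) = 0"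
    and "\<lbrakk>a \<in> Basis; j \<in> Basis\<rbrakk> \<Longrightarrow> coord_hess G (\<lambda>x. h (fst x)) (0, a) (j, 0) (z, w) = 0"
    and "\<lbrakk>a \<in> Basis; b \<in> Basis\<rbrakk> \<Longrightarrow> coord_hess G (\<lambda>x. h (fst x)) (0, a) (0, b) (z, w) =
      f z * (\<Sum>k\<in>Basis. pd k h z * (coord_grad GB f z \<bullet> k)) * GF a b w"
proof -
  have x: "(z, w) \<in> U \<times> V" using zw by simp
  have d: "h differentiable (at y)" if "y \<in> U" for y
    using that h smooth_on_differentiable by blast
  have d2: "pd i h differentiable (at y)" if "y \<in> U" "i \<in> Basis" for y i
    using that h smooth_on_differentiable smooth_on_pd by blast
  have pd: "pd v (\<lambda>x. h (fst x)) y = pd (fst v) h (fst y)" if "y \<in> U \<times> V" for v y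
    using that by (intro pd_fst_comp d) auto
  have pdB: "pd v (pd (j, 0) (\<lambda>x. h (fst x))) (z, w) = pd (fst v) (pd j h) z" if "j \<in> Basis" for v j
    using pd_fst_comp[of "pd j h" "(z, w)" v] d2[OF zw(1) that]
    by (subst pd_cong[OF open_Times_domain x, of _ "\<lambda>x. pd j h (fst x)"]) (auto simp: pd)
  have pdF: "pd v (pd (0, b) (\<lambda>x. h (fst x))) (z, w) = 0" for v b
    by (subst pd_cong[OF open_Times_domain x, of _ "\<lambda>x. 0"]) (auto simp: pd pd_0 d)
  note s = coord_hess_def sum_Basis_Times pd[OF x] pdB pdF christoffel_G[OF zw] d[OF zw(1)] d2[OF zw(1)]
  show "coord_hess G (\<lambda>x. h (fst x)) (i, 0) (j, 0) (z, w) = coord_hess GB h i j z"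
    if "i \<in> Basis" "j \<in> Basis" for i j
    using that by (simp add: s pd_0)
  show "coord_hess G (\<lambda>x. h (fst x)) (i, 0) (0, b) (z, w) = 0" if "i \<in> Basis" "b \<in> Basis" for i b
    using that by (simp add: s pd_0)
  show "coord_hess G (\<lambda>x. h (fst x)) (0, a) (j, 0) (z, w) = 0" if "a \<in> Basis" "j \<in> Basis" for a j
    using that by (simp add: s pd_0)
  show "coord_hess G (\<lambda>x. h (fst x)) (0, a) (0, b) (z, w) =
      f z * (\<Sum>k\<in>Basis. pd k h z * (coord_grad GB f z \<bullet> k)) * GF a b w" if "a \<in> Basis" "b \<in> Basis" for a b
    using that by (simp add: s pd_0 sum_negf sum_distrib_left sum_distrib_right mult_ac)
qed

end

section \<open>Charts and tangent vectors\<close>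

lemma
  assumes "smooth_atlas A" "c \<in> A"
  shows chart_domain_open: "open (fst c)"
    and chart_image_open: "open (snd c ` fst c)"
    and chart_continuous: "continuous_on (fst c) (snd c)"
    and chart_inv_continuous: "continuous_on (snd c ` fst c) (chart_inv c)"
    and chart_inv_chart: "p \<in> fst c \<Longrightarrow> chart_inv c (snd c p) = p"
    and chart_chart_inv: "z \<in> snd c ` fst c \<Longrightarrow> snd c (chart_inv c z) = z"
    and chart_inv_in_domain: "z \<in> snd c ` fst c \<Longrightarrow> chart_inv c z \<in> fst c"
  using assms by (auto simp: smooth_atlas_def homeomorphism_def inv_into_into f_inv_into_f)

lemma chart_cover:
  assumes "smooth_atlas A"
  obtains c where "c \<in> A" "p \<in> fst c"
  using assms unfolding smooth_atlas_def by (metis UNIV_I UN_E)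

lemma chart_transition:
  "\<lbrakk>smooth_atlas A; c \<in> A; d \<in> A\<rbrakk> \<Longrightarrow> smooth_on (snd c ` (fst c \<inter> fst d)) (snd d \<circ> chart_inv c)"
  by (simp add: smooth_atlas_def)

lemma chart_image_Int_open:
  assumes "smooth_atlas A" "c \<in> A" "open W"
  shows "open (snd c ` (fst c \<inter> W))"
proof -
  have "snd c ` (fst c \<inter> W) = chart_inv c -` W \<inter> snd c ` fst c"
    using chart_inv_chart[OF assms(1,2)] by (auto simp: image_iff)
  then show ?thesis
    using chart_inv_continuous[OF assms(1,2)] chart_image_open[OF assms(1,2)] assms(3)
    by (metis continuous_on_open_vimage)
qed

lemma chart_inv_image_open:
  assumes "smooth_atlas A" "c \<in> A" "open Z" "Z \<subseteq> snd c ` fst c"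
  shows "open (chart_inv c ` Z)"
proof -
  have "chart_inv c ` Z = snd c -` Z \<inter> fst c"
    using chart_inv_chart[OF assms(1,2)] chart_chart_inv[OF assms(1,2)] chart_inv_in_domain[OF assms(1,2)] assms(4)
    by (force simp: image_iff)
  then show ?thesis
    using chart_continuous[OF assms(1,2)] chart_domain_open[OF assms(1,2)] assms(3)
    by (metis continuous_on_open_vimage)
qed

section \<open>Tangent vectors and metrics in a chart\<close>

lemma smooth_at_differentiable:
  assumes "smooth_atlas A" "smooth_at A h p" "c \<in> A" "p \<in> fst c"
  shows "(h \<circ> chart_inv c) differentiable (at (snd c p))"
proof -
  obtain W where "p \<in> W" "smooth_on (snd c ` (fst c \<inter> W)) (h \<circ> chart_inv c)"
    using assms unfolding smooth_at_def by blast
  then show ?thesis using smooth_on_differentiable assms(4) by blast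
qed

text \<open>Linear functions of the coordinates are the test functions that recover the components
  of a tangent vector. The behaviour of \<open>snd c\<close> outside its domain is harmless because
  \<open>smooth_at\<close> is local.\<close>

lemma smooth_at_linear_chart:
  assumes "smooth_atlas A" "c \<in> A" "p \<in> fst c" "bounded_linear L"
  shows "smooth_at A (\<lambda>q. L (snd c q)) p"
  unfolding smooth_at_def
proof (intro exI[of _ "fst c"] conjI ballI)
  show "open (fst c)" "p \<in> fst c" by (rule chart_domain_open[OF assms(1,2)], rule assms)
  show "smooth_on (snd d ` (fst d \<inter> fst c)) ((\<lambda>q. L (snd c q)) \<circ> chart_inv d)" if "d \<in> A" for d
    using smooth_on_bounded_linear[OF chart_image_Int_open[OF assms(1) that \<open>open (fst c)\<close>] assms(4)
        chart_transition[OF assms(1) that assms(2)]]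
    by (simp add: o_def)
qed

lemma coord_vec_linear:
  assumes "smooth_atlas A" "c \<in> A" "p \<in> fst c"
  shows "coord_vec A c p (a *\<^sub>R u + b *\<^sub>R v) = (\<lambda>h. a * coord_vec A c p u h + b * coord_vec A c p v h)"
  using pd_linear[OF smooth_at_differentiable[OF assms(1) _ assms(2,3)]]
  by (auto simp: coord_vec_def fun_eq_iff linear_add linear_cmul)

lemma coord_vec_0:
  assumes "smooth_atlas A" "c \<in> A" "p \<in> fst c"
  shows "coord_vec A c p 0 = (\<lambda>_. 0)"
  using coord_vec_linear[OF assms, of 0 0 0 0] by simp

lemma coord_vec_eq_0_iff:
  assumes "smooth_atlas A" "c \<in> A" "p \<in> fst c"
  shows "coord_vec A c p u = (\<lambda>_. 0) \<longleftrightarrow> u = 0"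
proof
  assume *: "coord_vec A c p u = (\<lambda>_. 0)"
  \<comment> \<open>On this function the vector takes the value
    \<open>u \<bullet> u\<close>.\<close>
  define h where "h q = snd c q \<bullet> u" for q
  have "smooth_at A h p"
    unfolding h_def by (rule smooth_at_linear_chart[OF assms bounded_linear_inner_left])
  then have "0 = pd u (h \<circ> chart_inv c) (snd c p)"
    using fun_cong[OF *, of h] by (simp add: coord_vec_def)
  also have "\<dots> = pd u (\<lambda>z. z \<bullet> u) (snd c p)"
    using assms chart_chart_inv[OF assms(1,2)]
    by (intro pd_cong[OF chart_image_open[OF assms(1,2)]]) (auto simp: h_def)
  also have "\<dots> = u \<bullet> u"
    by (rule pd_eqI) (auto intro!: derivative_eq_intros)
  finally show "u = 0" by simp
qed (simp add: coord_vec_0[OF assms])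

lemma coord_vec_in_tangent_space: "c \<in> A \<Longrightarrow> p \<in> fst c \<Longrightarrow> coord_vec A c p u \<in> tangent_space A p"
  unfolding tangent_space_def by blast

lemma zero_in_tangent_space: "smooth_atlas A \<Longrightarrow> (\<lambda>_. 0) \<in> tangent_space A p"
  using chart_cover[of A p] coord_vec_0[of A _ p] coord_vec_in_tangent_space[of _ A p] by metis

lemma
  assumes "riemannian_metric A g" "X \<in> tangent_space A p"
  shows riemannian_metric_symm: "Y \<in> tangent_space A p \<Longrightarrow> g p X Y = g p Y X"
    and riemannian_metric_linear: "\<lbrakk>Y \<in> tangent_space A p; Z \<in> tangent_space A p\<rbrakk> \<Longrightarrow>
      g p (\<lambda>h. a * X h + b * Y h) Z = a * g p X Z + b * g p Y Z"
    and riemannian_metric_pos: "X \<noteq> (\<lambda>_. 0) \<Longrightarrow> g p X X > 0"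
    and riemannian_metric_zero: "g p (\<lambda>_. 0) X = 0"
    and riemannian_metric_nonneg: "g p X X \<ge> 0"
proof -
  show lin: "g p (\<lambda>h. a * X h + b * Y h) Z = a * g p X Z + b * g p Y Z"
    if "Y \<in> tangent_space A p" "Z \<in> tangent_space A p" for a b Y Z
    using that assms unfolding riemannian_metric_def by blast
  show "Y \<in> tangent_space A p \<Longrightarrow> g p X Y = g p Y X"
    using assms unfolding riemannian_metric_def by blast
  show pos: "X \<noteq> (\<lambda>_. 0) \<Longrightarrow> g p X X > 0"
    using assms unfolding riemannian_metric_def by blast
  show zero: "g p (\<lambda>_. 0) X = 0"
    using lin[of X X 0 0] assms by simp
  show "g p X X \<ge> 0"
    using pos zero by (cases "X = (\<lambda>_. 0)") auto
qed

text \<open>\<open>riemannian_metric\<close> provides linearity in the first argument; linearity in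
  the second comes from symmetry.\<close>

lemma metric_coord_vec:
  assumes A: "smooth_atlas A" and g: "riemannian_metric A g" and c: "c \<in> A" "p \<in> fst c"
  shows "g p (coord_vec A c p u) (coord_vec A c p v) =
    (\<Sum>i\<in>Basis. \<Sum>j\<in>Basis. metric_comp A g c i j p * (u \<bullet> i) * (v \<bullet> j))"
proof -
  note T = coord_vec_in_tangent_space[OF c]
  define M where "M u v = g p (coord_vec A c p u) (coord_vec A c p v)" for u v
  have comb: "M (a *\<^sub>R u + b *\<^sub>R u') v = a * M u v + b * M u' v" for a b u u' v
    unfolding M_def coord_vec_linear[OF A c] by (intro riemannian_metric_linear[OF g] T)
  have lin: "linear (\<lambda>u. M u v)" for v
    using comb[of 1 _ 1] comb[of _ _ 0] by (intro linearI) (simp_all)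
  have sym: "M u v = M v u" for u v
    unfolding M_def by (intro riemannian_metric_symm[OF g] T)
  have expand: "M u v = (\<Sum>i\<in>Basis. (u \<bullet> i) * M i v)" for u v
  proof -
    have "M u v = M (\<Sum>i\<in>Basis. (u \<bullet> i) *\<^sub>R i) v" by (simp add: euclidean_representation)
    also have "\<dots> = (\<Sum>i\<in>Basis. (u \<bullet> i) * M i v)"
      by (simp add: linear_sum[OF lin] linear_cmul[OF lin])
    finally show ?thesis .
  qed
  have "M u v = (\<Sum>i\<in>Basis. (u \<bullet> i) * (\<Sum>j\<in>Basis. (v \<bullet> j) * M j i))"
    unfolding expand[of u v] using expand[of v] sym by simp
  then show ?thesis
    by (simp add: M_def metric_comp_def sum_distrib_left sym[unfolded M_def] mult_ac)
qed

text \<open>Positivity carries over because nonzero components give a nonzero tangent vector, by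
  \<open>coord_vec_eq_0_iff\<close>.\<close>

lemma local_metric_coord_metric_on:
  assumes A: "smooth_atlas A" and g: "riemannian_metric A g" and c: "c \<in> A"
  shows "coord_metric_on (snd c ` fst c) (local_metric A g c)"
proof
  show "open (snd c ` fst c)" by (rule chart_image_open[OF A c])
  note T = coord_vec_in_tangent_space[OF c]
  show "local_metric A g c i j z = local_metric A g c j i z" if "z \<in> snd c ` fst c" for z i j
    using chart_inv_in_domain[OF A c that]
    by (auto simp: metric_comp_def intro!: riemannian_metric_symm[OF g] T)
  show "0 < (\<Sum>i\<in>Basis. \<Sum>j\<in>Basis. local_metric A g c i j z * (v \<bullet> i) * (v \<bullet> j))"
    if "z \<in> snd c ` fst c" "v \<noteq> 0" for z v
    using riemannian_metric_pos[OF g T[OF chart_inv_in_domain[OF A c that(1)]], of v] that(2)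
      coord_vec_eq_0_iff[OF A c chart_inv_in_domain[OF A c that(1)], of v]
    by (simp add: metric_coord_vec[OF A g c chart_inv_in_domain[OF A c that(1)]])
  show "smooth_on (snd c ` fst c) (local_metric A g c i j)" if "i \<in> Basis" "j \<in> Basis" for i j
    using g c that by (simp add: riemannian_metric_def)
qed

text \<open>Brings inner products of gradients into the form in which the warped Ricci tensor and
  Hessian produce them: one differential applied to one gradient.\<close>

lemma metric_grad:
  assumes A: "smooth_atlas A" and g: "riemannian_metric A g" and c: "c \<in> A" "p \<in> fst c"
  shows "g p (grad A g c h p) (grad A g c k p) =
    (\<Sum>i\<in>Basis. pd i (h \<circ> chart_inv c) (snd c p) *
      (coord_grad (local_metric A g c) (k \<circ> chart_inv c) (snd c p) \<bullet> i))"
proof -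
  interpret coord_metric_on "snd c ` fst c" "local_metric A g c"
    by (rule local_metric_coord_metric_on[OF A g c(1)])
  let ?z = "snd c p"
  let ?H = "coord_grad (local_metric A g c) (h \<circ> chart_inv c) ?z"
  let ?K = "coord_grad (local_metric A g c) (k \<circ> chart_inv c) ?z"
  have z: "?z \<in> snd c ` fst c" using c by auto
  have "g p (grad A g c h p) (grad A g c k p) =
      (\<Sum>i\<in>Basis. \<Sum>j\<in>Basis. local_metric A g c i j ?z * (?H \<bullet> i) * (?K \<bullet> j))"
    unfolding grad_def metric_coord_vec[OF A g c] using chart_inv_chart[OF A c(1)] c by simp
  also have "\<dots> = (\<Sum>j\<in>Basis. \<Sum>i\<in>Basis. local_metric A g c j i ?z * (?H \<bullet> i) * (?K \<bullet> j))"
    by (subst sum.swap) (auto intro!: sum.cong simp: symm[OF z, unfolded o_apply])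
  also have "\<dots> = (\<Sum>j\<in>Basis. (\<Sum>i\<in>Basis. local_metric A g c j i ?z * (?H \<bullet> i)) * (?K \<bullet> j))"
    by (simp add: sum_distrib_right)
  also have "\<dots> = (\<Sum>i\<in>Basis. pd i (h \<circ> chart_inv c) ?z * (?K \<bullet> i))"
    using z by (intro sum.cong refl) (simp only: metric_coord_grad)
  finally show ?thesis .
qed

section \<open>Products of manifolds\<close>

abbreviation prod_chart :: "('p, 'a) chart \<Rightarrow> ('q, 'b) chart \<Rightarrow> ('p \<times> 'q, 'a \<times> 'b) chart" where
  "prod_chart x y \<equiv> (fst x \<times> fst y, map_prod (snd x) (snd y))"

lemma prod_atlas_cases:
  assumes "c \<in> prod_atlas A C"
  obtains x y where "c = prod_chart x y" "x \<in> A" "y \<in> C"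
  using assms by (auto simp: prod_atlas_def)

lemma prod_chart_in_atlas: "x \<in> A \<Longrightarrow> y \<in> C \<Longrightarrow> prod_chart x y \<in> prod_atlas A C"
  unfolding prod_atlas_def by blast

lemma prod_chart_inv:
  assumes A: "smooth_atlas A" "x \<in> A" and C: "smooth_atlas C" "y \<in> C"
    and "z \<in> snd x ` fst x" "w \<in> snd y ` fst y"
  shows "chart_inv (prod_chart x y) (z, w) = (chart_inv x z, chart_inv y w)"
proof (rule inv_into_f_eq)
  have "inj_on (snd x) (fst x)" "inj_on (snd y) (fst y)"
    using chart_inv_chart[OF A] chart_inv_chart[OF C] by (metis inj_on_inverseI)+
  then show "inj_on (snd (prod_chart x y)) (fst (prod_chart x y))"
    by (auto simp: inj_on_def)
qed (use assms in \<open>auto simp: inv_into_into f_inv_into_f\<close>)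

lemma prod_chart_image_Int:
  "snd (prod_chart x y) ` (fst (prod_chart x y) \<inter> W \<times> Z) =
    snd x ` (fst x \<inter> W) \<times> snd y ` (fst y \<inter> Z)"
  by (auto simp: image_iff)

lemma prod_chart_image:
  "snd (prod_chart x y) ` fst (prod_chart x y) = snd x ` fst x \<times> snd y ` fst y"
  using prod_chart_image_Int[of x y UNIV UNIV] by simp

lemma smooth_atlas_prod:
  assumes A: "smooth_atlas A" and C: "smooth_atlas C"
  shows "smooth_atlas (prod_atlas A C)"
  unfolding smooth_atlas_def
proof (intro conjI ballI)
  fix c assume "c \<in> prod_atlas A C"
  then obtain x y where c: "c = prod_chart x y" and x: "x \<in> A" and y: "y \<in> C"
    by (rule prod_atlas_cases)
  show "open (fst c)" using chart_domain_open[OF A x] chart_domain_open[OF C y] by (simp add: c open_Times)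
  show "open (snd c ` fst c)"
    unfolding c prod_chart_image by (intro open_Times chart_image_open[OF A x] chart_image_open[OF C y])
  show "homeomorphism (fst c) (snd c ` fst c) (snd c) (chart_inv c)"
  proof -
    have "continuous_on (snd x ` fst x \<times> snd y ` fst y) (\<lambda>z. (chart_inv x (fst z), chart_inv y (snd z)))"
      by (intro continuous_on_Pair continuous_on_compose2[OF chart_inv_continuous[OF A x]]
          continuous_on_compose2[OF chart_inv_continuous[OF C y]] continuous_on_fst continuous_on_snd continuous_on_id)
        auto
    then have "continuous_on (snd c ` fst c) (chart_inv c)"
      unfolding c prod_chart_image
      by (rule continuous_on_eq) (auto simp: prod_chart_inv[OF A x C y, simplified])
    moreover have "continuous_on (fst x \<times> fst y) (\<lambda>p. (snd x (fst p), snd y (snd p)))"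
      by (intro continuous_on_Pair continuous_on_compose2[OF chart_continuous[OF A x]]
          continuous_on_compose2[OF chart_continuous[OF C y]] continuous_on_fst continuous_on_snd continuous_on_id)
        auto
    then have "continuous_on (fst c) (snd c)" by (simp add: c map_prod_def case_prod_beta')
    moreover have inv: "chart_inv c (snd c p) = p" if "p \<in> fst c" for p
      using that chart_inv_chart[OF A x] chart_inv_chart[OF C y]
      by (auto simp: c prod_chart_inv[OF A x C y, simplified])
    moreover have "chart_inv c ` snd c ` fst c = fst c" by (simp add: image_image inv)
    ultimately show ?thesis
      by (simp add: homeomorphism_def f_inv_into_f)
  qed
next
  have "p \<in> (\<Union>c\<in>prod_atlas A C. fst c)" for p :: "'a \<times> 'c"
  proof -
    obtain x y where "x \<in> A" "fst p \<in> fst x" "y \<in> C" "snd p \<in> fst y"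
      using chart_cover[OF A] chart_cover[OF C] by metis
    then show ?thesis using prod_chart_in_atlas[of x A y C] by (force simp: mem_Times_iff)
  qed
  then show "(\<Union>c\<in>prod_atlas A C. fst c) = UNIV" by auto
next
  fix c d assume "c \<in> prod_atlas A C" "d \<in> prod_atlas A C"
  then obtain x y x' y' where c: "c = prod_chart x y" and x: "x \<in> A" and y: "y \<in> C"
    and d: "d = prod_chart x' y'" and x': "x' \<in> A" and y': "y' \<in> C"
    by (elim prod_atlas_cases)
  define S T where "S = snd x ` (fst x \<inter> fst x')" and "T = snd y ` (fst y \<inter> fst y')"
  have S: "open S" and T: "open T"
    unfolding S_def T_def
    by (intro chart_image_Int_open[OF A x] chart_image_Int_open[OF C y]
        chart_domain_open[OF A x'] chart_domain_open[OF C y'])+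
  have dom: "snd c ` (fst c \<inter> fst d) = S \<times> T"
    unfolding c d S_def T_def using prod_chart_image_Int[of x y "fst x'" "fst y'"] by simp
  have tx: "smooth_on S (snd x' \<circ> chart_inv x)" and ty: "smooth_on T (snd y' \<circ> chart_inv y)"
    unfolding S_def T_def by (rule chart_transition[OF A x x'], rule chart_transition[OF C y y'])
  \<comment> \<open>Pairing two smooth maps is written as the sum of two linear embeddings, since
    smoothness is known to be stable under sums and bounded linear maps.\<close>
  have "bounded_linear (\<lambda>u::'b. (u, 0::'d))" "bounded_linear (\<lambda>u::'d. (0::'b, u))"
    by (auto intro!: bounded_linear_Pair bounded_linear_ident bounded_linear_zero)
  then have "smooth_on (S \<times> T) (\<lambda>q. ((snd x' \<circ> chart_inv x) (fst q), 0) + (0, (snd y' \<circ> chart_inv y) (snd q)))"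
    by (intro smooth_on_add open_Times S T
        smooth_on_bounded_linear[of _ "\<lambda>u. (u, 0)"] smooth_on_bounded_linear[of _ "\<lambda>u. (0, u)"]
        smooth_on_fst_comp smooth_on_snd_comp tx ty)
  moreover have "(snd d \<circ> chart_inv c) q =
      ((snd x' \<circ> chart_inv x) (fst q), 0) + (0, (snd y' \<circ> chart_inv y) (snd q))" if "q \<in> S \<times> T" for q
  proof -
    have "fst q \<in> snd x ` fst x" "snd q \<in> snd y ` fst y" using that by (auto simp: S_def T_def)
    then have "chart_inv c q = (chart_inv x (fst q), chart_inv y (snd q))"
      unfolding c using prod_chart_inv[OF A x C y, of "fst q" "snd q"] by simp
    then show ?thesis by (simp add: d)
  qed
  ultimately show "smooth_on (snd c ` (fst c \<inter> fst d)) (snd d \<circ> chart_inv c)"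
    unfolding dom by (subst smooth_on_cong[OF open_Times[OF S T]])
qed

lemma smooth_manifold_prod:
  assumes "smooth_manifold A" "smooth_manifold C"
  shows "smooth_manifold (prod_atlas A C)"
  using assms smooth_atlas_prod connected_Times[of "UNIV :: 'a set" "UNIV :: 'c set"]
  by (auto simp: smooth_manifold_def)

text \<open>\<open>push_forward\<close> evaluates a vector of the product at
  \<open>h \<circ> fst\<close>, and vectors are set to 0 on functions that are not smooth. This
  lemma keeps that default from interfering.\<close>

lemma smooth_at_fst:
  assumes A: "smooth_atlas A" and C: "smooth_atlas C" and h: "smooth_at A h (fst p)"
  shows "smooth_at (prod_atlas A C) (h \<circ> fst) p"
proof -
  obtain W where W: "open W" "fst p \<in> W" "\<And>c. c \<in> A \<Longrightarrow> smooth_on (snd c ` (fst c \<inter> W)) (h \<circ> chart_inv c)"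
    using h unfolding smooth_at_def by blast
  have "smooth_on (snd c ` (fst c \<inter> W \<times> UNIV)) ((h \<circ> fst) \<circ> chart_inv c)" if cc: "c \<in> prod_atlas A C" for c
  proof -
    obtain x y where c: "c = prod_chart x y" and x: "x \<in> A" and y: "y \<in> C"
      using cc by (rule prod_atlas_cases)
    have o: "open (snd x ` (fst x \<inter> W))" "open (snd y ` fst y)"
      using chart_image_Int_open[OF A x W(1)] chart_image_open[OF C y] by auto
    have "smooth_on (snd x ` (fst x \<inter> W) \<times> snd y ` fst y) (\<lambda>q. (h \<circ> chart_inv x) (fst q))"
      by (intro smooth_on_fst_comp o W(3) x)
    moreover have "((h \<circ> fst) \<circ> chart_inv c) q = (h \<circ> chart_inv x) (fst q)"
      if "q \<in> snd x ` (fst x \<inter> W) \<times> snd y ` fst y" for q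
      using that unfolding c o_def by (auto simp: prod_chart_inv[OF A x C y, simplified])
    ultimately have "smooth_on (snd x ` (fst x \<inter> W) \<times> snd y ` fst y) ((h \<circ> fst) \<circ> chart_inv c)"
      using smooth_on_cong[OF open_Times[OF o], of "(h \<circ> fst) \<circ> chart_inv c" "\<lambda>q. (h \<circ> chart_inv x) (fst q)"] by blast
    then show ?thesis using prod_chart_image_Int[of x y W UNIV] by (simp add: c)
  qed
  then show ?thesis
    unfolding smooth_at_def using W by (intro exI[of _ "W \<times> UNIV"]) (auto simp: open_Times mem_Times_iff)
qed

lemma smooth_at_snd:
  assumes A: "smooth_atlas A" and C: "smooth_atlas C" and h: "smooth_at C h (snd p)"
  shows "smooth_at (prod_atlas A C) (h \<circ> snd) p"
proof -
  obtain W where W: "open W" "snd p \<in> W" "\<And>c. c \<in> C \<Longrightarrow> smooth_on (snd c ` (fst c \<inter> W)) (h \<circ> chart_inv c)"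
    using h unfolding smooth_at_def by blast
  have "smooth_on (snd c ` (fst c \<inter> UNIV \<times> W)) ((h \<circ> snd) \<circ> chart_inv c)" if cc: "c \<in> prod_atlas A C" for c
  proof -
    obtain x y where c: "c = prod_chart x y" and x: "x \<in> A" and y: "y \<in> C"
      using cc by (rule prod_atlas_cases)
    have o: "open (snd x ` fst x)" "open (snd y ` (fst y \<inter> W))"
      using chart_image_Int_open[OF C y W(1)] chart_image_open[OF A x] by auto
    have "smooth_on (snd x ` fst x \<times> snd y ` (fst y \<inter> W)) (\<lambda>q. (h \<circ> chart_inv y) (snd q))"
      by (intro smooth_on_snd_comp o W(3) y)
    moreover have "((h \<circ> snd) \<circ> chart_inv c) q = (h \<circ> chart_inv y) (snd q)"
      if "q \<in> snd x ` fst x \<times> snd y ` (fst y \<inter> W)" for q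
      using that unfolding c o_def by (auto simp: prod_chart_inv[OF A x C y, simplified])
    ultimately have "smooth_on (snd x ` fst x \<times> snd y ` (fst y \<inter> W)) ((h \<circ> snd) \<circ> chart_inv c)"
      using smooth_on_cong[OF open_Times[OF o], of "(h \<circ> snd) \<circ> chart_inv c" "\<lambda>q. (h \<circ> chart_inv y) (snd q)"] by blast
    then show ?thesis using prod_chart_image_Int[of x y UNIV W] by (simp add: c)
  qed
  then show ?thesis
    unfolding smooth_at_def using W by (intro exI[of _ "UNIV \<times> W"]) (auto simp: open_Times mem_Times_iff)
qed

lemma smooth_fun_fst:
  assumes A: "smooth_atlas A" and C: "smooth_atlas C" and h: "smooth_fun A h"
  shows "smooth_fun (prod_atlas A C) (h \<circ> fst)"
  unfolding smooth_fun_def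
proof
  fix c assume "c \<in> prod_atlas A C"
  then obtain x y where c: "c = prod_chart x y" and x: "x \<in> A" and y: "y \<in> C"
    by (rule prod_atlas_cases)
  have o: "open (snd x ` fst x)" "open (snd y ` fst y)"
    using chart_image_open[OF A x] chart_image_open[OF C y] by auto
  have "smooth_on (snd x ` fst x \<times> snd y ` fst y) (\<lambda>q. (h \<circ> chart_inv x) (fst q))"
    by (intro smooth_on_fst_comp o bspec[OF h[unfolded smooth_fun_def] x])
  moreover have "((h \<circ> fst) \<circ> chart_inv c) q = (h \<circ> chart_inv x) (fst q)"
    if "q \<in> snd x ` fst x \<times> snd y ` fst y" for q
    using that unfolding c o_def by (auto simp: prod_chart_inv[OF A x C y, simplified])
    ultimately have "smooth_on (snd x ` fst x \<times> snd y ` fst y) ((h \<circ> fst) \<circ> chart_inv c)"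
      using smooth_on_cong[OF open_Times[OF o], of "(h \<circ> fst) \<circ> chart_inv c" "\<lambda>q. (h \<circ> chart_inv x) (fst q)"] by blast
    then show "smooth_on (snd c ` fst c) (h \<circ> fst \<circ> chart_inv c)"
    using prod_chart_image[of x y] by (simp add: c)
qed

lemma push_forward_coord_vec:
  assumes A: "smooth_atlas A" "x \<in> A" and C: "smooth_atlas C" "y \<in> C"
    and p: "fst p \<in> fst x" "snd p \<in> fst y"
  shows "push_forward A fst p (coord_vec (prod_atlas A C) (prod_chart x y) p u) = coord_vec A x (fst p) (fst u)"
    and "push_forward C snd p (coord_vec (prod_atlas A C) (prod_chart x y) p u) = coord_vec C y (snd p) (snd u)"
proof -
  let ?c = "prod_chart x y"
  have o: "open (snd x ` fst x \<times> snd y ` fst y)"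
    by (intro open_Times chart_image_open[OF A] chart_image_open[OF C])
  have zw: "snd ?c p = (snd x (fst p), snd y (snd p))"
    by (simp add: map_prod_def case_prod_beta)
  have mem: "snd ?c p \<in> snd x ` fst x \<times> snd y ` fst y" unfolding zw using p by auto
  have inv: "chart_inv ?c q = (chart_inv x (fst q), chart_inv y (snd q))"
    if "q \<in> snd x ` fst x \<times> snd y ` fst y" for q
    using that prod_chart_inv[OF A C, of "fst q" "snd q"] by (simp only: mem_Times_iff prod.collapse)
  show "push_forward A fst p (coord_vec (prod_atlas A C) ?c p u) = coord_vec A x (fst p) (fst u)"
  proof
    fix h
    have "pd u ((h \<circ> fst) \<circ> chart_inv ?c) (snd ?c p) = pd (fst u) (h \<circ> chart_inv x) (snd x (fst p))"
      if h: "smooth_at A h (fst p)"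
    proof -
      have "pd u ((h \<circ> fst) \<circ> chart_inv ?c) (snd ?c p) = pd u (\<lambda>q. (h \<circ> chart_inv x) (fst q)) (snd ?c p)"
        by (intro pd_cong[OF o mem]) (use inv in auto)
      also have "\<dots> = pd (fst u) (h \<circ> chart_inv x) (fst (snd ?c p))"
        using smooth_at_differentiable[OF A(1) h A(2) p(1)] by (intro pd_fst_comp) (simp only: zw fst_conv)
      finally show ?thesis by (simp only: zw fst_conv)
    qed
    then show "push_forward A fst p (coord_vec (prod_atlas A C) ?c p u) h = coord_vec A x (fst p) (fst u) h"
      using smooth_at_fst[OF A(1) C(1), of h p] by (auto simp: push_forward_def coord_vec_def)
  qed
  show "push_forward C snd p (coord_vec (prod_atlas A C) ?c p u) = coord_vec C y (snd p) (snd u)"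
  proof
    fix h
    have "pd u ((h \<circ> snd) \<circ> chart_inv ?c) (snd ?c p) = pd (snd u) (h \<circ> chart_inv y) (snd y (snd p))"
      if h: "smooth_at C h (snd p)"
    proof -
      have "pd u ((h \<circ> snd) \<circ> chart_inv ?c) (snd ?c p) = pd u (\<lambda>q. (h \<circ> chart_inv y) (snd q)) (snd ?c p)"
        by (intro pd_cong[OF o mem]) (use inv in auto)
      also have "\<dots> = pd (snd u) (h \<circ> chart_inv y) (snd (snd ?c p))"
        using smooth_at_differentiable[OF C(1) h C(2) p(2)] by (intro pd_snd_comp) (simp add: o_def)
      finally show ?thesis by simp
    qed
    then show "push_forward C snd p (coord_vec (prod_atlas A C) ?c p u) h = coord_vec C y (snd p) (snd u) h"
      using smooth_at_snd[OF A(1) C(1), of h p] by (auto simp: push_forward_def coord_vec_def)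
  qed
qed

lemma push_forward_linear:
  "push_forward A F p (\<lambda>h. a * X h + b * Y h) = (\<lambda>h. a * push_forward A F p X h + b * push_forward A F p Y h)"
  by (auto simp: push_forward_def)

section \<open>Warped products\<close>

text \<open>The third claim is what makes the warped metric definite: a vector killed by both
  projections is 0.\<close>

lemma push_forward_in_tangent_space:
  assumes A: "smooth_atlas A" and C: "smooth_atlas C" and X: "X \<in> tangent_space (prod_atlas A C) p"
  shows "push_forward A fst p X \<in> tangent_space A (fst p)"
    and "push_forward C snd p X \<in> tangent_space C (snd p)"
    and "X \<noteq> (\<lambda>_. 0) \<Longrightarrow> push_forward A fst p X \<noteq> (\<lambda>_. 0) \<or> push_forward C snd p X \<noteq> (\<lambda>_. 0)"
proof -
  obtain c u where cu: "X = coord_vec (prod_atlas A C) c p u" "c \<in> prod_atlas A C" "p \<in> fst c"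
    using X unfolding tangent_space_def by blast
  obtain x y where c: "c = prod_chart x y" and x: "x \<in> A" and y: "y \<in> C"
    using cu(2) by (rule prod_atlas_cases)
  have p: "fst p \<in> fst x" "snd p \<in> fst y" using cu(3) by (auto simp: c)
  note pf = push_forward_coord_vec[OF A x C y p, of u, folded c, folded cu(1)]
  show "push_forward A fst p X \<in> tangent_space A (fst p)" "push_forward C snd p X \<in> tangent_space C (snd p)"
    unfolding pf by (auto intro!: coord_vec_in_tangent_space x y p)
  assume "X \<noteq> (\<lambda>_. 0)"
  then have "u \<noteq> 0"
    unfolding cu(1) coord_vec_eq_0_iff[OF smooth_atlas_prod[OF A C] cu(2,3)] .
  then have "fst u \<noteq> 0 \<or> snd u \<noteq> 0" by (auto simp: prod_eq_iff)
  then show "push_forward A fst p X \<noteq> (\<lambda>_. 0) \<or> push_forward C snd p X \<noteq> (\<lambda>_. 0)"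
    unfolding pf coord_vec_eq_0_iff[OF A x p(1)] coord_vec_eq_0_iff[OF C y p(2)] .
qed

text \<open>The bridge to the computation in coordinates. \<open>(i, 0)\<close> projects to the zero
  vector of the fibre and \<open>(0, a)\<close> to that of the base, on which the metrics vanish;
  this produces the block form.\<close>

lemma warped_coords_local_metric:
  assumes A: "smooth_atlas A" "riemannian_metric A gA" "x \<in> A"
    and C: "smooth_atlas C" "riemannian_metric C gC" "y \<in> C"
    and f: "smooth_fun A f" "\<And>p. f p > 0"
  shows "warped_coords (snd x ` fst x) (local_metric A gA x) (snd y ` fst y) (local_metric C gC y)
    (f \<circ> chart_inv x) (local_metric (prod_atlas A C) (warped_metric A gA f C gC) (prod_chart x y))"
proof -
  let ?G = "local_metric (prod_atlas A C) (warped_metric A gA f C gC) (prod_chart x y)"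
  interpret A: coord_metric_on "snd x ` fst x" "local_metric A gA x"
    by (rule local_metric_coord_metric_on[OF A])
  interpret C: coord_metric_on "snd y ` fst y" "local_metric C gC y"
    by (rule local_metric_coord_metric_on[OF C])
  have G: "?G I J (z, w) =
      gA (chart_inv x z) (coord_vec A x (chart_inv x z) (fst I)) (coord_vec A x (chart_inv x z) (fst J)) +
      (f (chart_inv x z))\<^sup>2 *
      gC (chart_inv y w) (coord_vec C y (chart_inv y w) (snd I)) (coord_vec C y (chart_inv y w) (snd J))"
    if "z \<in> snd x ` fst x" "w \<in> snd y ` fst y" for z w I J
  proof -
    have "fst (chart_inv x z, chart_inv y w) \<in> fst x" "snd (chart_inv x z, chart_inv y w) \<in> fst y"
      using chart_inv_in_domain[OF A(1,3) that(1)] chart_inv_in_domain[OF C(1,3) that(2)] by auto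
    note pf = push_forward_coord_vec[OF A(1,3) C(1,3) this]
    show ?thesis
      using pf prod_chart_inv[OF A(1,3) C(1,3) that]
      by (simp add: metric_comp_def warped_metric_def)
  qed
  have zA: "gA p (\<lambda>_. 0) (coord_vec A x p u) = 0" "gA p (coord_vec A x p u) (\<lambda>_. 0) = 0"
    if "p \<in> fst x" for p u
    using riemannian_metric_zero[OF A(2) coord_vec_in_tangent_space[OF A(3) that]]
      riemannian_metric_symm[OF A(2) zero_in_tangent_space[OF A(1)] coord_vec_in_tangent_space[OF A(3) that]]
    by auto
  have zC: "gC p (\<lambda>_. 0) (coord_vec C y p u) = 0" "gC p (coord_vec C y p u) (\<lambda>_. 0) = 0"
    if "p \<in> fst y" for p u
    using riemannian_metric_zero[OF C(2) coord_vec_in_tangent_space[OF C(3) that]]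
      riemannian_metric_symm[OF C(2) zero_in_tangent_space[OF C(1)] coord_vec_in_tangent_space[OF C(3) that]]
    by auto
  note z = G[unfolded fst_conv snd_conv] zA[OF chart_inv_in_domain[OF A(1,3)]] zC[OF chart_inv_in_domain[OF C(1,3)]]
    coord_vec_0[OF A(1,3) chart_inv_in_domain[OF A(1,3)]]
    coord_vec_0[OF C(1,3) chart_inv_in_domain[OF C(1,3)]]
    riemannian_metric_zero[OF A(2) zero_in_tangent_space[OF A(1)]]
    riemannian_metric_zero[OF C(2) zero_in_tangent_space[OF C(1)]]
  show ?thesis
  proof
    show "smooth_on (snd x ` fst x) (f \<circ> chart_inv x)"
      using f(1) A(3) by (simp add: smooth_fun_def)
    show "0 < (f \<circ> chart_inv x) z" for z using f(2) by simp
  qed (simp_all only: z fst_conv snd_conv, simp_all add: metric_comp_def)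
qed

lemma riemannian_metric_warped:
  assumes A: "smooth_atlas A" "riemannian_metric A gA"
    and C: "smooth_atlas C" "riemannian_metric C gC"
    and f: "smooth_fun A f" "\<And>p. f p > 0"
  shows "riemannian_metric (prod_atlas A C) (warped_metric A gA f C gC)"
  unfolding riemannian_metric_def
proof (intro conjI allI ballI impI)
  fix p X assume X: "X \<in> tangent_space (prod_atlas A C) p"
  note pX = push_forward_in_tangent_space[OF A(1) C(1) X]
  {
    fix Y assume Y: "Y \<in> tangent_space (prod_atlas A C) p"
    note pY = push_forward_in_tangent_space[OF A(1) C(1) Y]
    show "warped_metric A gA f C gC p X Y = warped_metric A gA f C gC p Y X"
      unfolding warped_metric_def
      using riemannian_metric_symm[OF A(2) pX(1) pY(1)] riemannian_metric_symm[OF C(2) pX(2) pY(2)] by simp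
    fix Z a b assume Z: "Z \<in> tangent_space (prod_atlas A C) p"
    note pZ = push_forward_in_tangent_space[OF A(1) C(1) Z]
    show "warped_metric A gA f C gC p (\<lambda>h. a * X h + b * Y h) Z =
        a * warped_metric A gA f C gC p X Z + b * warped_metric A gA f C gC p Y Z"
      unfolding warped_metric_def push_forward_linear
        riemannian_metric_linear[OF A(2) pX(1) pY(1) pZ(1)] riemannian_metric_linear[OF C(2) pX(2) pY(2) pZ(2)]
      by (simp add: algebra_simps)
  }
  show "0 < warped_metric A gA f C gC p X X" if "X \<noteq> (\<lambda>_. 0)"
    using pX(3)[OF that] riemannian_metric_pos[OF A(2) pX(1)] riemannian_metric_pos[OF C(2) pX(2)]
      riemannian_metric_nonneg[OF A(2) pX(1)] riemannian_metric_nonneg[OF C(2) pX(2)] f(2)[of "fst p"]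
    unfolding warped_metric_def
    by (metis add_nonneg_pos add_pos_nonneg mult_pos_pos zero_less_power mult_nonneg_nonneg less_imp_le)
next
  fix c and I J :: "'b \<times> 'd" assume "c \<in> prod_atlas A C" and IJ: "I \<in> Basis" "J \<in> Basis"
  then obtain x y where c: "c = prod_chart x y" and x: "x \<in> A" and y: "y \<in> C"
    by (elim prod_atlas_cases)
  interpret warped_coords "snd x ` fst x" "local_metric A gA x" "snd y ` fst y" "local_metric C gC y"
    "f \<circ> chart_inv x" "local_metric (prod_atlas A C) (warped_metric A gA f C gC) (prod_chart x y)"
    by (rule warped_coords_local_metric[OF A x C y f])
  show "smooth_on (snd c ` fst c)
      (metric_comp (prod_atlas A C) (warped_metric A gA f C gC) c I J \<circ> chart_inv c)"
    using T.smooth[OF IJ] prod_chart_image[of x y] by (simp add: c)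
qed

text \<open>The equations are asked for only at \<open>p\<close> and \<open>q\<close> and in one
  pair of charts; since every chart of the product atlas comes from such a pair, this covers the
  whole product.\<close>

lemma ricci_hess_warped:
  fixes A :: "('p::{t2_space,second_countable_topology}, 'a::euclidean_space) chart set"
    and C :: "('q::{t2_space,second_countable_topology}, 'd::euclidean_space) chart set"
  assumes A: "smooth_atlas A" "riemannian_metric A gA"
    and C: "smooth_atlas C" "riemannian_metric C gC"
    and f: "smooth_fun A f" "\<And>p. f p > 0" and h: "smooth_fun A h"
    and x: "x \<in> A" and y: "y \<in> C" and p: "p \<in> fst x" and q: "q \<in> fst y"
    and base: "\<And>i j. \<lbrakk>i \<in> Basis; j \<in> Basis\<rbrakk> \<Longrightarrow>
      ricci A gA x i j p + hess A gA x h i j p =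
      lam * metric_comp A gA x i j p + real DIM('d) / f p * hess A gA x f i j p"
    and grad: "lam * (f p)\<^sup>2 + f p * laplacian A gA x f p
       + (real DIM('d) - 1) * gA p (grad A gA x f p) (grad A gA x f p)
       - f p * gA p (grad A gA x h p) (grad A gA x f p) = \<mu>"
    and fibre: "\<And>a b. \<lbrakk>a \<in> Basis; b \<in> Basis\<rbrakk> \<Longrightarrow> ricci C gC y a b q = \<mu> * metric_comp C gC y a b q"
    and IJ: "I \<in> Basis" "J \<in> Basis"
  shows "ricci (prod_atlas A C) (warped_metric A gA f C gC) (prod_chart x y) I J (p, q)
      + hess (prod_atlas A C) (warped_metric A gA f C gC) (prod_chart x y) (h \<circ> fst) I J (p, q) =
      lam * metric_comp (prod_atlas A C) (warped_metric A gA f C gC) (prod_chart x y) I J (p, q)"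
proof -
  let ?c = "prod_chart x y"
  let ?P = "prod_atlas A C"
  let ?g = "warped_metric A gA f C gC"
  interpret warped_coords "snd x ` fst x" "local_metric A gA x" "snd y ` fst y" "local_metric C gC y"
    "f \<circ> chart_inv x" "local_metric ?P ?g ?c"
    by (rule warped_coords_local_metric[OF A x C y f])
  define z w where "z = snd x p" and "w = snd y q"
  have z: "z \<in> snd x ` fst x" and w: "w \<in> snd y ` fst y" using p q by (auto simp: z_def w_def)
  have inv: "chart_inv x z = p" "chart_inv y w = q"
    unfolding z_def w_def using chart_inv_chart[OF A(1) x p] chart_inv_chart[OF C(1) y q] by auto
  have G: "metric_comp ?P ?g ?c I J (p, q) = local_metric ?P ?g ?c I J (z, w)" for I J
    using prod_chart_inv[OF A(1) x C(1) y z w] by (simp add: inv)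
  have ric: "ricci ?P ?g ?c I J (p, q) = coord_ricci (local_metric ?P ?g ?c) I J (z, w)" for I J
    by (simp add: ricci_def z_def w_def)
  have hs: "smooth_on (snd x ` fst x) (h \<circ> chart_inv x)"
    using h x by (simp add: smooth_fun_def)
  have hess: "hess ?P ?g ?c (h \<circ> fst) I J (p, q) =
      coord_hess (local_metric ?P ?g ?c) (\<lambda>v. (h \<circ> chart_inv x) (fst v)) I J (z, w)" for I J
  proof -
    have eq: "((h \<circ> fst) \<circ> chart_inv ?c) v = (h \<circ> chart_inv x) (fst v)"
      if "v \<in> snd x ` fst x \<times> snd y ` fst y" for v
      using that prod_chart_inv[OF A(1) x C(1) y, of "fst v" "snd v"] by (simp add: mem_Times_iff)
    have pd1: "pd u ((h \<circ> fst) \<circ> chart_inv ?c) v = pd u (\<lambda>v. (h \<circ> chart_inv x) (fst v)) v"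
      if "v \<in> snd x ` fst x \<times> snd y ` fst y" for u v
      by (rule pd_cong[OF open_Times_domain that eq])
    have zw: "(z, w) \<in> snd x ` fst x \<times> snd y ` fst y" using z w by simp
    have "snd ?c (p, q) = (z, w)" by (simp add: z_def w_def)
    \<comment> \<open>The two coordinate expressions of the lift agree on the chart image only.
      Their second derivatives agree because \<open>pd1\<close> holds on this whole open set and may
      be differentiated again.\<close>
    then show ?thesis
      unfolding hess_def coord_hess_def
      by (simp only: pd1[OF zw] pd_cong[OF open_Times_domain zw pd1])
  qed
  have rA: "ricci A gA x i j p = coord_ricci (local_metric A gA x) i j z"
      "hess A gA x k i j p = coord_hess (local_metric A gA x) (k \<circ> chart_inv x) i j z"
      "metric_comp A gA x i j p = local_metric A gA x i j z"
      "laplacian A gA x f p = coord_laplacian (local_metric A gA x) (f \<circ> chart_inv x) z" for i j k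
    by (simp_all add: ricci_def hess_def laplacian_def z_def[symmetric] inv)
  have rC: "ricci C gC y a b q = coord_ricci (local_metric C gC y) a b w"
      "metric_comp C gC y a b q = local_metric C gC y a b w" for a b
    by (simp_all add: ricci_def w_def[symmetric] inv)
  have fp: "f p = (f \<circ> chart_inv x) z" by (simp add: inv)
  note mg = metric_grad[OF A x p, folded z_def]
  note base' = base[unfolded rA fp]
  note grad' = grad[unfolded rA fp mg]
  note fibre' = fibre[unfolded rC]
  have "coord_ricci (local_metric ?P ?g ?c) I J (z, w)
      + coord_hess (local_metric ?P ?g ?c) (\<lambda>v. (h \<circ> chart_inv x) (fst v)) I J (z, w)
      = lam * local_metric ?P ?g ?c I J (z, w)"
    using IJ(1)
  proof (cases I rule: Basis_Times_cases)
    case I: (fst i)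
    show ?thesis using IJ(2)
    proof (cases J rule: Basis_Times_cases)
      case J: (fst j)
      show ?thesis
        unfolding I J using base'[OF I(2) J(2)]
        by (simp only: coord_ricci_G_base[OF z w I(2) J(2)] coord_hess_G(1)[OF hs z w I(2) J(2)] G_BB[OF z w I(2) J(2)])
    next
      case J: (snd b)
      show ?thesis
        unfolding I J
        by (simp only: coord_ricci_G_mixed(1)[OF z w I(2) J(2)] coord_hess_G(2)[OF hs z w I(2) J(2)] G_BF[OF z w I(2) J(2)] mult_zero_right add_0_right)
    qed
  next
    case I: (snd a)
    show ?thesis using IJ(2)
    proof (cases J rule: Basis_Times_cases)
      case J: (fst j)
      show ?thesis
        unfolding I J
        by (simp only: coord_ricci_G_mixed(2)[OF z w J(2) I(2)] coord_hess_G(3)[OF hs z w I(2) J(2)] G_FB[OF z w I(2) J(2)] mult_zero_right add_0_right)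
    next
      case J: (snd b)
      \<comment> \<open>Replacing \<open>\<mu>\<close> by the expression it equals cancels
        everything except \<open>lam * f^2\<close> times the fibre metric.\<close>
      show ?thesis
        unfolding I J coord_ricci_G_fibre[OF z w I(2) J(2)] coord_hess_G(4)[OF hs z w I(2) J(2)] G_FF[OF z w I(2) J(2)]
          fibre'[OF I(2) J(2)] grad'[symmetric]
        by (simp add: algebra_simps del: o_apply)
    qed
  qed
  then show ?thesis unfolding ric hess G .
qed

section \<open>Curves and the Riemannian distance\<close>

text \<open>\<open>velocity\<close> may be meaningless at break points and end points, so speeds can
  be compared only off a finite set.\<close>

lemma integral_le_except_finite:
  fixes h k :: "real \<Rightarrow> real"
  assumes "finite N" "h integrable_on {a..b}" "k integrable_on {a..b}"
    and "\<And>t. t \<in> {a..b} - N \<Longrightarrow> h t \<le> k t"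
  shows "integral {a..b} h \<le> integral {a..b} k"
proof -
  define h' where "h' t = (if t \<in> N then k t else h t)" for t
  have "integral {a..b} h = integral {a..b} h'"
    by (rule integral_spike[OF negligible_finite[OF assms(1)]]) (simp add: h'_def)
  also have "\<dots> \<le> integral {a..b} k"
    using assms by (intro integral_le integrable_spike_finite[OF assms(1) _ assms(2), of h']) (auto simp: h'_def)
  finally show ?thesis .
qed

section \<open>Velocity, speed and length of curves\<close>

definition speed ::
    "('p::topological_space, 'a::euclidean_space) chart set \<Rightarrow> 'p metric \<Rightarrow> (real \<Rightarrow> 'p) \<Rightarrow> real \<Rightarrow> real" where
  "speed A g \<gamma> t = sqrt (g (\<gamma> t) (velocity A \<gamma> t) (velocity A \<gamma> t))"

lemma curve_length_speed: "curve_length A g \<gamma> a b = integral {a..b} (speed A g \<gamma>)"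
  by (simp add: curve_length_def speed_def[abs_def])

lemma velocity_cong:
  assumes "open T" "t \<in> T" "\<And>s. s \<in> T \<Longrightarrow> \<gamma> s = \<delta> s"
  shows "velocity A \<gamma> t = velocity A \<delta> t"
proof -
  have "vector_derivative (h \<circ> \<gamma>) (at t) = vector_derivative (h \<circ> \<delta>) (at t)" for h :: "'a \<Rightarrow> real"
    using assms by (intro vector_derivative_cong_eq) (auto simp: eventually_nhds intro!: exI[of _ T])
  then show ?thesis using assms by (auto simp: velocity_def fun_eq_iff)
qed

lemma speed_cong:
  assumes "open T" "t \<in> T" "\<And>s. s \<in> T \<Longrightarrow> \<gamma> s = \<delta> s"
  shows "speed A g \<gamma> t = speed A g \<delta> t"
proof -
  have "velocity A \<gamma> t = velocity A \<delta> t"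
    by (rule velocity_cong[OF assms(1,2)]) (rule assms(3))
  then show ?thesis using assms by (simp add: speed_def)
qed

text \<open>The chain rule through a chart. Continuity keeps the curve in the chart domain near
  \<open>t\<close>, where \<open>h \<circ> \<gamma>\<close> factors through the coordinates.\<close>

lemma velocity_chart:
  assumes A: "smooth_atlas A" and c: "c \<in> A" and t: "\<gamma> t \<in> fst c" "isCont \<gamma> t"
    and d: "((snd c \<circ> \<gamma>) has_vector_derivative d) (at t)"
  shows "velocity A \<gamma> t = coord_vec A c (\<gamma> t) d"
proof
  fix h
  have "vector_derivative (h \<circ> \<gamma>) (at t) = pd d (h \<circ> chart_inv c) (snd c (\<gamma> t))"
    if h: "smooth_at A h (\<gamma> t)"
  proof -
    obtain T where T: "open T" "t \<in> T" "\<forall>s\<in>T. \<gamma> s \<in> fst c"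
      using t chart_domain_open[OF A c] unfolding continuous_at_open by blast
    let ?h = "h \<circ> chart_inv c"
    have "(?h has_derivative (\<lambda>v. pd v ?h (snd c (\<gamma> t)))) (at ((snd c \<circ> \<gamma>) t))"
      using pd_has_derivative[OF smooth_at_differentiable[OF A h c t(1)]] by simp
    from diff_chain_at[OF d[unfolded has_vector_derivative_def] this]
    have "((?h \<circ> (snd c \<circ> \<gamma>)) has_vector_derivative pd d ?h (snd c (\<gamma> t))) (at t)"
      using linear_cmul[OF pd_linear[OF smooth_at_differentiable[OF A h c t(1)]]]
      unfolding has_vector_derivative_def by (simp add: o_def)
    then have "((h \<circ> \<gamma>) has_vector_derivative pd d ?h (snd c (\<gamma> t))) (at t)"
      using has_vector_derivative_transform_within_open[OF _ T(1,2)] T(3) chart_inv_chart[OF A c] by force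
    then show ?thesis by (rule vector_derivative_at)
  qed
  then show "velocity A \<gamma> t h = coord_vec A c (\<gamma> t) d h"
    by (simp add: velocity_def coord_vec_def)
qed

lemma C1_curve_cong:
  assumes "\<And>t. t \<in> {a..b} \<Longrightarrow> \<gamma> t = \<delta> t" "C1_curve A \<gamma> a b"
  shows "C1_curve A \<delta> a b"
  unfolding C1_curve_def
proof (intro conjI ballI)
  show "continuous_on {a..b} \<delta>"
    using assms continuous_on_cong[of "{a..b}" "{a..b}" \<gamma> \<delta>] by (simp add: C1_curve_def)
  fix c assume "c \<in> A"
  then obtain D where D: "continuous_on {t\<in>{a..b}. \<gamma> t \<in> fst c} D"
    "\<And>t. t \<in> {a..b} \<Longrightarrow> \<gamma> t \<in> fst c \<Longrightarrow> ((snd c \<circ> \<gamma>) has_vector_derivative D t) (at t within {a..b})"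
    using assms(2) unfolding C1_curve_def by blast
  have "{t\<in>{a..b}. \<gamma> t \<in> fst c} = {t\<in>{a..b}. \<delta> t \<in> fst c}" using assms(1) by auto
  moreover have "((snd c \<circ> \<delta>) has_vector_derivative D t) (at t within {a..b})"
    if "t \<in> {a..b}" "\<delta> t \<in> fst c" for t
    using assms(1) D(2) that
    by (intro has_vector_derivative_transform[OF that(1), of "snd c \<circ> \<delta>" "snd c \<circ> \<gamma>"]) auto
  ultimately show "\<exists>D. continuous_on {t \<in> {a..b}. \<delta> t \<in> fst c} D \<and>
      (\<forall>t\<in>{a..b}. \<delta> t \<in> fst c \<longrightarrow> ((snd c \<circ> \<delta>) has_vector_derivative D t) (at t within {a..b}))"
    using D(1) by (intro exI[of _ D]) auto
qed

lemma C1_curve_subinterval: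
  assumes "C1_curve A \<gamma> a b" "a \<le> s" "t \<le> b"
  shows "C1_curve A \<gamma> s t"
  unfolding C1_curve_def
proof (intro conjI ballI)
  have sub: "{s..t} \<subseteq> {a..b}" using assms by auto
  show "continuous_on {s..t} \<gamma>"
    using assms(1) sub continuous_on_subset unfolding C1_curve_def by blast
  fix c assume "c \<in> A"
  then obtain D where D: "continuous_on {t\<in>{a..b}. \<gamma> t \<in> fst c} D"
    "\<And>t. t \<in> {a..b} \<Longrightarrow> \<gamma> t \<in> fst c \<Longrightarrow> ((snd c \<circ> \<gamma>) has_vector_derivative D t) (at t within {a..b})"
    using assms(1) unfolding C1_curve_def by blast
  show "\<exists>D. continuous_on {u \<in> {s..t}. \<gamma> u \<in> fst c} D \<and>
      (\<forall>u\<in>{s..t}. \<gamma> u \<in> fst c \<longrightarrow> ((snd c \<circ> \<gamma>) has_vector_derivative D u) (at u within {s..t}))"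
    using sub has_vector_derivative_within_subset[OF D(2) sub]
    by (intro exI[of _ D] conjI continuous_on_subset[OF D(1)]) auto
qed

lemma piecewise_C1_subinterval:
  assumes "piecewise_C1_curve A \<gamma> a b" "a \<le> s" "t \<le> b"
  shows "piecewise_C1_curve A \<gamma> s t"
proof -
  have "continuous_on {s..t} \<gamma>"
    using assms continuous_on_subset[of "{a..b}" \<gamma> "{s..t}"] unfolding piecewise_C1_curve_def by auto
  moreover obtain S where "finite S"
    "\<And>s t. a \<le> s \<and> s < t \<and> t \<le> b \<and> {s<..<t} \<inter> S = {} \<Longrightarrow> C1_curve A \<gamma> s t"
    using assms unfolding piecewise_C1_curve_def by blast
  ultimately show ?thesis
    unfolding piecewise_C1_curve_def using assms by (intro conjI exI[of _ S]) auto
qed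

lemma C1_imp_piecewise_C1: "C1_curve A \<gamma> a b \<Longrightarrow> piecewise_C1_curve A \<gamma> a b"
  using C1_curve_subinterval[of A \<gamma> a b] unfolding piecewise_C1_curve_def
  by (intro conjI exI[of _ "{}"]) (simp add: C1_curve_def, simp, blast)

text \<open>The exceptional set serves all charts at once, so derivatives are written with
  \<open>vector_derivative\<close> instead of the witnesses in \<open>C1_curve\<close>, which depend
  on the chart and the subinterval. It includes \<open>a\<close> and \<open>b\<close>, where only
  one-sided derivatives are given.\<close>

lemma piecewise_C1_regular:
  assumes "piecewise_C1_curve A \<gamma> a b"
  obtains N where "finite N"
    "\<And>t. t \<in> {a..b} - N \<Longrightarrow> isCont \<gamma> t"
    "\<And>t c. t \<in> {a..b} - N \<Longrightarrow> c \<in> A \<Longrightarrow> \<gamma> t \<in> fst c \<Longrightarrow>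
      ((snd c \<circ> \<gamma>) has_vector_derivative vector_derivative (snd c \<circ> \<gamma>) (at t)) (at t)"
proof -
  obtain S where S: "finite S"
    "\<And>s t. a \<le> s \<and> s < t \<and> t \<le> b \<and> {s<..<t} \<inter> S = {} \<Longrightarrow> C1_curve A \<gamma> s t"
    using assms unfolding piecewise_C1_curve_def by blast
  have cont: "continuous_on {a..b} \<gamma>" using assms by (simp add: piecewise_C1_curve_def)
  show thesis
  proof (rule that[of "S \<union> {a, b}"])
    show "finite (S \<union> {a, b})" using S(1) by simp
    show "isCont \<gamma> t" if "t \<in> {a..b} - (S \<union> {a, b})" for t
      using that cont continuous_on_interior[of "{a..b}" \<gamma> t] by auto
    show "((snd c \<circ> \<gamma>) has_vector_derivative vector_derivative (snd c \<circ> \<gamma>) (at t)) (at t)"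
      if t: "t \<in> {a..b} - (S \<union> {a, b})" and c: "c \<in> A" "\<gamma> t \<in> fst c" for t c
    proof -
      have "open ({a<..<b} - S)" using S(1) by (simp add: finite_imp_closed open_Diff)
      moreover have "t \<in> {a<..<b} - S" using t by auto
      ultimately obtain e where e: "e > 0" "cball t e \<subseteq> {a<..<b} - S"
        using open_contains_cball by blast
      have sub: "{t - e..t + e} \<subseteq> {a<..<b} - S" using e by (simp add: cball_eq_atLeastAtMost)
      moreover have "{t - e<..<t + e} \<subseteq> {t - e..t + e}" by auto
      ultimately have "{t - e<..<t + e} \<inter> S = {}" by blast
      moreover have "t - e \<in> {a<..<b}" "t + e \<in> {a<..<b}" using sub e(1) by (auto simp: subset_iff simp del: greaterThanLessThan_iff)
      then have "a \<le> t - e" "t + e \<le> b" by auto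
      ultimately have "C1_curve A \<gamma> (t - e) (t + e)" using S(2)[of "t - e" "t + e"] e(1) by auto
      then obtain D where "\<forall>s\<in>{t - e..t + e}. \<gamma> s \<in> fst c \<longrightarrow>
          ((snd c \<circ> \<gamma>) has_vector_derivative D s) (at s within {t - e..t + e})"
        using c(1) unfolding C1_curve_def by blast
      then have "((snd c \<circ> \<gamma>) has_vector_derivative D t) (at t within {t - e..t + e})"
        using c(2) e(1) by auto
      moreover have "at t within {t - e..t + e} = at t" using e(1) by (intro at_within_interior) auto
      ultimately show ?thesis using vector_derivative_at by fastforce
    qed
  qed
qed

lemma continuous_chart_metric:
  assumes A: "smooth_atlas A" and g: "riemannian_metric A g" and c: "c \<in> A" and "i \<in> Basis" "j \<in> Basis"
  shows "continuous_on (fst c) (metric_comp A g c i j)"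
proof -
  interpret coord_metric_on "snd c ` fst c" "local_metric A g c"
    by (rule local_metric_coord_metric_on[OF A g c])
  have "continuous_on (fst c) (\<lambda>p. local_metric A g c i j (snd c p))"
    using smooth_on_continuous[OF smooth[OF assms(4,5)]] chart_continuous[OF A c]
    by (rule continuous_on_compose2) auto
  then show ?thesis
    by (rule continuous_on_eq) (simp add: chart_inv_chart[OF A c])
qed

lemma speed_chart:
  assumes A: "smooth_atlas A" and g: "riemannian_metric A g" and c: "c \<in> A" and t: "\<gamma> t \<in> fst c" "isCont \<gamma> t"
    and d: "((snd c \<circ> \<gamma>) has_vector_derivative d) (at t)"
  shows "speed A g \<gamma> t = sqrt (\<Sum>i\<in>Basis. \<Sum>j\<in>Basis. metric_comp A g c i j (\<gamma> t) * (d \<bullet> i) * (d \<bullet> j))"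
  unfolding speed_def velocity_chart[OF A c t d] metric_coord_vec[OF A g c t(1)] ..

text \<open>Inside the interval the speed equals the continuous function \<open>E\<close>; the end
  points are negligible.\<close>

lemma speed_integrable_C1_chart:
  assumes A: "smooth_atlas A" and g: "riemannian_metric A g" and c: "c \<in> A"
    and \<gamma>: "C1_curve A \<gamma> a b" and sub: "\<gamma> ` {a..b} \<subseteq> fst c"
  shows "speed A g \<gamma> integrable_on {a..b}"
proof -
  obtain D where D: "continuous_on {t\<in>{a..b}. \<gamma> t \<in> fst c} D"
    "\<And>t. t \<in> {a..b} \<Longrightarrow> \<gamma> t \<in> fst c \<Longrightarrow> ((snd c \<circ> \<gamma>) has_vector_derivative D t) (at t within {a..b})"
    using \<gamma> c unfolding C1_curve_def by blast
  have "{t\<in>{a..b}. \<gamma> t \<in> fst c} = {a..b}" using sub by auto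
  with D(1) have contD: "continuous_on {a..b} D" by simp
  have cont: "continuous_on {a..b} \<gamma>" using \<gamma> by (simp add: C1_curve_def)
  define E where "E t = sqrt (\<Sum>i\<in>Basis. \<Sum>j\<in>Basis. metric_comp A g c i j (\<gamma> t) * (D t \<bullet> i) * (D t \<bullet> j))" for t
  have "continuous_on {a..b} E"
    unfolding E_def
    by (intro continuous_intros contD continuous_on_compose2[OF continuous_chart_metric[OF A g c] cont] sub)
  then have "E integrable_on {a..b}" by (rule integrable_continuous_interval)
  moreover have "speed A g \<gamma> t = E t" if "t \<in> {a<..<b}" for t
  proof -
    have "at t within {a..b} = at t" using that by (intro at_within_interior) auto
    moreover have \<gamma>t: "\<gamma> t \<in> fst c" using that sub by (auto simp: image_subset_iff)
    ultimately have d: "((snd c \<circ> \<gamma>) has_vector_derivative D t) (at t)" using D(2)[of t] that by auto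
    have "isCont \<gamma> t" using that cont continuous_on_interior[of "{a..b}" \<gamma> t] by auto
    then show ?thesis unfolding E_def by (intro speed_chart[OF A g c \<gamma>t _ d])
  qed
  ultimately show ?thesis
    using integrable_spike_interior[of a b "speed A g \<gamma>" E] by simp
qed

text \<open>No single chart need contain the curve, and break points interrupt its smoothness. Near
  each \<open>t\<close> one chart suffices and no break point other than \<open>t\<close> occurs;
  compactness of the interval does the rest.\<close>

lemma speed_integrable:
  assumes A: "smooth_atlas A" and g: "riemannian_metric A g" and \<gamma>: "piecewise_C1_curve A \<gamma> a b"
  shows "speed A g \<gamma> integrable_on {a..b}"
proof -
  obtain S where S: "finite S"
    "\<And>s t. a \<le> s \<and> s < t \<and> t \<le> b \<and> {s<..<t} \<inter> S = {} \<Longrightarrow> C1_curve A \<gamma> s t"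
    using \<gamma> unfolding piecewise_C1_curve_def by blast
  have cont: "continuous_on {a..b} \<gamma>" using \<gamma> by (simp add: piecewise_C1_curve_def)
  have "\<exists>d>0. \<forall>u v. t \<in> {u..v} \<and> {u..v} \<subseteq> ball t d \<and> {u..v} \<subseteq> {a..b} \<longrightarrow> speed A g \<gamma> integrable_on {u..v}"
    if t: "t \<in> {a..b}" for t
  proof -
    obtain c where c: "c \<in> A" "\<gamma> t \<in> fst c" using chart_cover[OF A] by blast
    have "openin (top_of_set {a..b}) ({a..b} \<inter> \<gamma> -` fst c)"
      using continuous_openin_preimage_gen[OF cont chart_domain_open[OF A c(1)]] .
    moreover have "t \<in> {a..b} \<inter> \<gamma> -` fst c" using t c by simp
    ultimately obtain d1 where d1: "d1 > 0" "ball t d1 \<inter> {a..b} \<subseteq> {a..b} \<inter> \<gamma> -` fst c"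
      unfolding openin_contains_ball by blast
    \<comment> \<open>\<open>t\<close> may itself be a break point, so it is exempted here and small
      intervals are cut at \<open>t\<close>.\<close>
    have "open (- (S - {t}))" by (intro open_Compl finite_imp_closed finite_Diff S(1))
    moreover have "t \<in> - (S - {t})" by simp
    ultimately obtain d2 where d2: "d2 > 0" "ball t d2 \<subseteq> - (S - {t})"
      using open_contains_ball by blast
    have "speed A g \<gamma> integrable_on {u..v}"
      if uv: "t \<in> {u..v}" "{u..v} \<subseteq> ball t (min d1 d2)" "{u..v} \<subseteq> {a..b}" for u v
    proof -
      have piece: "speed A g \<gamma> integrable_on {r..s}"
        if rs: "{r..s} \<subseteq> {u..v}" "t \<notin> {r<..<s}" "r \<le> s" for r s
      proof (cases "r < s")
        case True
        have "q \<notin> S" if q: "q \<in> {r<..<s}" for q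
        proof -
          have "q \<in> {r..s}" using q by auto
          then have "q \<in> ball t (min d1 d2)" using rs(1) uv(2) by blast
          then have "q \<in> ball t d2" by auto
          then show ?thesis using d2(2) q rs(2) by blast
        qed
        then have "{r<..<s} \<inter> S = {}" by blast
        moreover have "r \<in> {a..b}" "s \<in> {a..b}" using rs(1) uv(3) True by (auto simp: subset_iff)
        then have "a \<le> r" "s \<le> b" by auto
        ultimately have "C1_curve A \<gamma> r s" using S(2) True by blast
        moreover have "\<gamma> ` {r..s} \<subseteq> fst c"
        proof
          fix p assume "p \<in> \<gamma> ` {r..s}"
          then obtain q where q: "q \<in> {r..s}" "p = \<gamma> q" by blast
          then have "q \<in> {u..v}" using rs(1) by blast
          then have "q \<in> ball t d1 \<inter> {a..b}" using uv(2,3) by auto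
          then show "p \<in> fst c" using d1(2) q(2) by blast
        qed
        ultimately show ?thesis by (rule speed_integrable_C1_chart[OF A g c(1)])
      next
        case False
        then show ?thesis using rs(3) integrable_on_refl[of "speed A g \<gamma>" r] by simp
      qed
      have "speed A g \<gamma> integrable_on {u..t}" "speed A g \<gamma> integrable_on {t..v}"
        using uv(1) by (auto intro!: piece)
      then show ?thesis
        using uv(1) by (intro Henstock_Kurzweil_Integration.integrable_combine[of u t v]) auto
    qed
    then show ?thesis using d1(1) d2(1) by (intro exI[of _ "min d1 d2"]) auto
  qed
  then show ?thesis
    using integrable_on_little_subintervals[of a b "speed A g \<gamma>"] by simp
qed

text \<open>A metric is constrained only on tangent spaces, so the squared speed is known to be
  nonnegative only where the velocity is a tangent vector.\<close>

lemma velocity_in_tangent_space: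
  assumes A: "smooth_atlas A" and \<gamma>: "piecewise_C1_curve A \<gamma> a b"
  obtains N where "finite N" "\<And>t. t \<in> {a..b} - N \<Longrightarrow> velocity A \<gamma> t \<in> tangent_space A (\<gamma> t)"
proof -
  obtain N where N: "finite N" "\<And>t. t \<in> {a..b} - N \<Longrightarrow> isCont \<gamma> t"
    "\<And>t c. t \<in> {a..b} - N \<Longrightarrow> c \<in> A \<Longrightarrow> \<gamma> t \<in> fst c \<Longrightarrow>
      ((snd c \<circ> \<gamma>) has_vector_derivative vector_derivative (snd c \<circ> \<gamma>) (at t)) (at t)"
    using piecewise_C1_regular[OF \<gamma>] by blast
  have "velocity A \<gamma> t \<in> tangent_space A (\<gamma> t)" if t: "t \<in> {a..b} - N" for t
  proof -
    obtain c where c: "c \<in> A" "\<gamma> t \<in> fst c" using chart_cover[OF A] by blast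
    show ?thesis
      unfolding velocity_chart[OF A c N(2)[OF t] N(3)[OF t c]]
      by (rule coord_vec_in_tangent_space[OF c])
  qed
  with N(1) show thesis by (rule that)
qed

lemma curve_length_nonneg:
  assumes A: "smooth_atlas A" and g: "riemannian_metric A g" and \<gamma>: "piecewise_C1_curve A \<gamma> a b"
  shows "curve_length A g \<gamma> a b \<ge> 0"
proof -
  obtain N where N: "finite N" "\<And>t. t \<in> {a..b} - N \<Longrightarrow> velocity A \<gamma> t \<in> tangent_space A (\<gamma> t)"
    using velocity_in_tangent_space[OF A \<gamma>] by blast
  have "integral {a..b} (\<lambda>_. 0) \<le> integral {a..b} (speed A g \<gamma>)"
    using N(2) riemannian_metric_nonneg[OF g]
    by (intro integral_le_except_finite[OF N(1) _ speed_integrable[OF A g \<gamma>]]) (auto simp: speed_def)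
  then show ?thesis by (simp add: curve_length_speed)
qed

lemma curve_length_split:
  assumes A: "smooth_atlas A" and g: "riemannian_metric A g" and \<gamma>: "piecewise_C1_curve A \<gamma> a b"
    and "a \<le> s" "s \<le> b"
  shows "curve_length A g \<gamma> a b = curve_length A g \<gamma> a s + curve_length A g \<gamma> s b"
  using Henstock_Kurzweil_Integration.integral_combine[OF assms(4,5) speed_integrable[OF A g \<gamma>]]
  by (simp add: curve_length_speed)

section \<open>Translating and concatenating curves\<close>

lemma has_vector_derivative_translate:
  assumes "(h has_vector_derivative D) (at (t + k) within {a..b})"
  shows "((\<lambda>s. h (s + k)) has_vector_derivative D) (at t within {a - k..b - k})"
proof -
  have "((\<lambda>s. s + k) has_vector_derivative 1) (at t within {a - k..b - k})"
    using has_vector_derivative_add_const[of "\<lambda>s. s" k 1] has_vector_derivative_id[of "at t within {a - k..b - k}"]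
    by (simp add: id_def)
  moreover have "(\<lambda>s. s + k) ` {a - k..b - k} = {a..b}" by simp
  ultimately show ?thesis
    using vector_diff_chain_within[of "\<lambda>s. s + k" 1 t "{a - k..b - k}" h D] assms by (simp add: o_def)
qed

lemma continuous_on_translate_Icc:
  fixes \<gamma> :: "real \<Rightarrow> 'p::topological_space"
  assumes "continuous_on {a..b} \<gamma>"
  shows "continuous_on {a - k..b - k} (\<lambda>t. \<gamma> (t + k))"
proof (rule continuous_on_compose2[OF assms])
  show "continuous_on {a - k..b - k} (\<lambda>t. t + k)"
    by (intro continuous_on_add continuous_on_id continuous_on_const)
qed auto

lemma C1_curve_translate:
  assumes "C1_curve A \<gamma> a b"
  shows "C1_curve A (\<lambda>t. \<gamma> (t + k)) (a - k) (b - k)"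
  unfolding C1_curve_def
proof (intro conjI ballI)
  show "continuous_on {a - k..b - k} (\<lambda>t. \<gamma> (t + k))"
    using assms continuous_on_translate_Icc unfolding C1_curve_def by blast
  fix c assume "c \<in> A"
  then obtain D where D: "continuous_on {t\<in>{a..b}. \<gamma> t \<in> fst c} D"
    "\<And>t. t \<in> {a..b} \<Longrightarrow> \<gamma> t \<in> fst c \<Longrightarrow> ((snd c \<circ> \<gamma>) has_vector_derivative D t) (at t within {a..b})"
    using assms(1) unfolding C1_curve_def by blast
  show "\<exists>D. continuous_on {t \<in> {a - k..b - k}. \<gamma> (t + k) \<in> fst c} D \<and>
      (\<forall>t\<in>{a - k..b - k}. \<gamma> (t + k) \<in> fst c \<longrightarrow>
        ((snd c \<circ> (\<lambda>t. \<gamma> (t + k))) has_vector_derivative D t) (at t within {a - k..b - k}))"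
  proof (intro exI[of _ "\<lambda>t. D (t + k)"] conjI ballI impI)
    show "continuous_on {t \<in> {a - k..b - k}. \<gamma> (t + k) \<in> fst c} (\<lambda>t. D (t + k))"
      by (intro continuous_on_compose2[OF D(1)]) (auto intro!: continuous_intros)
    show "((snd c \<circ> (\<lambda>t. \<gamma> (t + k))) has_vector_derivative D (t + k)) (at t within {a - k..b - k})"
      if "t \<in> {a - k..b - k}" "\<gamma> (t + k) \<in> fst c" for t
      using has_vector_derivative_translate[OF D(2), of t k] that by (simp add: o_def)
  qed
qed

text \<open>Valid also where no derivative exists, because the derivative predicates of both
  functions are equivalent; the converse implication is the same fact for translation by
  \<open>- k\<close>.\<close>

lemma velocity_translate: "velocity A (\<lambda>t. \<gamma> (t + k)) t = velocity A \<gamma> (t + k)"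
proof -
  have *: "((\<lambda>s. h (s + k)) has_vector_derivative D) (at t)" if "(h has_vector_derivative D) (at (t + k))"
    for h :: "real \<Rightarrow> real" and D t k
    using vector_diff_chain_at[of "\<lambda>s. s + k" 1 t h D] that
      has_vector_derivative_add_const[of "\<lambda>s. s" k 1] has_vector_derivative_id[of "at t"]
    by (simp add: o_def id_def)
  have "((\<lambda>s. h (s + k)) has_vector_derivative D) (at t) \<longleftrightarrow> (h has_vector_derivative D) (at (t + k))"
    for h :: "real \<Rightarrow> real" and D
    using *[of h D t k] *[of "\<lambda>s. h (s + k)" D "t + k" "- k"] by auto
  then have "vector_derivative (\<lambda>s. h (s + k)) (at t) = vector_derivative h (at (t + k))" for h :: "real \<Rightarrow> real"
    by (simp add: vector_derivative_def)
  from this[of "h \<circ> \<gamma>" for h] show ?thesis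
    by (auto simp: velocity_def o_def fun_eq_iff)
qed

lemma piecewise_C1_translate:
  assumes "piecewise_C1_curve A \<gamma> a b"
  shows "piecewise_C1_curve A (\<lambda>t. \<gamma> (t + k)) (a - k) (b - k)"
    and "curve_length A g (\<lambda>t. \<gamma> (t + k)) (a - k) (b - k) = curve_length A g \<gamma> a b"
proof -
  obtain S where S: "finite S"
    "\<And>s t. a \<le> s \<and> s < t \<and> t \<le> b \<and> {s<..<t} \<inter> S = {} \<Longrightarrow> C1_curve A \<gamma> s t"
    using assms unfolding piecewise_C1_curve_def by blast
  have "C1_curve A (\<lambda>t. \<gamma> (t + k)) s t"
    if "a - k \<le> s" "s < t" "t \<le> b - k" "{s<..<t} \<inter> (\<lambda>t. t - k) ` S = {}" for s t
  proof -
    have "{s + k<..<t + k} \<inter> S = {}" using that(4) by force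
    then have "C1_curve A \<gamma> (s + k) (t + k)" using S(2) that by auto
    then show ?thesis using C1_curve_translate[of A \<gamma> "s + k" "t + k" k] by simp
  qed
  moreover have "continuous_on {a - k..b - k} (\<lambda>t. \<gamma> (t + k))"
    using assms continuous_on_translate_Icc unfolding piecewise_C1_curve_def by blast
  ultimately show "piecewise_C1_curve A (\<lambda>t. \<gamma> (t + k)) (a - k) (b - k)"
    unfolding piecewise_C1_curve_def using S(1) by (intro conjI exI[of _ "(\<lambda>t. t - k) ` S"]) auto
  show "curve_length A g (\<lambda>t. \<gamma> (t + k)) (a - k) (b - k) = curve_length A g \<gamma> a b"
    using integral_shift_real_ivl[of a k b "speed A g \<gamma>"]
    by (simp add: curve_length_speed speed_def[abs_def] velocity_translate)
qed

lemma piecewise_C1_join: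
  assumes A: "smooth_atlas A" and g: "riemannian_metric A g"
    and \<gamma>: "piecewise_C1_curve A \<gamma> a b" and \<delta>: "piecewise_C1_curve A \<delta> b c"
    and eq: "\<gamma> b = \<delta> b" and abc: "a < b" "b < c"
  shows "piecewise_C1_curve A (\<lambda>t. if t \<le> b then \<gamma> t else \<delta> t) a c"
    and "curve_length A g (\<lambda>t. if t \<le> b then \<gamma> t else \<delta> t) a c = curve_length A g \<gamma> a b + curve_length A g \<delta> b c"
proof -
  let ?j = "\<lambda>t. if t \<le> b then \<gamma> t else \<delta> t"
  obtain S where S: "finite S"
    "\<And>s t. a \<le> s \<and> s < t \<and> t \<le> b \<and> {s<..<t} \<inter> S = {} \<Longrightarrow> C1_curve A \<gamma> s t"
    using \<gamma> unfolding piecewise_C1_curve_def by blast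
  obtain T where T: "finite T"
    "\<And>s t. b \<le> s \<and> s < t \<and> t \<le> c \<and> {s<..<t} \<inter> T = {} \<Longrightarrow> C1_curve A \<delta> s t"
    using \<delta> unfolding piecewise_C1_curve_def by blast
  have sets: "{t \<in> {a..c}. t \<le> b} = {a..b}" "{t \<in> {a..c}. b \<le> t} = {b..c}" using abc by auto
  have "continuous_on {a..c} ?j"
  proof (rule continuous_on_cases_le[of "{a..c}" "\<lambda>t. t"])
    show "continuous_on {t \<in> {a..c}. t \<le> b} \<gamma>" "continuous_on {t \<in> {a..c}. b \<le> t} \<delta>"
      unfolding sets using \<gamma> \<delta> by (simp_all add: piecewise_C1_curve_def)
  qed (use eq in auto)
  moreover have "C1_curve A ?j s t"
    if st: "a \<le> s" "s < t" "t \<le> c" "{s<..<t} \<inter> (S \<union> T \<union> {b}) = {}" for s t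
  proof (cases "t \<le> b")
    case True
    then have "C1_curve A \<gamma> s t" using S(2) st by auto
    then show ?thesis by (rule C1_curve_cong[rotated]) (use True in auto)
  next
    case False
    then have "b \<le> s" using st(4) by force
    then have "C1_curve A \<delta> s t" using T(2) st by auto
    \<comment> \<open>The interval may begin at \<open>b\<close>, where the joined curve takes its
      value from \<open>\<gamma>\<close>; there \<open>\<gamma> b = \<delta> b\<close> is
      needed.\<close>
    moreover have "\<delta> u = ?j u" if "u \<in> {s..t}" for u
      using that \<open>b \<le> s\<close> eq by (cases "u = b") auto
    ultimately show ?thesis using C1_curve_cong[of s t \<delta> ?j] by blast
  qed
  ultimately show j: "piecewise_C1_curve A ?j a c"
    unfolding piecewise_C1_curve_def using S(1) T(1) by (intro conjI exI[of _ "S \<union> T \<union> {b}"]) auto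
  \<comment> \<open>Speeds are compared only away from \<open>b\<close>, where the joined curve may
    have a corner; a single point does not affect the length.\<close>
  have "speed A g ?j t = speed A g \<gamma> t" if "t < b" for t
    by (rule speed_cong[of "{..<b}"]) (use that in auto)
  then have "curve_length A g ?j a b = curve_length A g \<gamma> a b"
    unfolding curve_length_speed by (intro integral_spike[of "{b}"]) auto
  moreover have "speed A g ?j t = speed A g \<delta> t" if "t > b" for t
    by (rule speed_cong[of "{b<..}"]) (use that in auto)
  then have "curve_length A g ?j b c = curve_length A g \<delta> b c"
    unfolding curve_length_speed by (intro integral_spike[of "{b}"]) auto
  ultimately show "curve_length A g ?j a c = curve_length A g \<gamma> a b + curve_length A g \<delta> b c"
    using curve_length_split[OF A g j, of b] abc by simp
qed

definition joins ::
    "('p::topological_space, 'a::euclidean_space) chart set \<Rightarrow> (real \<Rightarrow> 'p) \<Rightarrow> real \<Rightarrow> real \<Rightarrow> 'p \<Rightarrow> 'p \<Rightarrow> bool" where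
  "joins A \<gamma> a b p q \<longleftrightarrow> a < b \<and> piecewise_C1_curve A \<gamma> a b \<and> \<gamma> a = p \<and> \<gamma> b = q"

lemma riem_dist_joins: "riem_dist A g p q = Inf {curve_length A g \<gamma> a b | \<gamma> a b. joins A \<gamma> a b p q}"
  by (simp add: riem_dist_def joins_def)

text \<open>The last conclusion records that the first curve is a part of the new one, so that a
  lower bound for \<open>f\<close> along the concatenation holds along the first curve.\<close>

lemma joins_concat:
  assumes A: "smooth_atlas A" and g: "riemannian_metric A g"
    and \<gamma>: "joins A \<gamma> a b p q" and \<delta>: "joins A \<delta> c d q r"
  obtains \<epsilon> s u where "joins A \<epsilon> s u p r"
    "curve_length A g \<epsilon> s u = curve_length A g \<gamma> a b + curve_length A g \<delta> c d"
    "\<And>v. v \<in> {a..b} \<Longrightarrow> \<exists>w\<in>{s..u}. \<epsilon> w = \<gamma> v"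
proof -
  \<comment> \<open>Shifted so as to start at the parameter \<open>b\<close> at which
    \<open>\<gamma>\<close> ends.\<close>
  define \<delta>' where "\<delta>' t = \<delta> (t + (c - b))" for t
  have \<delta>': "piecewise_C1_curve A \<delta>' b (d - (c - b))"
    "curve_length A g \<delta>' b (d - (c - b)) = curve_length A g \<delta> c d"
    using piecewise_C1_translate(1)[of A \<delta> c d "c - b"] piecewise_C1_translate(2)[where \<gamma> = \<delta> and k = "c - b" and a = c and b = d and g = g and A = A] \<delta> by (auto simp: \<delta>'_def[abs_def] joins_def)
  have eq: "\<gamma> b = \<delta>' b" and lt: "a < b" "b < d - (c - b)"
    using \<gamma> \<delta> by (auto simp: \<delta>'_def joins_def)
  have \<gamma>': "piecewise_C1_curve A \<gamma> a b" using \<gamma> by (simp add: joins_def)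
  note j = piecewise_C1_join[OF A g \<gamma>' \<delta>'(1) eq lt]
  show thesis
  proof (rule that[of "\<lambda>t. if t \<le> b then \<gamma> t else \<delta>' t" a "d - (c - b)"])
    show "joins A (\<lambda>t. if t \<le> b then \<gamma> t else \<delta>' t) a (d - (c - b)) p r"
      using j(1) lt \<gamma> \<delta> by (auto simp: joins_def \<delta>'_def)
    show "\<exists>w\<in>{a..d - (c - b)}. (if w \<le> b then \<gamma> w else \<delta>' w) = \<gamma> v" if "v \<in> {a..b}" for v
      using that lt by (intro bexI[of _ v]) auto
  qed (use j lt \<delta>' \<gamma> in \<open>auto simp: joins_def\<close>)
qed

section \<open>Joining points of a connected manifold by curves\<close>

text \<open>A coordinate segment has to be C1 in every chart \<open>d\<close> of the atlas; there
  its velocity is the derivative of the transition map along \<open>v\<close>.\<close>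

lemma C1_curve_segment:
  assumes A: "smooth_atlas A" and c: "c \<in> A"
    and seg: "\<And>t. t \<in> {0..1} \<Longrightarrow> z + t *\<^sub>R v \<in> snd c ` fst c"
  shows "C1_curve A (\<lambda>t. chart_inv c (z + t *\<^sub>R v)) 0 1"
  unfolding C1_curve_def
proof (intro conjI ballI)
  show "continuous_on {0..1} (\<lambda>t. chart_inv c (z + t *\<^sub>R v))"
    by (rule continuous_on_compose2[OF chart_inv_continuous[OF A c]])
      (use seg in \<open>auto intro!: continuous_intros\<close>)
  fix d assume d: "d \<in> A"
  let ?\<gamma> = "\<lambda>t. chart_inv c (z + t *\<^sub>R v)"
  let ?T = "snd d \<circ> chart_inv c"
  let ?S = "snd c ` (fst c \<inter> fst d)"
  have T: "smooth_on ?S ?T" by (rule chart_transition[OF A c d])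
  have mem: "z + t *\<^sub>R v \<in> ?S" if t: "t \<in> {0..1}" "?\<gamma> t \<in> fst d" for t
    using chart_chart_inv[OF A c seg[OF t(1)]] chart_inv_in_domain[OF A c seg[OF t(1)]] t(2)
    by (intro image_eqI[of _ _ "?\<gamma> t"]) auto
  have pdv: "pd v ?T y = (\<Sum>i\<in>Basis. (v \<bullet> i) *\<^sub>R pd i ?T y)" if "y \<in> ?S" for y
    by (rule pd_Basis_sum[OF smooth_on_differentiable[OF T that]])
  have "continuous_on ?S (\<lambda>y. \<Sum>i\<in>Basis. (v \<bullet> i) *\<^sub>R pd i ?T y)"
    by (intro continuous_on_sum continuous_on_scaleR continuous_on_const smooth_on_continuous[OF smooth_on_pd[OF T]])
  then have "continuous_on ?S (pd v ?T)"
    by (rule continuous_on_eq) (simp only: pdv)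
  then have "continuous_on {t \<in> {0..1}. ?\<gamma> t \<in> fst d} (\<lambda>t. pd v ?T (z + t *\<^sub>R v))"
    by (rule continuous_on_compose2[where f = "\<lambda>t. z + t *\<^sub>R v"])
      (use mem in \<open>auto simp del: atLeastAtMost_iff intro!: continuous_intros\<close>)
  moreover have "((snd d \<circ> ?\<gamma>) has_vector_derivative pd v ?T (z + t *\<^sub>R v)) (at t within {0..1})"
    if t: "t \<in> {0..1}" "?\<gamma> t \<in> fst d" for t
  proof -
    have diff: "?T differentiable (at (z + t *\<^sub>R v))"
      by (rule smooth_on_differentiable[OF T mem[OF t]])
    have "((\<lambda>t. z + t *\<^sub>R v) has_derivative (\<lambda>s. s *\<^sub>R v)) (at t within {0..1})"
      by (auto intro!: derivative_eq_intros)
    from has_derivative_compose[OF this pd_has_derivative[OF diff]]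
    show ?thesis
      unfolding has_vector_derivative_def using linear_cmul[OF pd_linear[OF diff]] by (simp add: o_def)
  qed
  ultimately show "\<exists>D. continuous_on {t \<in> {0..1}. ?\<gamma> t \<in> fst d} D \<and>
      (\<forall>t\<in>{0..1}. ?\<gamma> t \<in> fst d \<longrightarrow> ((snd d \<circ> ?\<gamma>) has_vector_derivative D t) (at t within {0..1}))"
    by blast
qed

text \<open>A ball in coordinates is convex, so segments join any two of its points.\<close>

lemma locally_joined:
  assumes A: "smooth_atlas A"
  obtains W where "open W" "p \<in> W" "\<And>q r. \<lbrakk>q \<in> W; r \<in> W\<rbrakk> \<Longrightarrow> \<exists>\<gamma> a b. joins A \<gamma> a b q r"
proof -
  obtain c where c: "c \<in> A" "p \<in> fst c" using chart_cover[OF A] by blast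
  obtain e where e: "e > 0" "ball (snd c p) e \<subseteq> snd c ` fst c"
    using chart_image_open[OF A c(1)] c(2) open_contains_ball by blast
  let ?W = "chart_inv c ` ball (snd c p) e"
  show thesis
  proof (rule that[of ?W])
    show "open ?W" by (rule chart_inv_image_open[OF A c(1) open_ball e(2)])
    show "p \<in> ?W" using chart_inv_chart[OF A c] e(1) by (intro image_eqI[of _ _ "snd c p"]) auto
    fix q r assume "q \<in> ?W" "r \<in> ?W"
    then obtain y z where yz: "q = chart_inv c y" "r = chart_inv c z" "y \<in> ball (snd c p) e" "z \<in> ball (snd c p) e"
      by blast
    have "y + t *\<^sub>R (z - y) \<in> snd c ` fst c" if "t \<in> {0..1}" for t
    proof -
      have "(1 - t) *\<^sub>R y + t *\<^sub>R z \<in> ball (snd c p) e"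
        using that yz(3,4) by (intro convexD[OF convex_ball]) auto
      then show ?thesis using e(2) by (auto simp: algebra_simps)
    qed
    then have "C1_curve A (\<lambda>t. chart_inv c (y + t *\<^sub>R (z - y))) 0 1"
      by (rule C1_curve_segment[OF A c(1)])
    then have "joins A (\<lambda>t. chart_inv c (y + t *\<^sub>R (z - y))) 0 1 q r"
      using yz by (simp add: joins_def C1_imp_piecewise_C1)
    then show "\<exists>\<gamma> a b. joins A \<gamma> a b q r" by blast
  qed
qed

text \<open>Guarantees that the infimum in \<open>riem_dist\<close> is over a nonempty set. The set
  of points reachable from \<open>p\<close> is open and closed: a neighbourhood from
  \<open>locally_joined\<close> that meets it lies in it.\<close>

lemma manifold_joined:
  assumes A: "smooth_atlas A" and g: "riemannian_metric A g"
    and conn: "connected (UNIV :: 'p set)"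
  shows "\<exists>\<gamma> a b. joins (A :: ('p::{t2_space,second_countable_topology}, 'a::euclidean_space) chart set) \<gamma> a b p q"
proof -
  define R where "R = {q. \<exists>\<gamma> a b. joins A \<gamma> a b p q}"
  have tr: "q \<in> R \<Longrightarrow> joins A \<gamma> a b q r \<Longrightarrow> r \<in> R" for q r \<gamma> a b
  proof -
    assume "q \<in> R" and \<delta>: "joins A \<gamma> a b q r"
    then obtain \<gamma>' a' b' where "joins A \<gamma>' a' b' p q" unfolding R_def by blast
    then obtain \<epsilon> s u where "joins A \<epsilon> s u p r"
      using \<delta> by (rule joins_concat[OF A g])
    then show "r \<in> R" unfolding R_def by blast
  qed
  have "\<exists>W. open W \<and> q \<in> W \<and> (W \<subseteq> R \<or> W \<subseteq> - R)" for q
  proof -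
    obtain W where W: "open W" "q \<in> W" "\<And>q r. \<lbrakk>q \<in> W; r \<in> W\<rbrakk> \<Longrightarrow> \<exists>\<gamma> a b. joins A \<gamma> a b q r"
      by (rule locally_joined[OF A]) blast
    have "W \<subseteq> R" if "r \<in> W" "r \<in> R" for r
      using W(3)[OF that(1)] tr[OF that(2)] by (meson subsetI)
    then show ?thesis using W(1,2) by blast
  qed
  then obtain W where W: "\<And>q. open (W q)" "\<And>q. q \<in> W q" "\<And>q. W q \<subseteq> R \<or> W q \<subseteq> - R" by metis
  have "\<exists>T. open T \<and> q \<in> T \<and> T \<subseteq> R" if "q \<in> R" for q
    using W(1,2) W(3)[of q] that by (intro exI[of _ "W q"]) blast
  then have "open R" using open_subopen[of R] by blast
  moreover have "\<exists>T. open T \<and> q \<in> T \<and> T \<subseteq> - R" if "q \<in> - R" for q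
    using W(1,2) W(3)[of q] that by (intro exI[of _ "W q"]) blast
  then have "open (- R)" using open_subopen[of "- R"] by blast
  \<comment> \<open>\<open>locally_joined\<close> also joins \<open>p\<close> to itself, so
    \<open>R\<close> is nonempty.\<close>
  moreover have "p \<in> R"
    using locally_joined[OF A, of p] unfolding R_def by blast
  ultimately have "R = UNIV"
    using conn connected_clopen[of "UNIV :: 'p set"] by (auto simp: closed_def)
  then have "q \<in> R" by simp
  then show ?thesis by (simp add: R_def)
qed

section \<open>The Riemannian distance and the confinement of short curves\<close>

locale riemannian =
  fixes A :: "('p::{t2_space,second_countable_topology}, 'a::euclidean_space) chart set" and g :: "'p metric"
  assumes riemannian_manifold: "riemannian_manifold A g"
begin

lemma atlas: "smooth_atlas A" and conn: "connected (UNIV :: 'p set)" and metric: "riemannian_metric A g"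
  using riemannian_manifold by (auto simp: riemannian_manifold_def smooth_manifold_def)

lemma joins_length_nonneg: "joins A \<gamma> a b p q \<Longrightarrow> curve_length A g \<gamma> a b \<ge> 0"
  using curve_length_nonneg[OF atlas metric] by (simp add: joins_def)

lemma riem_dist_le: "joins A \<gamma> a b p q \<Longrightarrow> riem_dist A g p q \<le> curve_length A g \<gamma> a b"
  unfolding riem_dist_joins
  by (rule cInf_lower) (auto intro!: bdd_belowI[of _ 0] joins_length_nonneg)

lemma riem_dist_lessE:
  assumes "riem_dist A g p q < e"
  obtains \<gamma> a b where "joins A \<gamma> a b p q" "curve_length A g \<gamma> a b < e"
proof -
  have "{curve_length A g \<gamma> a b | \<gamma> a b. joins A \<gamma> a b p q} \<noteq> {}"
    using manifold_joined[OF atlas metric conn] by blast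
  from cInf_lessD[OF this assms[unfolded riem_dist_joins]] show thesis using that by blast
qed

lemma riem_dist_nonneg: "riem_dist A g p q \<ge> 0"
proof (rule ccontr)
  assume "\<not> riem_dist A g p q \<ge> 0"
  then obtain \<gamma> a b where "joins A \<gamma> a b p q" "curve_length A g \<gamma> a b < 0"
    using riem_dist_lessE[of p q 0] by auto
  then show False using joins_length_nonneg by fastforce
qed

lemma riem_dist_triangle: "riem_dist A g p r \<le> riem_dist A g p q + riem_dist A g q r"
proof (rule field_le_epsilon)
  fix e :: real assume e: "e > 0"
  obtain \<gamma> a b where \<gamma>: "joins A \<gamma> a b p q" "curve_length A g \<gamma> a b < riem_dist A g p q + e / 2"
    using riem_dist_lessE[of p q "riem_dist A g p q + e / 2"] e by auto
  obtain \<delta> c d where \<delta>: "joins A \<delta> c d q r" "curve_length A g \<delta> c d < riem_dist A g q r + e / 2"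
    using riem_dist_lessE[of q r "riem_dist A g q r + e / 2"] e by auto
  obtain \<epsilon> s u where "joins A \<epsilon> s u p r" "curve_length A g \<epsilon> s u = curve_length A g \<gamma> a b + curve_length A g \<delta> c d"
    using joins_concat[OF atlas metric \<gamma>(1) \<delta>(1)] by metis
  then show "riem_dist A g p r \<le> riem_dist A g p q + riem_dist A g q r + e"
    using riem_dist_le[of \<epsilon> s u p r] \<gamma>(2) \<delta>(2) by simp
qed

text \<open>By compactness the quadratic form has a positive minimum for points in \<open>K\<close>
  and unit vectors. Homogeneity extends the bound to all \<open>v\<close>, with \<open>k\<close> the
  square root of that minimum.\<close>

lemma chart_norm_bound:
  assumes c: "c \<in> A" and K: "compact K" "K \<subseteq> snd c ` fst c"
  obtains k where "k > 0" "\<And>p v. p \<in> fst c \<Longrightarrow> snd c p \<in> K \<Longrightarrow>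
    k * norm v \<le> sqrt (\<Sum>i\<in>Basis. \<Sum>j\<in>Basis. metric_comp A g c i j p * (v \<bullet> i) * (v \<bullet> j))"
proof (cases "K = {}")
  case True
  then show thesis using that[of 1] by auto
next
  case False
  interpret coord_metric_on "snd c ` fst c" "local_metric A g c"
    by (rule local_metric_coord_metric_on[OF atlas metric c])
  define Q where "Q x = (\<Sum>i\<in>Basis. \<Sum>j\<in>Basis. local_metric A g c i j (fst x) * (snd x \<bullet> i) * (snd x \<bullet> j))"
    for x :: "'a \<times> 'a"
  let ?S = "K \<times> sphere (0 :: 'a) 1"
  have "continuous_on ?S Q"
    unfolding Q_def
    by (intro continuous_intros continuous_on_compose2[OF smooth_on_continuous[OF smooth]])
      (use K(2) in auto)
  moreover have "compact ?S" using K(1) by (intro compact_Times compact_sphere)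
  moreover have "?S \<noteq> {}" using False by auto
  ultimately obtain x where x: "x \<in> ?S" "\<And>y. y \<in> ?S \<Longrightarrow> Q x \<le> Q y"
    using continuous_attains_inf[of ?S Q] by blast
  have Qx: "Q x > 0"
  proof -
    have "snd x \<noteq> 0" "fst x \<in> snd c ` fst c" using x(1) K(2) by auto
    then show ?thesis unfolding Q_def by (intro pos)
  qed
  show thesis
  proof (rule that[of "sqrt (Q x)"])
    show "sqrt (Q x) > 0" using Qx by simp
    fix p and v :: 'a assume p: "p \<in> fst c" "snd c p \<in> K"
    let ?q = "\<lambda>v. \<Sum>i\<in>Basis. \<Sum>j\<in>Basis. metric_comp A g c i j p * (v \<bullet> i) * (v \<bullet> j)"
    have Q: "Q (snd c p, v) = ?q v" for v
      unfolding Q_def using chart_inv_chart[OF atlas c p(1)] by simp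
    have "Q x * (norm v)\<^sup>2 \<le> ?q v"
    proof (cases "v = 0")
      case False
      then have "Q x \<le> Q (snd c p, v /\<^sub>R norm v)" using p by (intro x(2)) auto
      also have "\<dots> = ?q v / (norm v)\<^sup>2"
        unfolding Q by (simp add: sum_divide_distrib power2_eq_square field_simps)
      finally show ?thesis using False by (simp add: field_simps)
    qed simp
    then have "sqrt (Q x * (norm v)\<^sup>2) \<le> sqrt (?q v)" by simp
    then show "sqrt (Q x) * norm v \<le> sqrt (?q v)" by (simp add: real_sqrt_mult)
  qed
qed

text \<open>The coordinate displacement is the integral of the coordinate velocity, whose norm is at
  most the speed divided by \<open>k\<close>.\<close>

lemma chart_displacement_bound:
  assumes c: "c \<in> A" and k: "k > 0" "\<And>p v. p \<in> fst c \<Longrightarrow> snd c p \<in> K \<Longrightarrow>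
      k * norm v \<le> sqrt (\<Sum>i\<in>Basis. \<Sum>j\<in>Basis. metric_comp A g c i j p * (v \<bullet> i) * (v \<bullet> j))"
    and \<gamma>: "piecewise_C1_curve A \<gamma> a b" "a \<le> b"
    and K: "\<And>t. t \<in> {a..b} \<Longrightarrow> \<gamma> t \<in> fst c" "\<And>t. t \<in> {a..b} \<Longrightarrow> snd c (\<gamma> t) \<in> K"
  shows "k * norm (snd c (\<gamma> b) - snd c (\<gamma> a)) \<le> curve_length A g \<gamma> a b"
proof -
  obtain N where N: "finite N" "\<And>t. t \<in> {a..b} - N \<Longrightarrow> isCont \<gamma> t"
    "\<And>t c. t \<in> {a..b} - N \<Longrightarrow> c \<in> A \<Longrightarrow> \<gamma> t \<in> fst c \<Longrightarrow>
      ((snd c \<circ> \<gamma>) has_vector_derivative vector_derivative (snd c \<circ> \<gamma>) (at t)) (at t)"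
    using piecewise_C1_regular[OF \<gamma>(1)] by blast
  \<comment> \<open>Set to 0 on \<open>N\<close>, like \<open>s\<close> below, so that the pointwise
    bound holds at every \<open>t\<close>.\<close>
  define D where "D t = (if t \<in> N then 0 else vector_derivative (snd c \<circ> \<gamma>) (at t))" for t
  have "continuous_on {a..b} (snd c \<circ> \<gamma>)"
    using \<gamma>(1) K(1) unfolding o_def piecewise_C1_curve_def
    by (intro continuous_on_compose2[OF chart_continuous[OF atlas c]]) auto
  moreover have der: "((snd c \<circ> \<gamma>) has_vector_derivative D t) (at t)" if "t \<in> {a..b} - N" for t
    using that N(3)[OF that c K(1)] by (auto simp: D_def)
  ultimately have I: "(D has_integral ((snd c \<circ> \<gamma>) b - (snd c \<circ> \<gamma>) a)) {a..b}"
    by (intro fundamental_theorem_of_calculus_interior_strong[OF N(1) \<gamma>(2)] der) auto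
  define s where "s t = (if t \<in> N then 0 else speed A g \<gamma> t)" for t
  have s: "s integrable_on {a..b}" "integral {a..b} s = curve_length A g \<gamma> a b"
    unfolding curve_length_speed
    by (rule integrable_spike_finite[OF N(1) _ speed_integrable[OF atlas metric \<gamma>(1)]], simp add: s_def)
      (rule integral_spike[OF negligible_finite[OF N(1)]], simp add: s_def)
  have bound: "norm (D t) \<le> s t / k" if t: "t \<in> {a..b}" for t
  proof (cases "t \<in> N")
    case False
    then have "k * norm (D t) \<le> speed A g \<gamma> t"
      using k(2)[OF K(1)[OF t] K(2)[OF t], of "D t"] t False der
      by (subst speed_chart[OF atlas metric c K(1)[OF t] N(2), of "D t"]) auto
    then show ?thesis using False k(1) by (simp add: s_def field_simps)
  qed (simp add: D_def s_def)
  have "norm (integral {a..b} D) \<le> integral {a..b} (\<lambda>t. s t / k)"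
    using I integrable_on_divide[OF s(1), of k] bound
    by (intro Henstock_Kurzweil_Integration.integral_norm_bound_integral) auto
  then show ?thesis
    using k(1) s(2) integral_unique[OF I] by (simp add: field_simps)
qed

text \<open>A curve ending at the centre of a compact coordinate ball but not contained in it has to run
  the last part of its way, from the boundary to the centre, inside the ball; this takes a definite
  length because the metric dominates a multiple of the Euclidean one there.\<close>

lemma short_curves_bounded_below:
  assumes f: "smooth_fun A f" "\<And>p. f p > 0"
  obtains r \<delta> where "r > 0" "\<delta> > 0"
    "\<And>\<gamma> a b q t. \<lbrakk>joins A \<gamma> a b q p; curve_length A g \<gamma> a b < r; t \<in> {a..b}\<rbrakk> \<Longrightarrow> f (\<gamma> t) \<ge> \<delta>"
proof -
  obtain c where c: "c \<in> A" "p \<in> fst c" using chart_cover[OF atlas] by blast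
  obtain e where e: "e > 0" "cball (snd c p) e \<subseteq> snd c ` fst c"
    using chart_image_open[OF atlas c(1)] c(2) open_contains_cball by blast
  let ?K = "cball (snd c p) e"
  have "continuous_on ?K (f \<circ> chart_inv c)"
    using f(1) c(1) e(2) smooth_on_continuous continuous_on_subset unfolding smooth_fun_def by blast
  then obtain z where z: "z \<in> ?K" "\<And>y. y \<in> ?K \<Longrightarrow> f (chart_inv c z) \<le> f (chart_inv c y)"
    using continuous_attains_inf[of ?K "f \<circ> chart_inv c"] e(1) by auto
  obtain k where k: "k > 0" "\<And>p v. p \<in> fst c \<Longrightarrow> snd c p \<in> ?K \<Longrightarrow>
      k * norm v \<le> sqrt (\<Sum>i\<in>Basis. \<Sum>j\<in>Basis. metric_comp A g c i j p * (v \<bullet> i) * (v \<bullet> j))"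
    using chart_norm_bound[OF c(1) compact_cball e(2)] by blast
  \<comment> \<open>\<open>k * e\<close> is a lower bound for the cost of crossing from the boundary
    of the ball to its centre: the Euclidean radius \<open>e\<close> times the factor
    \<open>k\<close>.\<close>
  have stay: "\<gamma> t \<in> chart_inv c ` ball (snd c p) e"
    if \<gamma>: "joins A \<gamma> a b q p" "curve_length A g \<gamma> a b < k * e" and t: "t \<in> {a..b}" for \<gamma> a b q t
  proof (rule ccontr)
    assume out: "\<gamma> t \<notin> chart_inv c ` ball (snd c p) e"
    have ball_open: "open (chart_inv c ` ball (snd c p) e)"
      using e(2) by (intro chart_inv_image_open[OF atlas c(1)]) auto
    have pw: "piecewise_C1_curve A \<gamma> a b" and cont: "continuous_on {a..b} \<gamma>" and end_p: "\<gamma> b = p" "a < b"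
      using \<gamma>(1) by (auto simp: joins_def piecewise_C1_curve_def)
    \<comment> \<open>The times spent outside the open ball. The last of them, \<open>s\<close>, is
      where the final run to the centre begins.\<close>
    define T where "T = {a..b} \<inter> \<gamma> -` (- chart_inv c ` ball (snd c p) e)"
    have "closed T"
      unfolding T_def using ball_open cont by (intro continuous_closed_preimage) auto
    moreover have "T \<subseteq> {a..b}" by (auto simp: T_def)
    ultimately have "compact T" by (metis compact_Icc compact_Int_closed inf.absorb_iff2)
    moreover have "t \<in> T" using out t by (simp add: T_def)
    ultimately obtain s where s: "s \<in> T" "\<And>u. u \<in> T \<Longrightarrow> u \<le> s"
      using compact_attains_sup[of T] by blast
    have p_in: "p \<in> chart_inv c ` ball (snd c p) e"
      using e(1) chart_inv_chart[OF atlas c] by (intro image_eqI[of _ _ "snd c p"]) auto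
    have s_ab: "a \<le> s" "s < b" using s(1) p_in end_p by (auto simp: T_def less_le)
    have after: "\<gamma> u \<in> chart_inv c ` ball (snd c p) e" if "u \<in> {s<..b}" for u
    proof (rule ccontr)
      assume "\<gamma> u \<notin> chart_inv c ` ball (snd c p) e"
      then have "u \<in> T" using that s_ab unfolding T_def by auto
      then show False using s(2) that by fastforce
    qed
    \<comment> \<open>A compact set is closed in a Hausdorff space. Thus \<open>\<gamma> s\<close>,
      a limit of points of the ball, lies in the closed ball and in particular in the chart
      domain.\<close>
    have "compact (chart_inv c ` ?K)"
      by (intro compact_continuous_image continuous_on_subset[OF chart_inv_continuous[OF atlas c(1)]] e(2) compact_cball)
    then have K_closed: "closed (chart_inv c ` ?K)" by (rule compact_imp_closed)
    have "continuous_on {s..b} \<gamma>" using cont s_ab by (auto intro: continuous_on_subset)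
    then have "closed ({s..b} \<inter> \<gamma> -` (chart_inv c ` ?K))"
      using K_closed by (intro continuous_closed_preimage) auto
    moreover have "{s<..b} \<subseteq> {s..b} \<inter> \<gamma> -` (chart_inv c ` ?K)"
      using after by (force simp: subset_iff)
    ultimately have "closure {s<..b} \<subseteq> {s..b} \<inter> \<gamma> -` (chart_inv c ` ?K)"
      by (rule closure_minimal[rotated])
    then have in_K: "\<gamma> u \<in> chart_inv c ` ?K" if "u \<in> {s..b}" for u
      using that s_ab by (auto simp: closure_greaterThanAtMost)
    have dom: "\<gamma> u \<in> fst c" "snd c (\<gamma> u) \<in> ?K" if u: "u \<in> {s..b}" for u
    proof -
      obtain y where y: "y \<in> ?K" "\<gamma> u = chart_inv c y" using in_K[OF u] by blast
      then show "\<gamma> u \<in> fst c" "snd c (\<gamma> u) \<in> ?K"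
        using chart_inv_in_domain[OF atlas c(1), of y] chart_chart_inv[OF atlas c(1), of y] e(2) by auto
    qed
    have "snd c (\<gamma> s) \<notin> ball (snd c p) e"
    proof
      assume "snd c (\<gamma> s) \<in> ball (snd c p) e"
      then have "\<gamma> s \<in> chart_inv c ` ball (snd c p) e"
        using chart_inv_chart[OF atlas c(1) dom(1)[of s]] s_ab by (intro image_eqI[of _ _ "snd c (\<gamma> s)"]) auto
      then show False using s(1) by (simp add: T_def)
    qed
    then have "e \<le> norm (snd c (\<gamma> b) - snd c (\<gamma> s))" by (simp add: end_p dist_norm)
    then have "k * e \<le> k * norm (snd c (\<gamma> b) - snd c (\<gamma> s))" using k(1) by simp
    also have "\<dots> \<le> curve_length A g \<gamma> s b"
    proof (rule chart_displacement_bound[where K = ?K, OF c(1) k(1)])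
      show "piecewise_C1_curve A \<gamma> s b" "s \<le> b"
        using s_ab piecewise_C1_subinterval[OF pw s_ab(1), of b] by auto
    qed (fact k(2) dom)+
    also have "\<dots> \<le> curve_length A g \<gamma> a b"
      using curve_length_split[OF atlas metric pw, of s] s_ab
        curve_length_nonneg[OF atlas metric piecewise_C1_subinterval[OF pw order_refl, of s]] by simp
    finally show False using \<gamma>(2) by simp
  qed
  show thesis
  \<comment> \<open>The second witness is the minimum of \<open>f\<close> on the closed coordinate
    ball.\<close>
  proof (rule that[of "k * e" "f (chart_inv c z)"])
    show "f (\<gamma> t) \<ge> f (chart_inv c z)"
      if "joins A \<gamma> a b q p" "curve_length A g \<gamma> a b < k * e" "t \<in> {a..b}" for \<gamma> a b q t
      using stay[OF that] z(2) by auto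
  qed (use k(1) e(1) f(2) in auto)
qed

end

section \<open>Completeness of warped products\<close>

text \<open>\<open>C1_curve\<close> wants one continuous derivative on the whole part of the curve
  inside a chart, while projections of curves provide derivatives only locally. On a nondegenerate
  interval derivatives are unique, so the local ones glue to \<open>D0\<close>.\<close>

lemma C1_curve_localI:
  assumes "a < b" and cont: "continuous_on {a..b} \<delta>"
    and loc: "\<And>c t. \<lbrakk>c \<in> A; t \<in> {a..b}; \<delta> t \<in> fst c\<rbrakk> \<Longrightarrow>
      \<exists>T D. open T \<and> t \<in> T \<and> continuous_on ({a..b} \<inter> T) D \<and>
        (\<forall>s\<in>{a..b} \<inter> T. ((snd c \<circ> \<delta>) has_vector_derivative D s) (at s within {a..b}))"
  shows "C1_curve A \<delta> a b"
  unfolding C1_curve_def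
proof (intro conjI ballI)
  show "continuous_on {a..b} \<delta>" by (rule cont)
  fix c assume c: "c \<in> A"
  define D0 where "D0 s = vector_derivative (snd c \<circ> \<delta>) (at s within {a..b})" for s
  have D0: "D0 s = D" if "s \<in> {a..b}" "((snd c \<circ> \<delta>) has_vector_derivative D) (at s within {a..b})" for s D
    unfolding D0_def using vector_derivative_within_cbox[OF assms(1)] that by simp
  let ?X = "{t \<in> {a..b}. \<delta> t \<in> fst c}"
  have "continuous (at t within ?X) D0" if t: "t \<in> ?X" for t
  proof -
    obtain T D where T: "open T" "t \<in> T" "continuous_on ({a..b} \<inter> T) D"
      "\<And>s. s \<in> {a..b} \<inter> T \<Longrightarrow> ((snd c \<circ> \<delta>) has_vector_derivative D s) (at s within {a..b})"
      using loc[OF c, of t] t by blast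
    have "D s = D0 s" if "s \<in> {a..b} \<inter> T" for s
      using D0[OF _ T(4)[OF that]] that by simp
    then have "continuous_on ({a..b} \<inter> T) D0"
      by (rule continuous_on_eq[OF T(3)])
    then have "continuous (at t within {a..b} \<inter> T) D0"
      using t T(2) by (simp add: continuous_on_eq_continuous_within)
    then have "continuous (at t within ?X \<inter> T) D0"
      by (rule continuous_within_subset) auto
    moreover have "at t within ?X = at t within ?X \<inter> T"
      using T(1,2) by (intro at_within_nhd[of t T]) auto
    ultimately show ?thesis by simp
  qed
  then have "continuous_on ?X D0" by (simp add: continuous_on_eq_continuous_within)
  moreover have "((snd c \<circ> \<delta>) has_vector_derivative D0 t) (at t within {a..b})"
    if t: "t \<in> {a..b}" "\<delta> t \<in> fst c" for t
  proof -
    obtain D where "((snd c \<circ> \<delta>) has_vector_derivative D) (at t within {a..b})"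
      using loc[OF c t] t(1) by blast
    then show ?thesis using D0[OF t(1)] by simp
  qed
  ultimately show "\<exists>D. continuous_on ?X D \<and>
      (\<forall>t\<in>{a..b}. \<delta> t \<in> fst c \<longrightarrow> ((snd c \<circ> \<delta>) has_vector_derivative D t) (at t within {a..b}))"
    by blast
qed

text \<open>A chart of one factor has to be paired with a chart of the other, and the latter changes
  along the curve; hence a statement near a single \<open>t\<close>.\<close>

lemma prod_curve_local:
  assumes A: "smooth_atlas A" and C: "smooth_atlas C"
    and \<gamma>: "C1_curve (prod_atlas A C) \<gamma> a b" and x: "x \<in> A" and y: "y \<in> C"
    and t: "t \<in> {a..b}" "fst (\<gamma> t) \<in> fst x" "snd (\<gamma> t) \<in> fst y"
  obtains T D where "open T" "t \<in> T" "continuous_on ({a..b} \<inter> T) D"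
    "\<And>s. s \<in> {a..b} \<inter> T \<Longrightarrow>
      ((\<lambda>s. (snd x (fst (\<gamma> s)), snd y (snd (\<gamma> s)))) has_vector_derivative D s) (at s within {a..b})"
proof -
  have cont: "continuous_on {a..b} \<gamma>" using \<gamma> by (simp add: C1_curve_def)
  have "open (fst x \<times> fst y)"
    by (intro open_Times chart_domain_open[OF A x] chart_domain_open[OF C y])
  then obtain T where T: "open T" "T \<inter> {a..b} = \<gamma> -` (fst x \<times> fst y) \<inter> {a..b}"
    using cont unfolding continuous_on_open_invariant by blast
  have "\<exists>D. continuous_on {t\<in>{a..b}. \<gamma> t \<in> fst x \<times> fst y} D \<and>
      (\<forall>t\<in>{a..b}. \<gamma> t \<in> fst x \<times> fst y \<longrightarrow>
        ((map_prod (snd x) (snd y) \<circ> \<gamma>) has_vector_derivative D t) (at t within {a..b}))"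
    using bspec[OF conjunct2[OF \<gamma>[unfolded C1_curve_def]] prod_chart_in_atlas[OF x y]]
    by (simp only: fst_conv snd_conv)
  then obtain D where D: "continuous_on {t\<in>{a..b}. \<gamma> t \<in> fst x \<times> fst y} D \<and>
      (\<forall>t\<in>{a..b}. \<gamma> t \<in> fst x \<times> fst y \<longrightarrow>
        ((map_prod (snd x) (snd y) \<circ> \<gamma>) has_vector_derivative D t) (at t within {a..b}))" ..
  have eq: "{t\<in>{a..b}. \<gamma> t \<in> fst x \<times> fst y} = {a..b} \<inter> T"
    unfolding Int_commute[of "{a..b}" T] T(2) by blast
  have mem: "s \<in> T \<longleftrightarrow> \<gamma> s \<in> fst x \<times> fst y" if "s \<in> {a..b}" for s
    using that eqset_imp_iff[OF T(2), of s] by (simp only: Int_iff vimage_eq simp_thms)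
  have map: "map_prod (snd x) (snd y) \<circ> \<gamma> = (\<lambda>s. (snd x (fst (\<gamma> s)), snd y (snd (\<gamma> s))))"
    by (auto simp: fun_eq_iff map_prod_def case_prod_beta)
  show thesis
  proof (rule that[OF T(1) _ conjunct1[OF D, unfolded eq]])
    show "t \<in> T" using mem[OF t(1)] t(2,3) by (simp add: mem_Times_iff)
    show "((\<lambda>s. (snd x (fst (\<gamma> s)), snd y (snd (\<gamma> s)))) has_vector_derivative D s) (at s within {a..b})"
      if "s \<in> {a..b} \<inter> T" for s
      using bspec[OF conjunct2[OF D], of s] that mem[of s] unfolding map by blast
  qed
qed

lemma C1_curve_fst:
  assumes A: "smooth_atlas A" and C: "smooth_atlas C"
    and \<gamma>: "C1_curve (prod_atlas A C) \<gamma> a b" and ab: "a < b"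
  shows "C1_curve A (fst \<circ> \<gamma>) a b"
proof (rule C1_curve_localI[OF ab])
  show "continuous_on {a..b} (fst \<circ> \<gamma>)"
    using \<gamma> by (auto simp: C1_curve_def o_def intro: continuous_on_fst)
  fix x t assume x: "x \<in> A" and t: "t \<in> {a..b}" "(fst \<circ> \<gamma>) t \<in> fst x"
  obtain y where y: "y \<in> C" "snd (\<gamma> t) \<in> fst y" using chart_cover[OF C] by blast
  obtain T D where T: "open T" "t \<in> T" "continuous_on ({a..b} \<inter> T) D"
    "\<And>s. s \<in> {a..b} \<inter> T \<Longrightarrow>
      ((\<lambda>s. (snd x (fst (\<gamma> s)), snd y (snd (\<gamma> s)))) has_vector_derivative D s) (at s within {a..b})"
    using prod_curve_local[OF A C \<gamma> x y(1) t(1) _ y(2)] t(2) by auto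
  show "\<exists>T D. open T \<and> t \<in> T \<and> continuous_on ({a..b} \<inter> T) D \<and>
      (\<forall>s\<in>{a..b} \<inter> T. ((snd x \<circ> (fst \<circ> \<gamma>)) has_vector_derivative D s) (at s within {a..b}))"
    using T(1,2) continuous_on_fst[OF T(3)] bounded_linear.has_vector_derivative[OF bounded_linear_fst T(4)]
    by (intro exI[of _ T] exI[of _ "\<lambda>s. fst (D s)"]) (auto simp: o_def)
qed

lemma C1_curve_snd:
  assumes A: "smooth_atlas A" and C: "smooth_atlas C"
    and \<gamma>: "C1_curve (prod_atlas A C) \<gamma> a b" and ab: "a < b"
  shows "C1_curve C (snd \<circ> \<gamma>) a b"
proof (rule C1_curve_localI[OF ab])
  show "continuous_on {a..b} (snd \<circ> \<gamma>)"
    using \<gamma> by (auto simp: C1_curve_def o_def intro: continuous_on_snd)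
  fix y t assume y: "y \<in> C" and t: "t \<in> {a..b}" "(snd \<circ> \<gamma>) t \<in> fst y"
  obtain x where x: "x \<in> A" "fst (\<gamma> t) \<in> fst x" using chart_cover[OF A] by blast
  obtain T D where T: "open T" "t \<in> T" "continuous_on ({a..b} \<inter> T) D"
    "\<And>s. s \<in> {a..b} \<inter> T \<Longrightarrow>
      ((\<lambda>s. (snd x (fst (\<gamma> s)), snd y (snd (\<gamma> s)))) has_vector_derivative D s) (at s within {a..b})"
    using prod_curve_local[OF A C \<gamma> x(1) y t(1) x(2)] t(2) by auto
  show "\<exists>T D. open T \<and> t \<in> T \<and> continuous_on ({a..b} \<inter> T) D \<and>
      (\<forall>s\<in>{a..b} \<inter> T. ((snd y \<circ> (snd \<circ> \<gamma>)) has_vector_derivative D s) (at s within {a..b}))"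
    using T(1,2) continuous_on_snd[OF T(3)] bounded_linear.has_vector_derivative[OF bounded_linear_snd T(4)]
    by (intro exI[of _ T] exI[of _ "\<lambda>s. snd (D s)"]) (auto simp: o_def)
qed

lemma C1_curve_horizontal:
  assumes "C1_curve A \<gamma> a b"
  shows "C1_curve (prod_atlas A C) (\<lambda>t. (\<gamma> t, q)) a b"
  unfolding C1_curve_def
proof (intro conjI ballI)
  show "continuous_on {a..b} (\<lambda>t. (\<gamma> t, q))"
    using assms by (intro continuous_on_Pair continuous_on_const) (simp add: C1_curve_def)
  fix c assume "c \<in> prod_atlas A C"
  then obtain x y where c: "c = prod_chart x y" and x: "x \<in> A" by (rule prod_atlas_cases)
  obtain D where D: "continuous_on {t\<in>{a..b}. \<gamma> t \<in> fst x} D"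
    "\<And>t. t \<in> {a..b} \<Longrightarrow> \<gamma> t \<in> fst x \<Longrightarrow> ((snd x \<circ> \<gamma>) has_vector_derivative D t) (at t within {a..b})"
    using assms x unfolding C1_curve_def by blast
  show "\<exists>D. continuous_on {t \<in> {a..b}. (\<gamma> t, q) \<in> fst c} D \<and>
      (\<forall>t\<in>{a..b}. (\<gamma> t, q) \<in> fst c \<longrightarrow>
        ((snd c \<circ> (\<lambda>t. (\<gamma> t, q))) has_vector_derivative D t) (at t within {a..b}))"
  proof (intro exI[of _ "\<lambda>t. (D t, 0)"] conjI ballI impI)
    show "continuous_on {t \<in> {a..b}. (\<gamma> t, q) \<in> fst c} (\<lambda>t. (D t, 0))"
      by (intro continuous_on_Pair continuous_on_const continuous_on_subset[OF D(1)]) (auto simp: c)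
    show "((snd c \<circ> (\<lambda>t. (\<gamma> t, q))) has_vector_derivative (D t, 0)) (at t within {a..b})"
      if "t \<in> {a..b}" "(\<gamma> t, q) \<in> fst c" for t
      using has_vector_derivative_Pair[OF D(2)[OF that(1)] has_vector_derivative_const[of "snd y q"]] that(2)
      by (simp add: c o_def)
  qed
qed

lemma C1_curve_vertical:
  assumes "C1_curve C \<gamma> a b"
  shows "C1_curve (prod_atlas A C) (\<lambda>t. (p, \<gamma> t)) a b"
  unfolding C1_curve_def
proof (intro conjI ballI)
  show "continuous_on {a..b} (\<lambda>t. (p, \<gamma> t))"
    using assms by (intro continuous_on_Pair continuous_on_const) (simp add: C1_curve_def)
  fix c assume "c \<in> prod_atlas A C"
  then obtain x y where c: "c = prod_chart x y" and y: "y \<in> C" by (rule prod_atlas_cases)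
  obtain D where D: "continuous_on {t\<in>{a..b}. \<gamma> t \<in> fst y} D"
    "\<And>t. t \<in> {a..b} \<Longrightarrow> \<gamma> t \<in> fst y \<Longrightarrow> ((snd y \<circ> \<gamma>) has_vector_derivative D t) (at t within {a..b})"
    using assms y unfolding C1_curve_def by blast
  show "\<exists>D. continuous_on {t \<in> {a..b}. (p, \<gamma> t) \<in> fst c} D \<and>
      (\<forall>t\<in>{a..b}. (p, \<gamma> t) \<in> fst c \<longrightarrow>
        ((snd c \<circ> (\<lambda>t. (p, \<gamma> t))) has_vector_derivative D t) (at t within {a..b}))"
  proof (intro exI[of _ "\<lambda>t. (0, D t)"] conjI ballI impI)
    show "continuous_on {t \<in> {a..b}. (p, \<gamma> t) \<in> fst c} (\<lambda>t. (0, D t))"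
      by (intro continuous_on_Pair continuous_on_const continuous_on_subset[OF D(1)]) (auto simp: c)
    show "((snd c \<circ> (\<lambda>t. (p, \<gamma> t))) has_vector_derivative (0, D t)) (at t within {a..b})"
      if "t \<in> {a..b}" "(p, \<gamma> t) \<in> fst c" for t
      using has_vector_derivative_Pair[OF has_vector_derivative_const[of "snd x p"] D(2)[OF that(1)]] that(2)
      by (simp add: c o_def)
  qed
qed

lemma piecewise_C1_transfer:
  assumes "piecewise_C1_curve A \<gamma> a b" "continuous_on {a..b} \<gamma> \<Longrightarrow> continuous_on {a..b} \<delta>"
    and "\<And>s t. s < t \<Longrightarrow> C1_curve A \<gamma> s t \<Longrightarrow> C1_curve C \<delta> s t"
  shows "piecewise_C1_curve C \<delta> a b"
  using assms unfolding piecewise_C1_curve_def by metis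

lemma velocity_const: "velocity A (\<lambda>_. p) t = (\<lambda>_. 0)"
  by (auto simp: velocity_def o_def)

text \<open>Both sides unfold to the derivative of \<open>h\<close> composed with the projected
  curve, so they agree at every \<open>t\<close>, regular or not.\<close>

lemma push_forward_velocity:
  assumes A: "smooth_atlas A" and C: "smooth_atlas C"
  shows "push_forward A fst (\<gamma> t) (velocity (prod_atlas A C) \<gamma> t) = velocity A (fst \<circ> \<gamma>) t"
    and "push_forward C snd (\<gamma> t) (velocity (prod_atlas A C) \<gamma> t) = velocity C (snd \<circ> \<gamma>) t"
  using smooth_at_fst[OF A C, of _ "\<gamma> t"] smooth_at_snd[OF A C, of _ "\<gamma> t"]
  by (auto simp: push_forward_def velocity_def o_assoc)

lemma speed_warped:
  assumes A: "smooth_atlas A" and C: "smooth_atlas C"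
  shows "speed (prod_atlas A C) (warped_metric A gA f C gC) \<gamma> t =
    sqrt (gA (fst (\<gamma> t)) (velocity A (fst \<circ> \<gamma>) t) (velocity A (fst \<circ> \<gamma>) t) +
      (f (fst (\<gamma> t)))\<^sup>2 * gC (snd (\<gamma> t)) (velocity C (snd \<circ> \<gamma>) t) (velocity C (snd \<circ> \<gamma>) t))"
  unfolding speed_def warped_metric_def push_forward_velocity[OF A C] ..

section \<open>Distances and Cauchy sequences in a warped product\<close>

locale warped_product = A: riemannian A gA + C: riemannian C gC
  for A :: "('p::{t2_space,second_countable_topology}, 'a::euclidean_space) chart set" and gA
    and C :: "('q::{t2_space,second_countable_topology}, 'b::euclidean_space) chart set" and gC +
  fixes f :: "'p \<Rightarrow> real"
  assumes f_smooth: "smooth_fun A f" and f_pos: "\<And>p. f p > 0"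
begin

abbreviation "P \<equiv> prod_atlas A C"
abbreviation "gP \<equiv> warped_metric A gA f C gC"

lemma riemannian_manifold_warped: "riemannian_manifold P gP"
  unfolding riemannian_manifold_def
  using smooth_manifold_prod[of A C] riemannian_metric_warped[OF A.atlas A.metric C.atlas C.metric f_smooth f_pos]
    A.riemannian_manifold C.riemannian_manifold
  by (simp add: riemannian_manifold_def)

sublocale P: riemannian P gP
  by unfold_locales (rule riemannian_manifold_warped)

lemma joins_fst:
  assumes "joins P \<gamma> a b u v"
  shows "joins A (fst \<circ> \<gamma>) a b (fst u) (fst v)"
  using assms piecewise_C1_transfer[of P \<gamma> a b "fst \<circ> \<gamma>" A] C1_curve_fst[OF A.atlas C.atlas]
  by (auto simp: joins_def o_def intro: continuous_on_fst)

lemma joins_snd: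
  assumes "joins P \<gamma> a b u v"
  shows "joins C (snd \<circ> \<gamma>) a b (snd u) (snd v)"
  using assms piecewise_C1_transfer[of P \<gamma> a b "snd \<circ> \<gamma>" C] C1_curve_snd[OF A.atlas C.atlas]
  by (auto simp: joins_def o_def intro: continuous_on_snd)

text \<open>Off \<open>N1 \<union> N2\<close> both projected velocities are tangent vectors, so the
  squared speed is a sum of two nonnegative terms, and dropping either one gives an
  inequality.\<close>

lemma projection_lengths:
  assumes \<gamma>: "joins P \<gamma> a b u v"
  shows "curve_length A gA (fst \<circ> \<gamma>) a b \<le> curve_length P gP \<gamma> a b"
    and "\<lbrakk>\<delta> > 0; \<And>t. t \<in> {a..b} \<Longrightarrow> \<delta> \<le> f (fst (\<gamma> t))\<rbrakk> \<Longrightarrow>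
      \<delta> * curve_length C gC (snd \<circ> \<gamma>) a b \<le> curve_length P gP \<gamma> a b"
proof -
  have p1: "piecewise_C1_curve A (fst \<circ> \<gamma>) a b" and p2: "piecewise_C1_curve C (snd \<circ> \<gamma>) a b"
    and p: "piecewise_C1_curve P \<gamma> a b"
    using joins_fst[OF \<gamma>] joins_snd[OF \<gamma>] \<gamma> by (auto simp: joins_def)
  obtain N1 where N1: "finite N1" "\<And>t. t \<in> {a..b} - N1 \<Longrightarrow> velocity A (fst \<circ> \<gamma>) t \<in> tangent_space A ((fst \<circ> \<gamma>) t)"
    using velocity_in_tangent_space[OF A.atlas p1] by blast
  obtain N2 where N2: "finite N2" "\<And>t. t \<in> {a..b} - N2 \<Longrightarrow> velocity C (snd \<circ> \<gamma>) t \<in> tangent_space C ((snd \<circ> \<gamma>) t)"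
    using velocity_in_tangent_space[OF C.atlas p2] by blast
  define QA QC where "QA t = gA ((fst \<circ> \<gamma>) t) (velocity A (fst \<circ> \<gamma>) t) (velocity A (fst \<circ> \<gamma>) t)"
    and "QC t = gC ((snd \<circ> \<gamma>) t) (velocity C (snd \<circ> \<gamma>) t) (velocity C (snd \<circ> \<gamma>) t)" for t
  have QA: "QA t \<ge> 0" if "t \<in> {a..b} - (N1 \<union> N2)" for t
    unfolding QA_def using N1(2)[of t] that by (intro riemannian_metric_nonneg[OF A.metric]) auto
  have QC: "QC t \<ge> 0" if "t \<in> {a..b} - (N1 \<union> N2)" for t
    unfolding QC_def using N2(2)[of t] that by (intro riemannian_metric_nonneg[OF C.metric]) auto
  have speed: "speed P gP \<gamma> t = sqrt (QA t + (f (fst (\<gamma> t)))\<^sup>2 * QC t)" for t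
    using speed_warped[OF A.atlas C.atlas] by (simp add: QA_def QC_def)
  have fin: "finite (N1 \<union> N2)" using N1(1) N2(1) by simp
  note int = speed_integrable[OF A.atlas A.metric p1] speed_integrable[OF C.atlas C.metric p2]
    speed_integrable[OF P.atlas P.metric p]
  show "curve_length A gA (fst \<circ> \<gamma>) a b \<le> curve_length P gP \<gamma> a b"
    unfolding curve_length_speed
  proof (rule integral_le_except_finite[OF fin int(1,3)])
    fix t assume t: "t \<in> {a..b} - (N1 \<union> N2)"
    have "speed A gA (fst \<circ> \<gamma>) t = sqrt (QA t)" by (simp only: speed_def QA_def)
    then show "speed A gA (fst \<circ> \<gamma>) t \<le> speed P gP \<gamma> t"
      using QC[OF t] by (simp add: speed)
  qed
  assume \<delta>: "\<delta> > 0" "\<And>t. t \<in> {a..b} \<Longrightarrow> \<delta> \<le> f (fst (\<gamma> t))"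
  have "integral {a..b} (\<lambda>t. \<delta> * speed C gC (snd \<circ> \<gamma>) t) \<le> integral {a..b} (speed P gP \<gamma>)"
  proof (rule integral_le_except_finite[OF fin _ int(3)])
    show "(\<lambda>t. \<delta> * speed C gC (snd \<circ> \<gamma>) t) integrable_on {a..b}"
      using int(2) \<delta>(1) by simp
    fix t assume t: "t \<in> {a..b} - (N1 \<union> N2)"
    have "\<delta> * speed C gC (snd \<circ> \<gamma>) t = sqrt (\<delta>\<^sup>2 * QC t)"
      using \<delta>(1) by (simp add: speed_def QC_def real_sqrt_mult)
    also have "\<dots> \<le> sqrt (QA t + (f (fst (\<gamma> t)))\<^sup>2 * QC t)"
    proof -
      have "\<delta>\<^sup>2 \<le> (f (fst (\<gamma> t)))\<^sup>2" using \<delta> t by (intro power_mono) auto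
      then have "\<delta>\<^sup>2 * QC t \<le> (f (fst (\<gamma> t)))\<^sup>2 * QC t" using QC[OF t] by (rule mult_right_mono)
      then show ?thesis using QA[OF t] by simp
    qed
    finally show "\<delta> * speed C gC (snd \<circ> \<gamma>) t \<le> speed P gP \<gamma> t" by (simp add: speed)
  qed
  then show "\<delta> * curve_length C gC (snd \<circ> \<gamma>) a b \<le> curve_length P gP \<gamma> a b"
    by (simp add: curve_length_speed)
qed

lemma riem_dist_fst: "riem_dist A gA (fst u) (fst v) \<le> riem_dist P gP u v"
proof (rule field_le_epsilon)
  fix e :: real assume "e > 0"
  then obtain \<gamma> a b where \<gamma>: "joins P \<gamma> a b u v" "curve_length P gP \<gamma> a b < riem_dist P gP u v + e"
    using P.riem_dist_lessE[of u v "riem_dist P gP u v + e"] by auto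
  then show "riem_dist A gA (fst u) (fst v) \<le> riem_dist P gP u v + e"
    using A.riem_dist_le[OF joins_fst[OF \<gamma>(1)]] projection_lengths(1)[OF \<gamma>(1)] by simp
qed

text \<open>The lifted curve is constant in the fibre and so has the speed of the base
  curve.\<close>

lemma riem_dist_horizontal: "riem_dist P gP (p, q) (p', q) \<le> riem_dist A gA p p'"
proof (rule field_le_epsilon)
  fix e :: real assume "e > 0"
  then obtain \<gamma> a b where \<gamma>: "joins A \<gamma> a b p p'" "curve_length A gA \<gamma> a b < riem_dist A gA p p' + e"
    using A.riem_dist_lessE[of p p' "riem_dist A gA p p' + e"] by auto
  have "joins P (\<lambda>t. (\<gamma> t, q)) a b (p, q) (p', q)"
    unfolding joins_def
  proof (intro conjI)
    show "piecewise_C1_curve P (\<lambda>t. (\<gamma> t, q)) a b"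
    proof (rule piecewise_C1_transfer)
      show "piecewise_C1_curve A \<gamma> a b" using \<gamma>(1) by (simp add: joins_def)
    qed (rule continuous_on_Pair[OF _ continuous_on_const] C1_curve_horizontal, assumption)+
  qed (use \<gamma>(1) in \<open>auto simp: joins_def\<close>)
  moreover have "speed P gP (\<lambda>t. (\<gamma> t, q)) t = speed A gA \<gamma> t" for t
    unfolding speed_warped[OF A.atlas C.atlas]
    using riemannian_metric_zero[OF C.metric zero_in_tangent_space[OF C.atlas]]
    by (simp add: speed_def o_def velocity_const)
  then have "speed P gP (\<lambda>t. (\<gamma> t, q)) = speed A gA \<gamma>" by (rule ext)
  then have "curve_length P gP (\<lambda>t. (\<gamma> t, q)) a b = curve_length A gA \<gamma> a b"
    by (simp add: curve_length_speed)
  ultimately show "riem_dist P gP (p, q) (p', q) \<le> riem_dist A gA p p' + e"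
    using P.riem_dist_le \<gamma>(2) by fastforce
qed

lemma riem_dist_vertical: "riem_dist P gP (p, q) (p, q') \<le> f p * riem_dist C gC q q'"
proof (rule field_le_epsilon)
  fix e :: real assume e: "e > 0"
  \<comment> \<open>Lengths in the fibre over \<open>p\<close> are multiplied by \<open>f p\<close>,
    so the tolerance is divided by it beforehand.\<close>
  then have "e / f p > 0" using f_pos by simp
  then obtain \<gamma> a b where \<gamma>: "joins C \<gamma> a b q q'" "curve_length C gC \<gamma> a b < riem_dist C gC q q' + e / f p"
    using C.riem_dist_lessE[of q q' "riem_dist C gC q q' + e / f p"] by auto
  have "joins P (\<lambda>t. (p, \<gamma> t)) a b (p, q) (p, q')"
    unfolding joins_def
  proof (intro conjI)
    show "piecewise_C1_curve P (\<lambda>t. (p, \<gamma> t)) a b"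
    proof (rule piecewise_C1_transfer)
      show "piecewise_C1_curve C \<gamma> a b" using \<gamma>(1) by (simp add: joins_def)
    qed (rule continuous_on_Pair[OF continuous_on_const] C1_curve_vertical, assumption)+
  qed (use \<gamma>(1) in \<open>auto simp: joins_def\<close>)
  moreover have "speed P gP (\<lambda>t. (p, \<gamma> t)) t = f p * speed C gC \<gamma> t" for t
    unfolding speed_warped[OF A.atlas C.atlas]
    using riemannian_metric_zero[OF A.metric zero_in_tangent_space[OF A.atlas]] f_pos[of p]
    by (simp add: speed_def o_def velocity_const real_sqrt_mult)
  then have "speed P gP (\<lambda>t. (p, \<gamma> t)) = (\<lambda>t. f p * speed C gC \<gamma> t)" by (rule ext)
  then have "curve_length P gP (\<lambda>t. (p, \<gamma> t)) a b = f p * curve_length C gC \<gamma> a b"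
    by (simp add: curve_length_speed)
  ultimately have "riem_dist P gP (p, q) (p, q') \<le> f p * curve_length C gC \<gamma> a b"
    using P.riem_dist_le by fastforce
  also have "\<dots> \<le> f p * (riem_dist C gC q q' + e / f p)"
    using \<gamma>(2) f_pos[of p] by simp
  also have "\<dots> = f p * riem_dist C gC q q' + e"
    using f_pos[of p] by (simp add: field_simps)
  finally show "riem_dist P gP (p, q) (p, q') \<le> f p * riem_dist C gC q q' + e" .
qed

text \<open>The lower bound for \<open>f\<close> is available along short base curves that end at
  \<open>p\<close>. The projection of a short curve from \<open>u\<close> to \<open>v\<close> is
  therefore prolonged by a short curve from \<open>fst v\<close> to \<open>p\<close>; each takes
  half of the length allowed by \<open>short_curves_bounded_below\<close>.\<close>

lemma riem_dist_snd_locally_bounded: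
  obtains r \<delta> where "r > 0" "\<delta> > 0"
    "\<And>u v e. \<lbrakk>riem_dist A gA (fst v) p < r; riem_dist P gP u v < r; riem_dist P gP u v < \<delta> * e\<rbrakk> \<Longrightarrow>
      riem_dist C gC (snd u) (snd v) < e"
proof -
  obtain r \<delta> where r: "r > 0" "\<delta> > 0"
    "\<And>\<gamma> a b q t. \<lbrakk>joins A \<gamma> a b q p; curve_length A gA \<gamma> a b < r; t \<in> {a..b}\<rbrakk> \<Longrightarrow> f (\<gamma> t) \<ge> \<delta>"
    using A.short_curves_bounded_below[OF f_smooth f_pos] by blast
  show thesis
  proof (rule that[of "r / 2" \<delta>])
    fix u v e
    assume vp: "riem_dist A gA (fst v) p < r / 2" and uv: "riem_dist P gP u v < r / 2" "riem_dist P gP u v < \<delta> * e"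
    obtain \<sigma> c d where \<sigma>: "joins A \<sigma> c d (fst v) p" "curve_length A gA \<sigma> c d < r / 2"
      using A.riem_dist_lessE[OF vp] by blast
    obtain \<gamma> a b where \<gamma>: "joins P \<gamma> a b u v" "curve_length P gP \<gamma> a b < min (r / 2) (\<delta> * e)"
      using P.riem_dist_lessE[of u v "min (r / 2) (\<delta> * e)"] uv by auto
    obtain \<epsilon> s w where \<epsilon>: "joins A \<epsilon> s w (fst u) p"
      "curve_length A gA \<epsilon> s w = curve_length A gA (fst \<circ> \<gamma>) a b + curve_length A gA \<sigma> c d"
      "\<And>v. v \<in> {a..b} \<Longrightarrow> \<exists>x\<in>{s..w}. \<epsilon> x = (fst \<circ> \<gamma>) v"
      using joins_concat[OF A.atlas A.metric joins_fst[OF \<gamma>(1)] \<sigma>(1)] by metis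
    have "curve_length A gA \<epsilon> s w < r"
      using \<epsilon>(2) \<sigma>(2) \<gamma>(2) projection_lengths(1)[OF \<gamma>(1)] by simp
    then have "\<delta> \<le> f (fst (\<gamma> t))" if "t \<in> {a..b}" for t
      using \<epsilon>(3)[OF that] r(3)[OF \<epsilon>(1)] by fastforce
    then have "\<delta> * curve_length C gC (snd \<circ> \<gamma>) a b < \<delta> * e"
      using projection_lengths(2)[OF \<gamma>(1) r(2)] \<gamma>(2) by fastforce
    then show "riem_dist C gC (snd u) (snd v) < e"
      using C.riem_dist_le[OF joins_snd[OF \<gamma>(1)]] r(2) by simp
  qed (use r in auto)
qed

lemma complete_warped:
  assumes completeA: "complete_riemannian_manifold A gA" and completeC: "complete_riemannian_manifold C gC"
  shows "complete_riemannian_manifold P gP"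
  unfolding complete_riemannian_manifold_def
proof (intro conjI allI impI)
  show "riemannian_manifold P gP" by (rule riemannian_manifold_warped)
  fix s :: "nat \<Rightarrow> 'p \<times> 'q"
  assume cauchy: "\<forall>e>0. \<exists>N. \<forall>m\<ge>N. \<forall>n\<ge>N. riem_dist P gP (s m) (s n) < e"
  have "\<forall>e>0. \<exists>N. \<forall>m\<ge>N. \<forall>n\<ge>N. riem_dist A gA (fst (s m)) (fst (s n)) < e"
    using cauchy riem_dist_fst by (meson le_less_trans)
  then obtain p where p: "(\<lambda>n. riem_dist A gA (fst (s n)) p) \<longlonglongrightarrow> 0"
    using mp[OF spec[OF conjunct2[OF completeA[unfolded complete_riemannian_manifold_def]], of "\<lambda>n. fst (s n)"]]
    by blast
  obtain r \<delta> where r: "r > 0" "\<delta> > 0"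
    "\<And>u v e. \<lbrakk>riem_dist A gA (fst v) p < r; riem_dist P gP u v < r; riem_dist P gP u v < \<delta> * e\<rbrakk> \<Longrightarrow>
      riem_dist C gC (snd u) (snd v) < e"
    by (rule riem_dist_snd_locally_bounded) blast
  obtain N0 where N0: "\<And>n. n \<ge> N0 \<Longrightarrow> riem_dist A gA (fst (s n)) p < r"
    using order_tendstoD(2)[OF p r(1)] by (auto simp: eventually_sequentially)
  have "\<exists>N. \<forall>m\<ge>N. \<forall>n\<ge>N. riem_dist C gC (snd (s m)) (snd (s n)) < e" if e: "e > 0" for e
  proof -
    have "min r (\<delta> * e) > 0" using r e by simp
    then obtain N where N: "\<And>m n. \<lbrakk>m \<ge> N; n \<ge> N\<rbrakk> \<Longrightarrow> riem_dist P gP (s m) (s n) < min r (\<delta> * e)"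
      using cauchy by blast
    have "riem_dist C gC (snd (s m)) (snd (s n)) < e" if "m \<ge> max N N0" "n \<ge> max N N0" for m n
      using r(3)[OF N0[of n], of "s m" e] N[of m n] that by simp
    then show ?thesis by blast
  qed
  then have "\<forall>e>0. \<exists>N. \<forall>m\<ge>N. \<forall>n\<ge>N. riem_dist C gC (snd (s m)) (snd (s n)) < e" by blast
  then obtain q where q: "(\<lambda>n. riem_dist C gC (snd (s n)) q) \<longlonglongrightarrow> 0"
    using mp[OF spec[OF conjunct2[OF completeC[unfolded complete_riemannian_manifold_def]], of "\<lambda>n. snd (s n)"]]
    by blast
  have "(\<lambda>n. riem_dist A gA (fst (s n)) p + f p * riem_dist C gC (snd (s n)) q) \<longlonglongrightarrow> 0 + f p * 0"
    by (intro tendsto_intros p q)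
  then have lim: "(\<lambda>n. riem_dist A gA (fst (s n)) p + f p * riem_dist C gC (snd (s n)) q) \<longlonglongrightarrow> 0" by simp
  \<comment> \<open>Go horizontally from \<open>s n\<close> to the fibre over \<open>p\<close> and
    then inside that fibre, so that fibre distances are scaled by the fixed number
    \<open>f p\<close>.\<close>
  have le: "riem_dist P gP (s n) (p, q) \<le> riem_dist A gA (fst (s n)) p + f p * riem_dist C gC (snd (s n)) q" for n
    using P.riem_dist_triangle[of "s n" "(p, q)" "(p, snd (s n))"]
      riem_dist_horizontal[of "fst (s n)" "snd (s n)" p] riem_dist_vertical[of p "snd (s n)" q] by simp
  have "(\<lambda>n. riem_dist P gP (s n) (p, q)) \<longlonglongrightarrow> 0"
    by (rule tendsto_sandwich[OF _ _ tendsto_const lim]) (simp_all add: P.riem_dist_nonneg le)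
  then show "\<exists>u. (\<lambda>n. riem_dist P gP (s n) u) \<longlonglongrightarrow> 0" by blast
qed

end

section \<open>The soliton equation on the warped product\<close>

theorem theorem3:
  fixes B :: "('p::{t2_space,second_countable_topology}, 'a::euclidean_space) chart set"
    and F :: "('q::{t2_space,second_countable_topology}, 'b::euclidean_space) chart set"
    and gB :: "'p metric" and gF :: "'q metric"
    and f \<phi> :: "'p \<Rightarrow> real"
    and c lam \<mu> :: real and m :: nat
  assumes "complete_riemannian_manifold B gB"
    and "smooth_fun B f" and "\<And>p. f p > 0" and "smooth_fun B \<phi>"
    and "m > 1"
    and "\<And>x p i j. x \<in> B \<Longrightarrow> p \<in> fst x \<Longrightarrow> i \<in> Basis \<Longrightarrow> j \<in> Basis \<Longrightarrow>
           ricci B gB x i j p + hess B gB x \<phi> i j p =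
           lam * metric_comp B gB x i j p + real m / f p * hess B gB x f i j p"
    and "\<And>x p. x \<in> B \<Longrightarrow> p \<in> fst x \<Longrightarrow>
           2 * lam * \<phi> p - gB p (grad B gB x \<phi> p) (grad B gB x \<phi> p) + laplacian B gB x \<phi> p
             + real m / f p * gB p (grad B gB x \<phi> p) (grad B gB x f p) = c"
    and "\<And>x p. x \<in> B \<Longrightarrow> p \<in> fst x \<Longrightarrow>
           lam * (f p)\<^sup>2 + f p * laplacian B gB x f p
             + (real m - 1) * gB p (grad B gB x f p) (grad B gB x f p)
             - f p * gB p (grad B gB x \<phi> p) (grad B gB x f p) = \<mu>"
    and "complete_riemannian_manifold F gF"
    and "DIM('b) = m"
    and "\<And>x q i j. x \<in> F \<Longrightarrow> q \<in> fst x \<Longrightarrow> i \<in> Basis \<Longrightarrow> j \<in> Basis \<Longrightarrow>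
           ricci F gF x i j q = \<mu> * metric_comp F gF x i j q"
  shows "gradient_ricci_soliton (prod_atlas B F) (warped_metric B gB f F gF) (\<phi> \<circ> fst) lam"
proof -
  interpret warped_product B gB F gF f
    using assms(1,9) by unfold_locales (simp_all add: complete_riemannian_manifold_def assms(2,3))
  note B = A.atlas A.metric and F = C.atlas C.metric
  have "ricci P gP c I J u + hess P gP c (\<phi> \<circ> fst) I J u = lam * metric_comp P gP c I J u"
    if c: "c \<in> P" and u: "u \<in> fst c" and IJ: "I \<in> Basis" "J \<in> Basis" for c u I J
  proof -
    obtain x y where xy: "c = prod_chart x y" "x \<in> B" "y \<in> F"
      using c by (rule prod_atlas_cases)
    obtain p q where pq: "u = (p, q)" "p \<in> fst x" "q \<in> fst y"
      using u xy(1) by auto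
    show ?thesis
      unfolding xy(1) pq(1)
    \<comment> \<open>\<open>DIM('b) = m\<close> identifies the coefficient \<open>m\<close> of the
      given equations with the number of fibre directions that produce the Hessian of
      \<open>f\<close>.\<close>
    proof (rule ricci_hess_warped[OF B F assms(2,3,4) xy(2,3) pq(2,3) _ _ _ IJ])
      show "ricci B gB x i j p + hess B gB x \<phi> i j p =
          lam * metric_comp B gB x i j p + real DIM('b) / f p * hess B gB x f i j p"
        if "i \<in> Basis" "j \<in> Basis" for i j
        using assms(6)[OF xy(2) pq(2) that] by (simp only: assms(10))
      show "lam * (f p)\<^sup>2 + f p * laplacian B gB x f p
          + (real DIM('b) - 1) * gB p (grad B gB x f p) (grad B gB x f p)
          - f p * gB p (grad B gB x \<phi> p) (grad B gB x f p) = \<mu>"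
        using assms(8)[OF xy(2) pq(2)] by (simp only: assms(10))
      show "ricci F gF y a b q = \<mu> * metric_comp F gF y a b q" if "a \<in> Basis" "b \<in> Basis" for a b
        by (rule assms(11)[OF xy(3) pq(3) that])
    qed
  qed
  then show ?thesis
    unfolding gradient_ricci_soliton_def
    using complete_warped[OF assms(1,9)] smooth_fun_fst[OF A.atlas C.atlas assms(4)] by blast
qed

end
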